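(* There is an absolute constant $c>0$ such that the following holds. Let $\mathcal{T}$ be a set of $n$ points in $\mathbb{E}^3$ and let $k \ge 0$ be an integer such that no more than $n-k$ points of $\mathcal{T}$ lie on any single plane, and no more than $n-k$ points of $\mathcal{T}$ lie on the union of any pair of skew lines. Then $\mathcal{T}$ spans at least $c\, n k^2$ planes.
   Context: A plane is spanned by a point set if it passes through three points of the set that are not collinear. *)

theory Defs
  imports "HOL-Analysis.Analysis"
begin

definition line :: "(real ^ 3) set \<Rightarrow> bool" where
  "line L \<longleftrightarrow> affine L \<and> aff_dim L = 1"

definition plane :: "(real ^ 3) set \<Rightarrow> bool" where
  "plane P \<longleftrightarrow> affine P \<and> aff_dim P = 2"

definition skew_lines :: "(real ^ 3) set \<Rightarrow> (real ^ 3) set \<Rightarrow> bool" where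
  "skew_lines L M \<longleftrightarrow> line L \<and> line M \<and> \<not> coplanar (L \<union> M)"

definition spanned_planes :: "(real ^ 3) set \<Rightarrow> (real ^ 3) set set" where
  "spanned_planes T =
     {P. plane P \<and> (\<exists>x\<in>T \<inter> P. \<exists>y\<in>T \<inter> P. \<exists>z\<in>T \<inter> P. \<not> collinear {x, y, z})}"

end

(* The planar input is a weak form of Beck's theorem: if no line contains more than a small
   fraction of n points, the points span on the order of n^2 lines. It follows from the
   Szemeredi-Trotter bound for r-rich lines, proved by Szekely's crossing argument: join consecutive
   points on the rich lines by segments and compare the number of crossings, at most the square of
   the number of lines, with the crossing lemma. The crossing lemma needs only that a noncrossing
   straight-line graph has O(n) edges; to see this, charge the wedge between two edges that leave a
   vertex to the right and are adjacent in slope to the leftmost vertex inside that wedge.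

   For planes, let T have n points. If no plane is rich, many points p of T see linearly many
   directions, and Beck's theorem in the central projection from p gives of order n^2 planes through
   each such p, hence n^3 planes in total. If some plane P is rich but no line is, Beck's theorem in P
   gives n^2 lines, and coning them over the k or more points off P gives enough planes. If some line
   l is rich, let r be the number of points off l. Either a plane through l contains a positive
   fraction of these r points, and one cones again; or a line M skew to l does, and one uses the planes
   spanned by a point of l, a point of M and one of the k or more remaining points; or neither, and
   Beck's theorem in the projection from most points of l gives of order r^2 planes for each of them.
   Coincidences between planes are controlled throughout by the Cauchy-Schwarz inequality. *)

theory Submission
  imports Defs
begin

section \<open>Noncrossing straight-line graphs\<close>

text \<open>When a line l is rich, its points supply the factor n. One factor k comes from the r
  \<ge> k points off l, the other from the points that a plane or a pair of skew lines leaves out,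
  or again from r. The delicate case is the last one. Beck's theorem fails at a point x of l if a
  plane through x holds too many of the r points. If that plane does not contain l, it meets l in x
  alone, and two such planes at different points of l can meet only in a line skew to l. These lines
  are poor by assumption, so a second-moment count leaves a bounded number of bad points. The
  constants are not optimised. Each is chosen so that an error term (crossings, coincidences,
  discarded points, planes through l) costs at most a constant factor of the main term. The
  threshold for a rich line is \<open>beck_eps\<close> times that for a rich plane, so a rich plane
  without rich lines meets Beck's hypothesis.\<close>

type_synonym edge = "(real \<times> real) \<times> (real \<times> real)"

definition slope :: "edge \<Rightarrow> real" where
  "slope e = (snd (snd e) - snd (fst e)) / (fst (snd e) - fst (fst e))"

definition height :: "edge \<Rightarrow> real \<Rightarrow> real" where
  "height e x = snd (fst e) + slope e * (x - fst (fst e))"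

definition covers :: "edge \<Rightarrow> real \<Rightarrow> bool" where
  "covers e x \<longleftrightarrow> fst (fst e) \<le> x \<and> x \<le> fst (snd e)"

text \<open>The two segments strictly change order over their common range of abscissas. Touching,
  sharing an endpoint or overlapping along a line is thus no crossing, and a vertex may lie inside
  an edge.\<close>

definition crosses :: "edge \<Rightarrow> edge \<Rightarrow> bool" where
  "crosses e f \<longleftrightarrow> (\<exists>x y. covers e x \<and> covers f x \<and> covers e y \<and> covers f y \<and>
      height f x < height e x \<and> height e y < height f y)"

lemma crosses_sym: "crosses e f \<longleftrightarrow> crosses f e"
  unfolding crosses_def by blast

lemma height_shift: "height e x = height e y - slope e * (y - x)"
  unfolding height_def by (simp add: algebra_simps)

lemma height_left [simp]: "height e (fst (fst e)) = snd (fst e)"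
  unfolding height_def by simp

lemma height_right: "fst (fst e) < fst (snd e) \<Longrightarrow> height e (fst (snd e)) = snd (snd e)"
  unfolding height_def slope_def by simp

lemma height_less_left:
  assumes "height e y \<le> height f y" "slope f < slope e" "x < y"
  shows "height e x < height f x"
proof -
  have "slope f * (y - x) < slope e * (y - x)"
    using assms by (intro mult_strict_right_mono) auto
  then show ?thesis using assms(1) height_shift[of e x y] height_shift[of f x y] by linarith
qed

lemma height_less_right:
  assumes "height e x \<le> height f x" "slope e < slope f" "x < y"
  shows "height e y < height f y"
proof -
  have "slope e * (y - x) < slope f * (y - x)"
    using assms by (intro mult_strict_right_mono) auto
  then show ?thesis using assms(1) height_shift[of e x y] height_shift[of f x y] by linarith
qed

text \<open>Distinct abscissas let every edge point from left to right. Edges with different left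
  ends may overlap, but two edges leaving one vertex in the same direction are excluded: otherwise
  all pairs among n collinear points would form a noncrossing graph.\<close>

definition straight_graph :: "(real \<times> real) set \<Rightarrow> edge set \<Rightarrow> bool" where
  "straight_graph V E \<longleftrightarrow> finite V \<and> inj_on fst V \<and> E \<subseteq> V \<times> V \<and>
     (\<forall>e\<in>E. fst (fst e) < fst (snd e)) \<and>
     (\<forall>e\<in>E. \<forall>f\<in>E. fst e = fst f \<longrightarrow> slope e = slope f \<longrightarrow> e = f)"

section \<open>Wedges and the linear bound on noncrossing edges\<close>

text \<open>\<^term>\<open>w\<close> is the leftmost vertex in the closed wedge between two edges that are adjacent in slope.\<close>

definition wedge :: "(real \<times> real) set \<Rightarrow> edge set \<Rightarrow> edge \<Rightarrow> edge \<Rightarrow> real \<times> real \<Rightarrow> bool" where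
  "wedge V E e f w \<longleftrightarrow> e \<in> E \<and> f \<in> E \<and> fst f = fst e \<and> slope e < slope f \<and>
     (\<forall>g\<in>E. fst g = fst e \<longrightarrow> slope e < slope g \<longrightarrow> slope f \<le> slope g) \<and>
     w \<in> V \<and> fst (fst e) < fst w \<and> fst w \<le> fst (snd e) \<and> fst w \<le> fst (snd f) \<and>
     height e (fst w) \<le> snd w \<and> snd w \<le> height f (fst w) \<and>
     (\<forall>z\<in>V. fst (fst e) < fst z \<longrightarrow> fst z < fst w \<longrightarrow>
        \<not> (height e (fst z) \<le> snd z \<and> snd z \<le> height f (fst z)))"

text \<open>Let \<open>f\<close> be next above \<open>e\<close> in slope. Whichever of the two edges
  ends first has its right end in the closed wedge, so the wedge contains a leftmost vertex.\<close>

lemma wedge_exists: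
  assumes G: "straight_graph V E" and e: "e \<in> E" "g \<in> E" "fst g = fst e" "slope e < slope g"
  shows "\<exists>f w. wedge V E e f w"
proof -
  have fV: "finite V" and sub: "E \<subseteq> V \<times> V" and lr: "\<And>e. e \<in> E \<Longrightarrow> fst (fst e) < fst (snd e)"
    using G unfolding straight_graph_def by auto
  have fE: "finite E" using fV sub finite_subset by blast
  define U where "U = {g\<in>E. fst g = fst e \<and> slope e < slope g}"
  have U: "finite U" "U \<noteq> {}" using fE e unfolding U_def by (simp, blast)
  obtain f where f: "f \<in> U" "\<And>g. g \<in> U \<Longrightarrow> slope f \<le> slope g"
    using arg_min_if_finite(1)[OF U] arg_min_least[OF U] by blast
  define Rg where "Rg = {z\<in>V. fst (fst e) < fst z \<and> fst z \<le> fst (snd e) \<and> fst z \<le> fst (snd f) \<and>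
     height e (fst z) \<le> snd z \<and> snd z \<le> height f (fst z)}"
  have fe: "f \<in> E" "fst f = fst e" "slope e < slope f" using f unfolding U_def by auto
  have l1: "fst (fst e) < fst (snd e)" "fst (fst e) < fst (snd f)" using lr[OF e(1)] lr[OF fe(1)] fe by auto
  have h0: "height e (fst (fst e)) \<le> height f (fst (fst e))"
    using height_left[of e] height_left[of f] fe(2) by simp
  have "Rg \<noteq> {}"
  proof (cases "fst (snd e) \<le> fst (snd f)")
    case True
    have "snd e \<in> Rg" unfolding Rg_def
      using True l1 sub e(1) height_right[OF l1(1)] height_less_right[OF h0 fe(3) l1(1)] by auto
    then show ?thesis by auto
  next
    case False
    have l2: "fst (fst f) < fst (snd f)" using l1 fe by simp
    have "snd f \<in> Rg" unfolding Rg_def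
      using False l1 sub fe(1) height_right[OF l2] height_less_right[OF h0 fe(3) l1(2)] by auto
    then show ?thesis by auto
  qed
  moreover have "finite Rg" using fV unfolding Rg_def by auto
  ultimately obtain w where w: "w \<in> Rg" "\<And>z. z \<in> Rg \<Longrightarrow> fst w \<le> fst z"
    using arg_min_if_finite(1)[of Rg fst] arg_min_least[of Rg _ fst] by blast
  have "wedge V E e f w"
    unfolding wedge_def
  proof (intro conjI ballI impI notI)
    fix z assume z: "z \<in> V" "fst (fst e) < fst z" "fst z < fst w"
      "height e (fst z) \<le> snd z \<and> snd z \<le> height f (fst z)"
    then have "z \<in> Rg" using w(1) unfolding Rg_def by auto
    then show False using w(2) z by fastforce
  qed (use w f fe e in \<open>auto simp: Rg_def U_def\<close>)
  then show ?thesis by blast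
qed

text \<open>Left of \<open>w\<close> the edge \<open>e'\<close> of smaller slope runs above
  \<open>e\<close>, while at \<open>w\<close> it is below \<open>f\<close>. If \<open>e'\<close>
  starts left of the apex, it passes above the apex; if it starts right of the apex, its left end is
  a vertex above \<open>e\<close>, hence above \<open>f\<close> because \<open>w\<close> is
  leftmost. Either way \<open>e'\<close> crosses \<open>f\<close>.\<close>

lemma wedge_lower_step:
  assumes G: "straight_graph V E" and nc: "\<And>e f. e \<in> E \<Longrightarrow> f \<in> E \<Longrightarrow> \<not> crosses e f"
    and W: "wedge V E e f w" "wedge V E e' f' w"
    and h: "height e (fst w) = snd w" "height e' (fst w) = snd w" and s: "slope e' < slope e"
  shows False
proof -
  have inj: "inj_on fst V" and sub: "E \<subseteq> V \<times> V" using G unfolding straight_graph_def by auto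
  have w: "e \<in> E" "f \<in> E" "fst f = fst e" "slope e < slope f" "fst (fst e) < fst w"
     "fst w \<le> fst (snd e)" "fst w \<le> fst (snd f)" using W(1) unfolding wedge_def by auto
  have w': "e' \<in> E" "fst (fst e') < fst w" "fst w \<le> fst (snd e')" using W(2) unfolding wedge_def by auto
  have mn: "\<And>z. z \<in> V \<Longrightarrow> fst (fst e) < fst z \<Longrightarrow> fst z < fst w \<Longrightarrow> height e (fst z) \<le> snd z \<Longrightarrow>
      height f (fst z) < snd z" using W(1) unfolding wedge_def by force
  have V: "fst e \<in> V" "fst e' \<in> V" using sub w w' by auto
  have fw: "height e (fst w) < height f (fst w)"
    using w by (intro height_less_right[of e "fst (fst e)"]) (auto, metis height_left order_refl)
  have ab: "height e x < height e' x" if "x < fst w" for x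
    using height_less_left[of e "fst w" e' x] h s that by simp
  have "crosses e' f"
  proof (cases "fst (fst e') < fst (fst e)")
    case True
    have "height f (fst (fst e)) < height e' (fst (fst e))"
      using ab[OF w(5)] w(3) height_left[of f] by simp
    then show ?thesis unfolding crosses_def covers_def
      using True w w' fw h by (intro exI[of _ "fst (fst e)"] exI[of _ "fst w"]) auto
  next
    case False
    have a: "height e (fst (fst e')) < snd (fst e')" using ab[OF w'(2)] by simp
    have "fst (fst e') \<noteq> fst (fst e)"
    proof
      assume "fst (fst e') = fst (fst e)"
      then have "fst e' = fst e" using inj V by (auto dest: inj_onD)
      then show False using a height_left[of e] by simp
    qed
    then have "height f (fst (fst e')) < snd (fst e')" using False a w' V by (intro mn) auto
    then show ?thesis unfolding crosses_def covers_def
      using False w w' fw h by (intro exI[of _ "fst (fst e')"] exI[of _ "fst w"]) auto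
  qed
  then show False using nc w w' by blast
qed

text \<open>Reflection of \<open>wedge_lower_step\<close> in a horizontal line: the upper edges pass
  through \<open>w\<close>, and the one of larger slope crosses \<open>e\<close>.\<close>

lemma wedge_upper_step:
  assumes G: "straight_graph V E" and nc: "\<And>e f. e \<in> E \<Longrightarrow> f \<in> E \<Longrightarrow> \<not> crosses e f"
    and W: "wedge V E e f w" "wedge V E e' f' w"
    and h: "height f (fst w) = snd w" "height f' (fst w) = snd w" and s: "slope f < slope f'"
  shows False
proof -
  have inj: "inj_on fst V" and sub: "E \<subseteq> V \<times> V" using G unfolding straight_graph_def by auto
  have w: "e \<in> E" "f \<in> E" "fst f = fst e" "slope e < slope f" "fst (fst e) < fst w"
     "fst w \<le> fst (snd e)" "fst w \<le> fst (snd f)" using W(1) unfolding wedge_def by auto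
  have w': "f' \<in> E" "fst (fst f') < fst w" "fst w \<le> fst (snd f')" using W(2) unfolding wedge_def by auto
  have mn: "\<And>z. z \<in> V \<Longrightarrow> fst (fst e) < fst z \<Longrightarrow> fst z < fst w \<Longrightarrow> snd z \<le> height f (fst z) \<Longrightarrow>
      snd z < height e (fst z)" using W(1) unfolding wedge_def by force
  have V: "fst e \<in> V" "fst f' \<in> V" using sub w w' by auto
  have fw: "height e (fst w) < height f (fst w)"
    using w by (intro height_less_right[of e "fst (fst e)"]) (auto, metis height_left order_refl)
  have ab: "height f' x < height f x" if "x < fst w" for x
    using height_less_left[of f' "fst w" f x] h s that by simp
  have "crosses e f'"
  proof (cases "fst (fst f') < fst (fst e)")
    case True
    have "height f' (fst (fst e)) < height e (fst (fst e))"
      using ab[OF w(5)] w(3) height_left[of f] by simp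
    then show ?thesis unfolding crosses_def covers_def
      using True w w' fw h by (intro exI[of _ "fst (fst e)"] exI[of _ "fst w"]) auto
  next
    case False
    have a: "snd (fst f') < height f (fst (fst f'))" using ab[OF w'(2)] by simp
    have "fst (fst f') \<noteq> fst (fst e)"
    proof
      assume "fst (fst f') = fst (fst e)"
      then have "fst f' = fst f" using inj V w(3) by (auto dest: inj_onD)
      then show False using a height_left[of f] by simp
    qed
    then have "snd (fst f') < height e (fst (fst f'))" using False a w' V by (intro mn) auto
    then show ?thesis unfolding crosses_def covers_def
      using False w w' fw h by (intro exI[of _ "fst (fst f')"] exI[of _ "fst w"]) auto
  qed
  then show False using nc w w' by blast
qed

text \<open>The second apex has its abscissa between the first apex and \<open>w\<close>, so it lies
  outside the first wedge because \<open>w\<close> is leftmost there. Yet both wedges have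
  \<open>w\<close> strictly between their edges, so an edge of the second must cross an edge of the
  first.\<close>

lemma wedge_inner_step:
  assumes G: "straight_graph V E" and nc: "\<And>e f. e \<in> E \<Longrightarrow> f \<in> E \<Longrightarrow> \<not> crosses e f"
    and W: "wedge V E e f w" "wedge V E e' f' w"
    and h: "height e (fst w) < snd w" "snd w < height f (fst w)"
      "height e' (fst w) < snd w" "snd w < height f' (fst w)"
    and s: "fst (fst e) < fst (fst e')"
  shows False
proof -
  have sub: "E \<subseteq> V \<times> V" using G unfolding straight_graph_def by auto
  have w: "e \<in> E" "f \<in> E" "fst f = fst e" "slope e < slope f" "fst (fst e) < fst w"
     "fst w \<le> fst (snd e)" "fst w \<le> fst (snd f)" using W(1) unfolding wedge_def by auto
  have w': "e' \<in> E" "f' \<in> E" "fst f' = fst e'" "fst (fst e') < fst w"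
     "fst w \<le> fst (snd e')" "fst w \<le> fst (snd f')" using W(2) unfolding wedge_def by auto
  have V: "fst e' \<in> V" using sub w' by auto
  have hl: "height f' (fst (fst e')) = snd (fst e')" using height_left[of f'] w' by simp
  have "\<not> (height e (fst (fst e')) \<le> snd (fst e') \<and> snd (fst e') \<le> height f (fst (fst e')))"
    using W(1) V s w' unfolding wedge_def by blast
  then consider "snd (fst e') < height e (fst (fst e'))" | "height f (fst (fst e')) < snd (fst e')"
    by linarith
  then have "crosses e f' \<or> crosses e' f"
  proof cases
    case 1
    then have "crosses e f'" unfolding crosses_def covers_def
      using s w w' h hl by (intro exI[of _ "fst (fst e')"] exI[of _ "fst w"]) auto
    then show ?thesis ..
  next
    case 2
    then have "crosses e' f" unfolding crosses_def covers_def
      using s w w' h hl by (intro exI[of _ "fst (fst e')"] exI[of _ "fst w"]) auto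
    then show ?thesis ..
  qed
  then show False using nc w w' by blast
qed

text \<open>The slopes agree by \<open>wedge_lower_step\<close>, so both edges lie on one line. If
  the apexes differed, the right one would be a vertex of the other wedge to the left of
  \<open>w\<close>.\<close>

lemma wedge_lower_eq:
  assumes G: "straight_graph V E" and nc: "\<And>e f. e \<in> E \<Longrightarrow> f \<in> E \<Longrightarrow> \<not> crosses e f"
    and W: "wedge V E e f w" "wedge V E e' f' w"
    and h: "height e (fst w) = snd w" "height e' (fst w) = snd w"
  shows "e = e'"
proof -
  have no: False if W: "wedge V E e f w" "wedge V E e' f' w" and s: "slope e = slope e'"
      and h: "height e (fst w) = snd w" "height e' (fst w) = snd w"
      and l: "fst (fst e) < fst (fst e')" for e f e' f'
  proof -
    have eq: "height e x = height e' x" for x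
      using height_shift[of e x "fst w"] height_shift[of e' x "fst w"] h s by simp
    have V: "fst e' \<in> V" using W(2) G unfolding wedge_def straight_graph_def by auto
    have w: "fst f = fst e" "slope e < slope f" "fst (fst e') < fst w"
      using W unfolding wedge_def by auto
    have "height e (fst (fst e')) < height f (fst (fst e'))"
      using height_less_right[of e "fst (fst e)" f] l w height_left[of e] height_left[of f] by auto
    moreover have "height e (fst (fst e')) = snd (fst e')" using eq by simp
    ultimately show False using W(1) V w l unfolding wedge_def
      by (metis less_eq_real_def)
  qed
  have "slope e = slope e'"
    using wedge_lower_step[OF G nc W h] wedge_lower_step[OF G nc W(2,1) h(2,1)] by fastforce
  moreover from this have "fst (fst e) = fst (fst e')"
    using no[OF W _ h] no[OF W(2,1) _ h(2,1)] by fastforce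
  ultimately show ?thesis using W G unfolding wedge_def straight_graph_def
    by (metis inj_onD mem_Times_iff subsetD)
qed

text \<open>The upper edges agree in slope and apex as in the lower case. Adjacency in slope then
  leaves one candidate for the lower edge.\<close>

lemma wedge_upper_eq:
  assumes G: "straight_graph V E" and nc: "\<And>e f. e \<in> E \<Longrightarrow> f \<in> E \<Longrightarrow> \<not> crosses e f"
    and W: "wedge V E e f w" "wedge V E e' f' w"
    and h: "height f (fst w) = snd w" "height f' (fst w) = snd w"
  shows "e = e'"
proof -
  have no: False if W: "wedge V E e f w" "wedge V E e' f' w" and s: "slope f = slope f'"
      and h: "height f (fst w) = snd w" "height f' (fst w) = snd w"
      and l: "fst (fst e) < fst (fst e')" for e f e' f'
  proof -
    have eq: "height f x = height f' x" for x
      using height_shift[of f x "fst w"] height_shift[of f' x "fst w"] h s by simp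
    have V: "fst e' \<in> V" using W(2) G unfolding wedge_def straight_graph_def by auto
    have w: "fst f = fst e" "slope e < slope f" "fst (fst e') < fst w" "fst f' = fst e'"
      using W unfolding wedge_def by auto
    have "height e (fst (fst e')) < height f (fst (fst e'))"
      using height_less_right[of e "fst (fst e)" f] l w height_left[of e] height_left[of f] by auto
    moreover have "height f (fst (fst e')) = snd (fst e')" using eq height_left[of f'] w by simp
    ultimately show False using W(1) V w l unfolding wedge_def
      by (metis less_eq_real_def)
  qed
  have s: "slope f = slope f'"
    using wedge_upper_step[OF G nc W h] wedge_upper_step[OF G nc W(2,1) h(2,1)] by fastforce
  from this have "fst (fst e) = fst (fst e')"
    using no[OF W _ h] no[OF W(2,1) _ h(2,1)] by fastforce
  then have fe: "fst e = fst e'" using W G unfolding wedge_def straight_graph_def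
    by (metis inj_onD mem_Times_iff subsetD)
  have "\<not> slope e < slope e'" "\<not> slope e' < slope e"
    using W fe s unfolding wedge_def by force+
  then show ?thesis using W G fe unfolding wedge_def straight_graph_def by force
qed

text \<open>The apexes agree by \<open>wedge_inner_step\<close>, and different wedges at one apex
  have disjoint interiors because their edges are adjacent in slope.\<close>

lemma wedge_inner_eq:
  assumes G: "straight_graph V E" and nc: "\<And>e f. e \<in> E \<Longrightarrow> f \<in> E \<Longrightarrow> \<not> crosses e f"
    and W: "wedge V E e f w" "wedge V E e' f' w"
    and h: "height e (fst w) < snd w" "snd w < height f (fst w)"
      "height e' (fst w) < snd w" "snd w < height f' (fst w)"
  shows "e = e'"
proof -
  have no: False if W: "wedge V E e f w" "wedge V E e' f' w" and fe: "fst e = fst e'"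
    and h: "snd w < height f (fst w)" "height e' (fst w) < snd w" and s: "slope e < slope e'"
    for e f e' f'
  proof -
    have w: "slope f \<le> slope e'" "fst f = fst e'" "fst (fst e') < fst w"
      using W fe s unfolding wedge_def by auto
    have "height f (fst w) \<le> height e' (fst w)"
      using w unfolding height_def by (simp add: mult_right_mono)
    then show False using h by simp
  qed
  have "fst (fst e) = fst (fst e')"
    using wedge_inner_step[OF G nc W h] wedge_inner_step[OF G nc W(2,1) h(3,4,1,2)] by fastforce
  then have fe: "fst e = fst e'" using W G unfolding wedge_def straight_graph_def
    by (metis inj_onD mem_Times_iff subsetD)
  then have "slope e = slope e'"
    using no[OF W _ h(2,3)] no[OF W(2,1) _ h(4,1)] by fastforce
  then show ?thesis using W G fe unfolding wedge_def straight_graph_def by force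
qed

text \<open>Only the steepest edge leaving a vertex has no wedge above it. Every other edge is
  charged to the leftmost vertex of its wedge, and a vertex is charged at most once in each of three
  ways: on the lower edge, on the upper edge, or strictly between. This makes 1 + 3 edges per
  vertex.\<close>

lemma noncrossing_edges_le:
  assumes G: "straight_graph V E" and nc: "\<And>e f. e \<in> E \<Longrightarrow> f \<in> E \<Longrightarrow> \<not> crosses e f"
  shows "card E \<le> 4 * card V"
proof -
  have fV: "finite V" and sub: "E \<subseteq> V \<times> V" using G unfolding straight_graph_def by auto
  have fE: "finite E" using fV sub finite_subset by blast
  define Tp where "Tp = {e\<in>E. \<forall>g\<in>E. fst g = fst e \<longrightarrow> slope g \<le> slope e}"
  have "inj_on fst Tp"
  proof (rule inj_onI)
    fix e g assume "e \<in> Tp" "g \<in> Tp" "fst e = fst g"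
    then have "e \<in> E" "g \<in> E" "slope e = slope g" unfolding Tp_def by (auto intro!: antisym)
    then show "e = g" using G \<open>fst e = fst g\<close> unfolding straight_graph_def by blast
  qed
  moreover have "fst ` Tp \<subseteq> V" using sub unfolding Tp_def by auto
  ultimately have c1: "card Tp \<le> card V" using fV card_inj_on_le by blast
  have "\<forall>e\<in>E - Tp. \<exists>p. wedge V E e (fst p) (snd p)"
  proof
    fix e assume "e \<in> E - Tp"
    then obtain g where "e \<in> E" "g \<in> E" "fst g = fst e" "slope e < slope g"
      unfolding Tp_def by fastforce
    then obtain f w where "wedge V E e f w" using wedge_exists[OF G] by blast
    then have "wedge V E e (fst (f, w)) (snd (f, w))" by simp
    then show "\<exists>p. wedge V E e (fst p) (snd p)" by blast
  qed
  then obtain p where p: "\<And>e. e \<in> E - Tp \<Longrightarrow> wedge V E e (fst (p e)) (snd (p e))"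
    by metis
  define ty :: "edge \<Rightarrow> nat" where
    "ty e = (if height e (fst (snd (p e))) = snd (snd (p e)) then 0
       else if height (fst (p e)) (fst (snd (p e))) = snd (snd (p e)) then 1 else 2)" for e
  have ty: "ty e = 0 \<Longrightarrow> height e (fst (snd (p e))) = snd (snd (p e))"
    "ty e = 1 \<Longrightarrow> height (fst (p e)) (fst (snd (p e))) = snd (snd (p e))"
    "ty e = 2 \<Longrightarrow> height e (fst (snd (p e))) \<noteq> snd (snd (p e)) \<and>
       height (fst (p e)) (fst (snd (p e))) \<noteq> snd (snd (p e))" for e
    unfolding ty_def by (simp_all split: if_split_asm)
  have "inj_on (\<lambda>e. (snd (p e), ty e)) (E - Tp)"
  proof (rule inj_onI)
    fix e e' assume e: "e \<in> E - Tp" "e' \<in> E - Tp" "(snd (p e), ty e) = (snd (p e'), ty e')"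
    define w where "w = snd (p e)"
    have W: "wedge V E e (fst (p e)) w" "wedge V E e' (fst (p e')) w"
      using p[OF e(1)] p[OF e(2)] e(3) unfolding w_def by auto
    have le: "height e (fst w) \<le> snd w" "snd w \<le> height (fst (p e)) (fst w)"
      "height e' (fst w) \<le> snd w" "snd w \<le> height (fst (p e')) (fst w)"
      using W unfolding wedge_def by auto
    have ww: "snd (p e) = w" "snd (p e') = w" "ty e' = ty e" using e(3) w_def by simp_all
    have "ty e = 0 \<or> ty e = 1 \<or> ty e = 2" by (simp add: ty_def)
    then consider "ty e = 0" | "ty e = 1" | "ty e = 2" by (elim disjE)
    then show "e = e'"
    proof cases
      case 1
      then have "height e (fst w) = snd w" "height e' (fst w) = snd w"
        using ty(1)[of e] ty(1)[of e'] ww by auto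
      then show ?thesis using wedge_lower_eq[OF G nc W] by blast
    next
      case 2
      then have "height (fst (p e)) (fst w) = snd w" "height (fst (p e')) (fst w) = snd w"
        using ty(2)[of e] ty(2)[of e'] ww by auto
      then show ?thesis using wedge_upper_eq[OF G nc W] by blast
    next
      case 3
      then have "height e (fst w) < snd w" "snd w < height (fst (p e)) (fst w)"
          "height e' (fst w) < snd w" "snd w < height (fst (p e')) (fst w)"
        using ty(3)[of e] ty(3)[of e'] ww le by (auto simp: less_le)
      then show ?thesis using wedge_inner_eq[OF G nc W] by blast
    qed
  qed
  moreover have "(\<lambda>e. (snd (p e), ty e)) ` (E - Tp) \<subseteq> V \<times> {0..2}"
  proof -
    have "snd (p e) \<in> V" if "e \<in> E - Tp" for e using p[OF that] unfolding wedge_def by simp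
    moreover have "ty e \<le> 2" for e unfolding ty_def by auto
    ultimately show ?thesis by auto
  qed
  ultimately have "card (E - Tp) \<le> card (V \<times> {0..2::nat})"
    using fV by (intro card_inj_on_le[of _ _ "V \<times> {0..2::nat}"]) auto
  then have "card (E - Tp) \<le> 3 * card V" by (simp add: card_cartesian_product)
  moreover have "card E = card Tp + card (E - Tp)"
    using card_Int_Diff[OF fE, of Tp] by (simp add: Int_absorb1 Tp_def Collect_restrict)
  ultimately show ?thesis using c1 by simp
qed

section \<open>The crossing lemma and rich lines\<close>

lemma straight_graph_subset:
  assumes "straight_graph V E" "W \<subseteq> V" "F \<subseteq> E" "F \<subseteq> W \<times> W"
  shows "straight_graph W F"
proof -
  have "finite W" "inj_on fst W"
    using assms finite_subset inj_on_subset unfolding straight_graph_def by blast+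
  then show ?thesis using assms unfolding straight_graph_def by blast
qed

lemma straight_graph_finite: "straight_graph V E \<Longrightarrow> finite E"
  unfolding straight_graph_def by (meson finite_SigmaI finite_subset)

text \<open>Deleting an edge that takes part in a crossing removes at least one crossing, until the
  noncrossing bound applies. Crossings are counted as ordered pairs, which costs only a
  constant.\<close>

lemma edges_le_crossings:
  assumes "straight_graph V E"
  shows "card E \<le> 4 * card V + card {(e, f) \<in> E \<times> E. crosses e f}"
  using assms
proof (induction "card E" arbitrary: E rule: less_induct)
  case less
  have fE: "finite E" using less.prems straight_graph_finite by blast
  show ?case
  proof (cases "\<exists>e f. e \<in> E \<and> f \<in> E \<and> crosses e f")
    case False
    then show ?thesis using noncrossing_edges_le[OF less.prems] by force
  next
    case True
    then obtain e f where ef: "e \<in> E" "f \<in> E" "crosses e f" by blast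
    define E' where "E' = E - {e}"
    have c: "card E = Suc (card E')"
      unfolding E'_def using ef(1) fE by (metis card.remove)
    have "straight_graph V E'"
      using less.prems unfolding E'_def straight_graph_def by blast
    then have "card E' \<le> 4 * card V + card {(e, f) \<in> E' \<times> E'. crosses e f}"
      using less.hyps c by simp
    moreover have "card {(e, f) \<in> E' \<times> E'. crosses e f} < card {(e, f) \<in> E \<times> E. crosses e f}"
    proof (rule psubset_card_mono)
      show "finite {(e, f) \<in> E \<times> E. crosses e f}"
        by (rule finite_subset[of _ "E \<times> E"]) (use fE in auto)
      have "(e, f) \<in> {(e, f) \<in> E \<times> E. crosses e f}" "(e, f) \<notin> {(e, f) \<in> E' \<times> E'. crosses e f}"
        using ef unfolding E'_def by auto
      moreover have "{(e, f) \<in> E' \<times> E'. crosses e f} \<subseteq> {(e, f) \<in> E \<times> E. crosses e f}"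
        unfolding E'_def by auto
      ultimately show "{(e, f) \<in> E' \<times> E'. crosses e f} \<subset> {(e, f) \<in> E \<times> E. crosses e f}"
        by blast
    qed
    ultimately show ?thesis using c by linarith
  qed
qed

text \<open>The difference of the two heights is affine in the abscissa. A zero at a common end of
  both ranges leaves no room for a strict change of sign, and a left end equal to a right end leaves
  only one common abscissa.\<close>

lemma crosses_endpoints_distinct:
  assumes G: "straight_graph V E" and ef: "e \<in> E" "f \<in> E" "crosses e f"
  shows "card {fst e, snd e, fst f, snd f} = 4"
proof -
  have l: "fst (fst e) < fst (snd e)" "fst (fst f) < fst (snd f)"
    using G ef unfolding straight_graph_def by auto
  obtain x y where xy: "covers e x" "covers f x" "covers e y" "covers f y"
    "height f x < height e x" "height e y < height f y"
    using ef unfolding crosses_def by blast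
  have d: "height e x - height f x = height e z - height f z - (slope e - slope f) * (z - x)" for x z
    unfolding height_shift[of e x z] height_shift[of f x z] by (simp add: algebra_simps)
  have "fst e \<noteq> fst f"
  proof
    assume eq: "fst e = fst f"
    then have "height e (fst (fst e)) = height f (fst (fst e))"
      using height_left[of e] height_left[of f] by simp
    then have "0 < (slope e - slope f) * (x - fst (fst e))" "(slope e - slope f) * (y - fst (fst e)) < 0"
      using d[of x "fst (fst e)"] d[of y "fst (fst e)"] xy by (auto simp: algebra_simps)
    then show False using xy(1,3) unfolding covers_def
      by (smt (verit, best) mult_le_0_iff mult_nonneg_nonneg zero_less_mult_iff)
  qed
  moreover have "snd e \<noteq> snd f"
  proof
    assume eq: "snd e = snd f"
    then have "height e (fst (snd e)) = height f (fst (snd e))"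
      using height_right[of e] height_right[of f] l by simp
    then have "(slope e - slope f) * (fst (snd e) - x) < 0" "0 < (slope e - slope f) * (fst (snd e) - y)"
      using d[of x "fst (snd e)"] d[of y "fst (snd e)"] xy by (auto simp: algebra_simps)
    then show False using xy(1,3) unfolding covers_def
      by (smt (verit, best) mult_le_0_iff mult_nonneg_nonneg zero_less_mult_iff)
  qed
  moreover have "x \<noteq> y" using xy by auto
  then have "fst e \<noteq> snd f" "snd e \<noteq> fst f" using xy unfolding covers_def by auto
  moreover have "fst e \<noteq> snd e" "fst f \<noteq> snd f" using l by auto
  ultimately show ?thesis by auto
qed

text \<open>Counting in place of probability: colour \<open>V\<close> with \<open>t\<close> colours
  and keep the vertices of colour 0. Exactly \<open>t ^ (card V - d)\<close> colourings keep a given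
  set of \<open>d\<close> vertices.\<close>

lemma sum_card_vanishing:
  assumes fV: "finite V" and fA: "finite A" and t: "t \<ge> 1"
    and Z: "\<And>x. x \<in> A \<Longrightarrow> Z x \<subseteq> V \<and> card (Z x) = d"
  shows "(\<Sum>f\<in>PiE V (\<lambda>_. {..<t}). card {x\<in>A. \<forall>v\<in>Z x. f v = 0}) = card A * t ^ (card V - d)"
proof -
  let ?F = "PiE V (\<lambda>_. {..<t::nat})"
  have fF: "finite ?F" using fV by (simp add: finite_PiE)
  have "card {f\<in>?F. \<forall>v\<in>Z x. f v = 0} = t ^ (card V - d)" if x: "x \<in> A" for x
  proof -
    have zx: "Z x \<subseteq> V" "card (Z x) = d" using Z x by auto
    have "{f\<in>?F. \<forall>v\<in>Z x. f v = 0} = PiE V (\<lambda>v. if v \<in> Z x then {0} else {..<t})"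
    proof (intro set_eqI iffI)
      fix f assume "f \<in> {f\<in>?F. \<forall>v\<in>Z x. f v = 0}"
      then show "f \<in> PiE V (\<lambda>v. if v \<in> Z x then {0} else {..<t})" by (auto simp: PiE_iff)
    next
      fix f assume f: "f \<in> PiE V (\<lambda>v. if v \<in> Z x then {0} else {..<t})"
      have "f v = 0" if "v \<in> Z x" for v
        using PiE_mem[OF f, of v] that zx by auto
      moreover have "f v < t" if "v \<in> V" for v
        using PiE_mem[OF f that] t by (auto split: if_splits)
      moreover have "f \<in> extensional V" using f by (simp add: PiE_iff)
      ultimately show "f \<in> {f\<in>?F. \<forall>v\<in>Z x. f v = 0}" by (auto simp: PiE_iff)
    qed
    then have "card {f\<in>?F. \<forall>v\<in>Z x. f v = 0} = (\<Prod>v\<in>V. if v \<in> Z x then 1 else t)"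
      using fV by (simp add: card_PiE if_distrib[of card] cong: if_cong)
    also have "\<dots> = t ^ card (V - Z x)"
      using fV by (simp add: prod.If_cases Diff_eq)
    also have "card (V - Z x) = card V - d"
      using zx fV by (simp add: card_Diff_subset finite_subset)
    finally show ?thesis .
  qed
  then show ?thesis
    using sum_multicount_gen[OF fF fA, of "\<lambda>f x. \<forall>v\<in>Z x. f v = 0" "\<lambda>_. t ^ (card V - d)"] by simp
qed

text \<open>Apply \<open>edges_le_crossings\<close> to a random induced subgraph that keeps each vertex with
  probability \<open>1 / t\<close>: edges need two and crossings four vertices.\<close>

lemma crossing_bound:
  assumes G: "straight_graph V E" and t: "t \<ge> 1"
  shows "card E * t^2 \<le> 4 * card V * t^3 + card {(e, f) \<in> E \<times> E. crosses e f}"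
\<comment> \<open>The averaging argument needs four vertices, so that \<open>card V - 4\<close> is a
  true difference, and it gets them from a crossing. Hence the crossing-free case is treated
  apart.\<close>
proof (cases "{(e, f) \<in> E \<times> E. crosses e f} = {}")
  case True
  have "card E \<le> 4 * card V" using edges_le_crossings[OF G] unfolding True by simp
  then have "card E * t^2 \<le> (4 * card V) * t^2" by simp
  also have "\<dots> \<le> 4 * card V * t^3" using t by (intro mult_left_mono power_increasing) auto
  finally show ?thesis by simp
next
  case False
  define X where "X = {(e, f) \<in> E \<times> E. crosses e f}"
  have fV: "finite V" and sub: "E \<subseteq> V \<times> V" using G unfolding straight_graph_def by auto
  have fE: "finite E" using G straight_graph_finite by blast
  have fX: "finite X" unfolding X_def by (rule finite_subset[of _ "E \<times> E"]) (use fE in auto)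
  let ?F = "PiE V (\<lambda>_. {..<t})"
  define S where "S f = {v\<in>V. \<forall>u\<in>{v}. f u = (0::nat)}" for f :: "real \<times> real \<Rightarrow> nat"
  define ES where "ES f = {e\<in>E. \<forall>u\<in>{fst e, snd e}. f u = (0::nat)}" for f :: "real \<times> real \<Rightarrow> nat"
  define XS where "XS f = {z\<in>X. \<forall>u\<in>{fst (fst z), snd (fst z), fst (snd z), snd (snd z)}. f u = (0::nat)}"
    for f :: "real \<times> real \<Rightarrow> nat"
  have X4: "{fst (fst z), snd (fst z), fst (snd z), snd (snd z)} \<subseteq> V \<and>
     card {fst (fst z), snd (fst z), fst (snd z), snd (snd z)} = 4" if "z \<in> X" for z
  proof -
    have z: "fst z \<in> E" "snd z \<in> E" "crosses (fst z) (snd z)" using that unfolding X_def by auto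
    then show ?thesis using crosses_endpoints_distinct[OF G z] sub by auto
  qed
  have n4: "card V \<ge> 4"
    using False X4 card_mono[OF fV] unfolding X_def[symmetric] by (metis ex_in_conv)
  have E2: "{fst e, snd e} \<subseteq> V \<and> card {fst e, snd e} = 2" if "e \<in> E" for e
  proof -
    have "fst e \<noteq> snd e" using G that unfolding straight_graph_def by force
    then show ?thesis using that sub by auto
  qed
  have "card (ES f) \<le> 4 * card (S f) + card (XS f)" for f
  proof -
    have "straight_graph (S f) (ES f)"
      by (rule straight_graph_subset[OF G]) (use sub in \<open>auto simp: S_def ES_def\<close>)
    from edges_le_crossings[OF this]
    have "card (ES f) \<le> 4 * card (S f) + card {(e, e') \<in> ES f \<times> ES f. crosses e e'}" .
    also have "{(e, e') \<in> ES f \<times> ES f. crosses e e'} = XS f"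
      unfolding ES_def XS_def X_def by auto
    finally show ?thesis .
  qed
  then have "(\<Sum>f\<in>?F. card (ES f)) \<le> (\<Sum>f\<in>?F. 4 * card (S f) + card (XS f))"
    by (intro sum_mono)
  also have "\<dots> = 4 * (\<Sum>f\<in>?F. card (S f)) + (\<Sum>f\<in>?F. card (XS f))"
    by (simp add: sum.distrib sum_distrib_left)
  also have "(\<Sum>f\<in>?F. card (S f)) = card V * t ^ (card V - 1)"
    unfolding S_def by (rule sum_card_vanishing[OF fV fV t]) auto
  also have "(\<Sum>f\<in>?F. card (XS f)) = card X * t ^ (card V - 4)"
    unfolding XS_def by (rule sum_card_vanishing[OF fV fX t]) (use X4 in blast)
  also have "(\<Sum>f\<in>?F. card (ES f)) = card E * t ^ (card V - 2)"
    unfolding ES_def by (rule sum_card_vanishing[OF fV fE t]) (use E2 in blast)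
  finally have le: "card E * t ^ (card V - 2) \<le> 4 * (card V * t ^ (card V - 1)) + card X * t ^ (card V - 4)" .
  obtain n where n: "card V = n + 4" using n4 by (metis add.commute le_Suc_ex)
  have "t ^ n * (card E * t^2) \<le> t ^ n * (4 * card V * t^3 + card X)"
    using le unfolding n by (simp add: power_add power2_eq_square algebra_simps)
  then show ?thesis using t unfolding X_def by simp
qed

section \<open>From rich lines to a drawn graph\<close>

lemma card_consecutive_ge:
  fixes g :: "'a \<Rightarrow> real"
  assumes fA: "finite A" and inj: "inj_on g A"
  shows "card {(p, q) \<in> A \<times> A. g p < g q \<and> (\<forall>z\<in>A. \<not> (g p < g z \<and> g z < g q))} \<ge> card A - 1"
    (is "card ?C \<ge> _")
proof (cases "A = {}")
  case False
  have fC: "finite ?C" by (rule finite_subset[of _ "A \<times> A"]) (use fA in auto)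
  define M where "M = arg_min_on (\<lambda>x. - g x) A"
  have M: "M \<in> A" "\<And>x. x \<in> A \<Longrightarrow> g x \<le> g M"
    using arg_min_if_finite(1)[OF fA False, of "\<lambda>x. - g x"] arg_min_least[OF fA False, of _ "\<lambda>x. - g x"]
    unfolding M_def by auto
  have "A - {M} \<subseteq> fst ` ?C"
  proof
    fix p assume p: "p \<in> A - {M}"
    have "g p \<noteq> g M" using inj p M(1) by (auto dest: inj_onD)
    then have "g p < g M" using p M(2)[of p] by simp
    define B where "B = {q\<in>A. g p < g q}"
    have B: "finite B" "B \<noteq> {}" using fA M \<open>g p < g M\<close> unfolding B_def by auto
    define q where "q = arg_min_on g B"
    have q: "q \<in> B" "\<And>z. z \<in> B \<Longrightarrow> g q \<le> g z"
      using arg_min_if_finite(1)[OF B, of g] arg_min_least[OF B, of _ g] unfolding q_def by auto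
    have "(p, q) \<in> ?C" using p q unfolding B_def by force
    then show "p \<in> fst ` ?C" by force
  qed
  then have "card (A - {M}) \<le> card ?C"
    using fC by (meson surj_card_le)
  then show ?thesis using M(1) fA by simp
qed simp

text \<open>A non-vertical line, coded by slope and intercept. Vertical lines never join two points
  with distinct abscissas.\<close>

definition on_graph :: "real \<times> real \<Rightarrow> (real \<times> real) set" where
  "on_graph l = {p. snd p = fst l * fst p + snd l}"

lemma on_graph_unique:
  assumes "p \<in> on_graph l" "q \<in> on_graph l" "p \<in> on_graph l'" "q \<in> on_graph l'" "fst p \<noteq> fst q"
  shows "l = l'"
proof -
  have "fst l * (fst p - fst q) = fst l' * (fst p - fst q)"
    using assms unfolding on_graph_def by (simp add: algebra_simps)
  then have "fst l = fst l'" using assms(5) by simp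
  then show ?thesis using assms(1,3) unfolding on_graph_def by (simp add: prod_eq_iff)
qed

lemma height_on_graph:
  assumes "fst e \<in> on_graph l" "snd e \<in> on_graph l" "fst (fst e) < fst (snd e)"
  shows "height e x = fst l * x + snd l"
proof -
  have "snd (snd e) - snd (fst e) = fst l * (fst (snd e) - fst (fst e))"
    using assms unfolding on_graph_def by (simp add: algebra_simps)
  then have "slope e = fst l" using assms(3) unfolding slope_def by simp
  then show ?thesis using assms(1) unfolding height_def on_graph_def by (simp add: algebra_simps)
qed

text \<open>The quotient is the abscissa where the two lines meet. That it lies strictly inside the
  edge is what later singles out the edge among the consecutive segments of its line.\<close>

lemma crosses_interior:
  assumes e: "fst e \<in> on_graph l" "snd e \<in> on_graph l" "fst (fst e) < fst (snd e)"
    and f: "fst f \<in> on_graph l'" "snd f \<in> on_graph l'" "fst (fst f) < fst (snd f)"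
    and X: "crosses e f"
  shows "fst l \<noteq> fst l' \<and> fst (fst e) < (snd l' - snd l) / (fst l - fst l') \<and>
    (snd l' - snd l) / (fst l - fst l') < fst (snd e)"
proof -
  obtain x y where xy: "covers e x" "covers e y"
    "fst l' * x + snd l' < fst l * x + snd l" "fst l * y + snd l < fst l' * y + snd l'"
    using X unfolding crosses_def height_on_graph[OF e] height_on_graph[OF f] by blast
  define d where "d = fst l - fst l'"
  define c where "c = snd l' - snd l"
  have *: "c < d * x" "d * y < c" using xy unfolding c_def d_def by (auto simp: algebra_simps)
  then have "d \<noteq> 0" by auto
  then have "(y < c / d \<and> c / d < x) \<or> (x < c / d \<and> c / d < y)"
    using * by (cases "d > 0") (auto simp: field_simps)
  then show ?thesis using xy(1,2) \<open>d \<noteq> 0\<close> unfolding covers_def c_def d_def by auto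
qed

text \<open>Each line of \<open>M\<close> yields at least r - 1 edges between consecutive points.
  Two lines meet at most once, so an ordered pair of lines accounts for at most one
  crossing.\<close>

lemma rich_graphs_bound:
  assumes fS: "finite S" and inj: "inj_on fst S" and fM: "finite M"
    and rich: "\<And>l. l \<in> M \<Longrightarrow> card (S \<inter> on_graph l) \<ge> r" and t: "t \<ge> 1"
  shows "card M * (r - 1) * t^2 \<le> 4 * card S * t^3 + card M ^ 2"
proof -
  define C where "C l = {(p, q) \<in> (S \<inter> on_graph l) \<times> (S \<inter> on_graph l). fst p < fst q \<and>
     (\<forall>z\<in>S \<inter> on_graph l. \<not> (fst p < fst z \<and> fst z < fst q))}" for l
  have C: "fst e \<in> S" "snd e \<in> S" "fst e \<in> on_graph l" "snd e \<in> on_graph l" "fst (fst e) < fst (snd e)"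
    "\<And>z. z \<in> S \<Longrightarrow> z \<in> on_graph l \<Longrightarrow> fst (fst e) < fst z \<Longrightarrow> fst z < fst (snd e) \<Longrightarrow> False"
    if "e \<in> C l" for e l
  proof -
    have "(fst e, snd e) \<in> C l" using that by simp
    then show "fst e \<in> S" "snd e \<in> S" "fst e \<in> on_graph l" "snd e \<in> on_graph l" "fst (fst e) < fst (snd e)"
      "\<And>z. z \<in> S \<Longrightarrow> z \<in> on_graph l \<Longrightarrow> fst (fst e) < fst z \<Longrightarrow> fst z < fst (snd e) \<Longrightarrow> False"
      unfolding C_def by blast+
  qed
  have fC: "finite (C l)" for l
    unfolding C_def by (rule finite_subset[of _ "S \<times> S"]) (use fS in auto)
  have disj: "l = l'" if "e \<in> C l" "e \<in> C l'" for e l l'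
    using on_graph_unique[of "fst e" l "snd e" l'] C[OF that(1)] C[OF that(2)] by auto
  define E where "E = (\<Union>l\<in>M. C l)"
  have G: "straight_graph S E"
    unfolding straight_graph_def
  proof (intro conjI ballI impI)
    show "E \<subseteq> S \<times> S" unfolding E_def C_def by auto
    fix e assume "e \<in> E"
    then obtain l where l: "l \<in> M" "e \<in> C l" unfolding E_def by auto
    show "fst (fst e) < fst (snd e)" using C[OF l(2)] by simp
    fix f assume "f \<in> E" and *: "fst e = fst f" "slope e = slope f"
    then obtain l' where l': "l' \<in> M" "f \<in> C l'" unfolding E_def by auto
    note ce = C[OF l(2)] and cf = C[OF l'(2)]
    have h: "height e x = height f x" for x using * unfolding height_def by simp
    have "fst l * x + snd l = fst l' * x + snd l'" for x
      using h[of x] height_on_graph[OF ce(3-5)] height_on_graph[OF cf(3-5)] by simp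
    from this[of 0] this[of 1] have "l = l'" by (simp add: prod_eq_iff)
    have "fst (snd e) = fst (snd f)"
      using ce(6)[of "snd f"] cf(6)[of "snd e"] ce(2,4,5) cf(2,4,5) * \<open>l = l'\<close> by force
    then have "snd e = snd f" using ce cf inj by (auto dest: inj_onD)
    then show "e = f" using * by (simp add: prod_eq_iff)
  qed (use fS inj in auto)
  have "card M * (r - 1) = (\<Sum>l\<in>M. r - 1)" by simp
  also have "\<dots> \<le> (\<Sum>l\<in>M. card (C l))"
  proof (rule sum_mono)
    fix l assume l: "l \<in> M"
    have "card (S \<inter> on_graph l) - 1 \<le> card (C l)"
      unfolding C_def by (rule card_consecutive_ge) (use fS inj in \<open>auto intro: inj_on_subset\<close>)
    then show "r - 1 \<le> card (C l)" using rich[OF l] by simp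
  qed
  also have "\<dots> = card E" unfolding E_def
    by (rule card_UN_disjoint[symmetric]) (use fM fC disj in auto)
  finally have 1: "card M * (r - 1) \<le> card E" .
  define X where "X = {(e, f) \<in> E \<times> E. crosses e f}"
  have "\<forall>e\<in>E. \<exists>l. l \<in> M \<and> e \<in> C l" unfolding E_def by auto
  then obtain L where L: "\<And>e. e \<in> E \<Longrightarrow> L e \<in> M \<and> e \<in> C (L e)" by metis
  \<comment> \<open>Segments between consecutive points of one line have disjoint interiors, so one
    abscissa strictly inside identifies the segment.\<close>
  have uniq: "e = e'" if e: "e \<in> C l" "e' \<in> C l" and
    x: "fst (fst e) < x" "x < fst (snd e)" "fst (fst e') < x" "x < fst (snd e')" for e e' l x
  proof -
    note ce = C[OF e(1)] and ce' = C[OF e(2)]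
    have "fst (fst e) = fst (fst e')"
      using ce(6)[of "fst e'"] ce'(6)[of "fst e"] ce(1,3) ce'(1,3) x by force
    moreover have "fst (snd e) = fst (snd e')"
      using ce(6)[of "snd e'"] ce'(6)[of "snd e"] ce(2,4) ce'(2,4) x by force
    ultimately show ?thesis using ce(1,2) ce'(1,2) inj by (auto dest: inj_onD simp: prod_eq_iff)
  qed
  have "inj_on (\<lambda>(e, f). (L e, L f)) X"
  proof (rule inj_onI, clarify)
    fix e f e' f' assume ef: "(e, f) \<in> X" "(e', f') \<in> X" and eq: "L e = L e'" "L f = L f'"
    have E: "e \<in> E" "f \<in> E" "e' \<in> E" "f' \<in> E" "crosses e f" "crosses e' f'"
      using ef unfolding X_def by auto
    note ce = C[OF conjunct2[OF L[OF E(1)]]] and cf = C[OF conjunct2[OF L[OF E(2)]]]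
    note ce' = C[OF conjunct2[OF L[OF E(3)]]] and cf' = C[OF conjunct2[OF L[OF E(4)]]]
    note i1 = crosses_interior[OF ce(3-5) cf(3-5) E(5)]
    note i2 = crosses_interior[OF ce'(3-5) cf'(3-5) E(6)]
    note j1 = crosses_interior[OF cf(3-5) ce(3-5) E(5)[unfolded crosses_sym[of e]]]
    note j2 = crosses_interior[OF cf'(3-5) ce'(3-5) E(6)[unfolded crosses_sym[of e']]]
    have m: "e \<in> C (L e)" "e' \<in> C (L e)" "f \<in> C (L f)" "f' \<in> C (L f)"
      using L[OF E(1)] L[OF E(2)] L[OF E(3)] L[OF E(4)] eq by simp_all
    have "e = e'" using uniq[OF m(1,2)] i1 i2 unfolding eq by blast
    moreover have "f = f'" using uniq[OF m(3,4)] j1 j2 unfolding eq by blast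
    ultimately show "e = e' \<and> f = f'" by simp
  qed
  moreover have "(\<lambda>(e, f). (L e, L f)) ` X \<subseteq> M \<times> M" using L unfolding X_def by auto
  ultimately have "card X \<le> card (M \<times> M)" using fM by (intro card_inj_on_le) auto
  then have 2: "card X \<le> card M ^ 2" by (simp add: card_cartesian_product power2_eq_square)
  have "card M * (r - 1) * t^2 \<le> card E * t^2" using 1 by simp
  also have "\<dots> \<le> 4 * card S * t^3 + card X" unfolding X_def by (rule crossing_bound[OF G t])
  finally show ?thesis using 2 by linarith
qed

lemma card_rich_graphs_le:
  assumes fS: "finite S" and inj: "inj_on fst S" and fM: "finite M" and r: "r \<ge> 2"
    and rich: "\<And>l. l \<in> M \<Longrightarrow> card (S \<inter> on_graph l) \<ge> r"
  shows "real (card M) \<le> 32 * real (card S) / real r + 4096 * (real (card S))^2 / (real r)^3"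
proof (cases "card M = 0")
  case False
  define m where "m = real (card M)"
  define n where "n = real (card S)"
  define R where "R = real r"
  have m: "m > 0" and n: "n \<ge> 0" and R: "R \<ge> 2" using False r unfolding m_def n_def R_def by auto
  \<comment> \<open>This choice gives 4 m \<le> R t^2, so the crossing term m^2 is at most half of m
    (R - 1) t^2 and can be absorbed on the left.\<close>
  define t where "t = nat \<lceil>2 * sqrt (m / R)\<rceil>"
  have pos: "2 * sqrt (m / R) > 0" using m R by simp
  have t1: "real t \<ge> 2 * sqrt (m / R)" "real t \<le> 2 * sqrt (m / R) + 1" "t \<ge> 1"
    unfolding t_def using pos by linarith+
  have "real (card M * (r - 1) * t^2) \<le> real (4 * card S * t^3 + card M ^ 2)"
    using rich_graphs_bound[OF fS inj fM rich t1(3)] of_nat_le_iff by blast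
  then have *: "m * (R - 1) * (real t)^2 \<le> 4 * n * (real t)^3 + m^2"
    using r unfolding m_def n_def R_def by (simp add: of_nat_diff)
  have "(2 * sqrt (m / R))^2 \<le> (real t)^2" using t1 pos by (intro power_mono) auto
  then have "4 * m \<le> R * (real t)^2" using m R by (simp add: power_mult_distrib field_simps)
  then have "m * (4 * m) \<le> m * (R * (real t)^2)" using m by (intro mult_left_mono) auto
  then have "4 * m^2 \<le> m * R * (real t)^2" by (simp add: power2_eq_square)
  moreover have "m * R * (real t)^2 \<le> 2 * (m * (R - 1) * (real t)^2)"
  proof -
    have "(m * (real t)^2) * R \<le> (m * (real t)^2) * (2 * (R - 1))"
      using m R by (intro mult_left_mono) auto
    then show ?thesis by (simp add: algebra_simps)
  qed
  ultimately have "m * R * (real t)^2 \<le> 16 * n * (real t)^3"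
    using * by linarith
  then have "(real t)^2 * (m * R) \<le> (real t)^2 * (16 * n * real t)"
    by (simp add: power2_eq_square power3_eq_cube algebra_simps)
  then have "m * R \<le> 16 * n * real t" using t1(3) by simp
  also have "\<dots> \<le> 16 * n * (2 * sqrt (m / R) + 1)" using n t1 by (intro mult_left_mono) auto
  finally have le: "m * R \<le> 32 * n * sqrt (m / R) + 16 * n" by (simp add: algebra_simps)
  have nonneg: "0 \<le> 32 * n / R" "0 \<le> 4096 * n^2 / R^3" using n R by auto
  show ?thesis
  \<comment> \<open>Either the first term of the bound suffices, or 16 n is less than half of m R;
    squaring what remains then gives the second term.\<close>
  proof (cases "m * R \<le> 32 * n")
    case True
    then have "m \<le> 32 * n / R" using R by (simp add: field_simps)
    then show ?thesis using nonneg unfolding m_def n_def R_def by linarith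
  next
    case False
    then have "m * R \<le> 64 * n * sqrt (m / R)" using le by linarith
    then have "(m * R)^2 \<le> (64 * n * sqrt (m / R))^2" using m R by (intro power_mono) auto
    then have "m^2 * R^2 \<le> 4096 * n^2 * (m / R)" using m R by (simp add: power_mult_distrib)
    then have "m * (m * R^3) \<le> m * (4096 * n^2)"
      using R by (simp add: field_simps power2_eq_square power3_eq_cube)
    then have "m \<le> 4096 * n^2 / R^3" using m R by (simp add: field_simps)
    then show ?thesis using nonneg unfolding m_def n_def R_def by linarith
  qed
qed simp

section \<open>Beck's theorem\<close>

definition lines_of :: "(real ^ 3) set \<Rightarrow> (real ^ 3) set set" where
  "lines_of Y = {affine hull {p, q} | p q. p \<in> Y \<and> q \<in> Y \<and> p \<noteq> q}"

lemma affine_hull_2_eq: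
  fixes p q :: "'a::euclidean_space"
  assumes "x \<in> affine hull {p, q}" "y \<in> affine hull {p, q}" "x \<noteq> y"
  shows "affine hull {x, y} = affine hull {p, q}"
proof (rule affine_dim_equal)
  show "affine hull {x, y} \<subseteq> affine hull {p, q}"
    using assms by (intro hull_minimal) auto
  then have "p \<noteq> q" using assms by auto
  then show "aff_dim (affine hull {x, y}) = aff_dim (affine hull {p, q})"
    using assms(3) by (simp add: aff_dim_2)
qed auto

lemma lines_of_eqI:
  assumes "M \<in> lines_of Y" "x \<in> M" "y \<in> M" "x \<noteq> y"
  shows "M = affine hull {x, y}"
  using assms affine_hull_2_eq unfolding lines_of_def by blast

lemma lines_of_unique:
  assumes "M \<in> lines_of Y" "M' \<in> lines_of Y'" "x \<in> M" "y \<in> M" "x \<in> M'" "y \<in> M'" "x \<noteq> y"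
  shows "M = M'"
  using assms lines_of_eqI by metis

lemma lines_of_obtain:
  assumes "M \<in> lines_of Y"
  obtains p q where "p \<in> Y" "q \<in> Y" "p \<noteq> q" "M = affine hull {p, q}" "p \<in> M" "q \<in> M"
proof -
  obtain p q where pq: "p \<in> Y" "q \<in> Y" "p \<noteq> q" "M = affine hull {p, q}"
    using assms unfolding lines_of_def by blast
  have "p \<in> M" "q \<in> M" unfolding pq(4) by (rule hull_inc; simp)+
  from that[OF pq this] show ?thesis .
qed

lemma finite_lines_of: "finite Y \<Longrightarrow> finite (lines_of Y)"
proof -
  assume "finite Y"
  have "lines_of Y \<subseteq> (\<lambda>z. affine hull {fst z, snd z}) ` (Y \<times> Y)" unfolding lines_of_def by force
  then show ?thesis using finite_surj[of "Y \<times> Y"] \<open>finite Y\<close> by blast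
qed

section \<open>Generic projection to the plane\<close>

lemma exists_inner_nonzero:
  fixes D :: "'a::euclidean_space set"
  assumes "finite D" "0 \<notin> D"
  shows "\<exists>u. \<forall>d\<in>D. u \<bullet> d \<noteq> 0"
proof -
  have "negligible (\<Union>d\<in>D. {u. d \<bullet> u = 0})"
    using assms by (intro negligible_Union) (auto intro!: negligible_hyperplane)
  then have "(\<Union>d\<in>D. {u. d \<bullet> u = 0}) \<noteq> UNIV" using non_negligible_UNIV by auto
  then show ?thesis by (auto simp: inner_commute)
qed

text \<open>The first coordinate \<open>u\<close> separates the points. The second,
  \<open>v\<close>, is chosen after it so that no noncollinear triple becomes collinear. Each choice
  only has to avoid finitely many hyperplanes.\<close>

lemma generic_projection:
  fixes Y :: "(real ^ 3) set"
  assumes fY: "finite Y"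
  shows "\<exists>\<pi> :: real ^ 3 \<Rightarrow> real \<times> real. inj_on (fst \<circ> \<pi>) Y \<and>
    (\<forall>M\<in>lines_of Y. \<exists>l. \<forall>z\<in>Y. z \<in> M \<longleftrightarrow> \<pi> z \<in> on_graph l)"
proof -
  have "finite ((\<lambda>(p, q). q - p) ` (Y \<times> Y) - {0})" using fY by auto
  then obtain u where "\<forall>d\<in>(\<lambda>(p, q). q - p) ` (Y \<times> Y) - {0}. u \<bullet> d \<noteq> 0"
    using exists_inner_nonzero by (metis Diff_iff insertI1)
  then have u: "u \<bullet> (q - p) \<noteq> 0" if "p \<in> Y" "q \<in> Y" "p \<noteq> q" for p q
    using that by force
  \<comment> \<open>For distinct p and q in \<open>Y\<close> this vector is zero exactly when p, q,
    r are collinear, and it is orthogonal to \<open>v\<close> exactly when their images are.\<close>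
  define d where "d p q r = (u \<bullet> (q - p)) *\<^sub>R (r - p) - (u \<bullet> (r - p)) *\<^sub>R (q - p)" for p q r
  have "finite ((\<lambda>(p, q, r). d p q r) ` (Y \<times> Y \<times> Y) - {0})" using fY by auto
  then obtain v where "\<forall>x\<in>(\<lambda>(p, q, r). d p q r) ` (Y \<times> Y \<times> Y) - {0}. v \<bullet> x \<noteq> 0"
    using exists_inner_nonzero by (metis Diff_iff insertI1)
  then have v: "v \<bullet> d p q r = 0 \<Longrightarrow> d p q r = 0" if "p \<in> Y" "q \<in> Y" "r \<in> Y" for p q r
    using that by force
  define \<pi> where "\<pi> z = (u \<bullet> z, v \<bullet> z)" for z
  have "inj_on (fst \<circ> \<pi>) Y"
  proof (rule inj_onI, rule ccontr)
    fix p q assume "p \<in> Y" "q \<in> Y" "(fst \<circ> \<pi>) p = (fst \<circ> \<pi>) q" "p \<noteq> q"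
    then show False using u[of p q] unfolding \<pi>_def by (simp add: inner_diff_right)
  qed
  moreover have "\<exists>l. \<forall>z\<in>Y. z \<in> M \<longleftrightarrow> \<pi> z \<in> on_graph l" if M: "M \<in> lines_of Y" for M
  proof -
    obtain p q where pq: "p \<in> Y" "q \<in> Y" "p \<noteq> q" "M = affine hull {p, q}"
      using M by (rule lines_of_obtain)
    define \<delta> where "\<delta> = u \<bullet> (q - p)"
    have d0: "\<delta> \<noteq> 0" using u pq unfolding \<delta>_def by blast
    define a where "a = (v \<bullet> (q - p)) / \<delta>"
    have "z \<in> M \<longleftrightarrow> \<pi> z \<in> on_graph (a, v \<bullet> p - a * (u \<bullet> p))" if z: "z \<in> Y" for z
    proof
      assume "z \<in> M"
      then obtain s t where st: "s + t = 1" "z = s *\<^sub>R p + t *\<^sub>R q"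
        unfolding pq(4) affine_hull_2 by auto
      have s: "s = 1 - t" using st by simp
      have "z - p = t *\<^sub>R (q - p)" unfolding st(2) s by (simp add: algebra_simps)
      then have "u \<bullet> z - u \<bullet> p = t * \<delta>" "v \<bullet> z - v \<bullet> p = t * (v \<bullet> (q - p))"
        unfolding \<delta>_def by (metis inner_diff_right inner_scaleR_right)+
      then have "v \<bullet> z - v \<bullet> p = a * (u \<bullet> z - u \<bullet> p)" unfolding a_def using d0 by simp
      then show "\<pi> z \<in> on_graph (a, v \<bullet> p - a * (u \<bullet> p))"
        unfolding \<pi>_def on_graph_def by (simp add: algebra_simps)
    next
      assume "\<pi> z \<in> on_graph (a, v \<bullet> p - a * (u \<bullet> p))"
      then have "v \<bullet> (z - p) = a * (u \<bullet> (z - p))"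
        unfolding \<pi>_def on_graph_def by (simp add: algebra_simps inner_diff_right)
      then have "v \<bullet> d p q z = 0"
        unfolding d_def a_def using d0 unfolding \<delta>_def by (simp add: inner_diff_right[of v "_ *\<^sub>R _"])
      then have "d p q z = 0" using v pq z by blast
      then have "\<delta> *\<^sub>R (z - p) = (u \<bullet> (z - p)) *\<^sub>R (q - p)" unfolding d_def \<delta>_def by simp
      then have "(1 / \<delta>) *\<^sub>R (\<delta> *\<^sub>R (z - p)) = (1 / \<delta>) *\<^sub>R ((u \<bullet> (z - p)) *\<^sub>R (q - p))" by simp
      then have zp: "z - p = ((u \<bullet> (z - p)) / \<delta>) *\<^sub>R (q - p)" using d0 by simp
      define t where "t = (u \<bullet> (z - p)) / \<delta>"
      have "z = (1 - t) *\<^sub>R p + t *\<^sub>R q"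
        using zp unfolding t_def[symmetric] by (simp add: algebra_simps)
      then have "\<exists>a b. z = a *\<^sub>R p + b *\<^sub>R q \<and> a + b = 1"
        by (metis diff_add_cancel)
      then show "z \<in> M" unfolding pq(4) affine_hull_2 by blast
    qed
    then show ?thesis by blast
  qed
  ultimately show ?thesis by blast
qed

lemma card_rich_lines_le:
  assumes fY: "finite Y" and r: "r \<ge> 2"
  shows "real (card {M \<in> lines_of Y. r \<le> card (Y \<inter> M)})
    \<le> 32 * real (card Y) / real r + 4096 * (real (card Y))^2 / (real r)^3"
proof -
  obtain \<pi> :: "real ^ 3 \<Rightarrow> real \<times> real" where inj: "inj_on (fst \<circ> \<pi>) Y"
    and ex: "\<forall>M\<in>lines_of Y. \<exists>l. \<forall>z\<in>Y. z \<in> M \<longleftrightarrow> \<pi> z \<in> on_graph l"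
    using generic_projection[OF fY] by blast
  obtain l where l: "\<And>M z. M \<in> lines_of Y \<Longrightarrow> z \<in> Y \<Longrightarrow> z \<in> M \<longleftrightarrow> \<pi> z \<in> on_graph (l M)"
    using ex by metis
  let ?R = "{M \<in> lines_of Y. r \<le> card (Y \<inter> M)}"
  have i\<pi>: "inj_on \<pi> Y" using inj inj_on_imageI2 by blast
  have fR: "finite ?R" using finite_lines_of[OF fY] by simp
  have "inj_on l ?R"
  proof (rule inj_onI)
    fix M M' assume *: "M \<in> ?R" "M' \<in> ?R" "l M = l M'"
    then obtain p q where "p \<in> Y" "q \<in> Y" "p \<noteq> q" "p \<in> M" "q \<in> M"
      by (auto elim: lines_of_obtain)
    then show "M = M'" using * l by (intro lines_of_unique[of M Y M' Y p q]) auto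
  qed
  then have "card ?R = card (l ` ?R)" by (simp add: card_image)
  moreover have "real (card (l ` ?R)) \<le> 32 * real (card (\<pi> ` Y)) / real r + 4096 * (real (card (\<pi> ` Y)))^2 / (real r)^3"
  proof (rule card_rich_graphs_le)
    show "inj_on fst (\<pi> ` Y)" using inj by (metis inj_on_imageI)
    fix k assume "k \<in> l ` ?R"
    then obtain M where M: "M \<in> lines_of Y" "r \<le> card (Y \<inter> M)" "k = l M" by auto
    have "\<pi> ` Y \<inter> on_graph k = \<pi> ` (Y \<inter> M)" using l M by auto
    then have "card (\<pi> ` Y \<inter> on_graph k) = card (Y \<inter> M)"
      using i\<pi> by (simp add: card_image inj_on_subset)
    then show "r \<le> card (\<pi> ` Y \<inter> on_graph k)" using M by simp
  qed (use fY fR r in auto)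
  ultimately show ?thesis using i\<pi> by (simp add: card_image)
qed

lemma sum_inverse_squares_le:
  assumes "K \<ge> 1"
  shows "(\<Sum>s\<in>{K+1..N}. 1 / (real s)^2) \<le> 1 / real K"
proof -
  have "(\<Sum>s\<in>{K+1..K+d}. 1 / (real s)^2) \<le> 1 / real K - 1 / real (K + d)" for d
  proof (induction d)
    case (Suc d)
    define x where "x = real (K + d)"
    have x: "x \<ge> 1" using assms unfolding x_def by simp
    have "1 / (x + 1)^2 \<le> 1 / x - 1 / (x + 1)"
    proof -
      have "1 / x - 1 / (x + 1) = 1 / (x * (x + 1))" using x by (simp add: field_simps)
      moreover have "1 / (x + 1)^2 \<le> 1 / (x * (x + 1))"
        using x by (intro divide_left_mono) (auto simp: power2_eq_square)
      ultimately show ?thesis by simp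
    qed
    moreover have "{K+1..K + Suc d} = insert (K + Suc d) {K+1..K+d}" by auto
    ultimately show ?case using Suc unfolding x_def by (simp add: add.commute add.left_commute)
  qed simp
  from this[of "N - K"] show ?thesis
  proof (cases "K \<le> N")
    case True
    then show ?thesis using \<open>_ \<le> 1 / real K - 1 / real (K + (N - K))\<close>
      by (smt (verit) le_add_diff_inverse of_nat_0_le_iff zero_le_divide_1_iff)
  qed simp
qed

text \<open>A line with c points carries at most c^2 of the ordered pairs. Lines with at most
  \<open>K\<close> points take at most 2^32 pairs each, and the Szemeredi-Trotter bound, summed over
  all levels of richness, leaves the richer lines a small fraction of n^2. The points may lie
  anywhere in space, so the result applies inside any plane without coordinates.\<close>

lemma beck_numeric:
  assumes fY: "finite Y" and n2: "card Y \<ge> 2"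
    and poor: "\<And>M. M \<in> lines_of Y \<Longrightarrow> real (card (Y \<inter> M)) \<le> real (card Y) / 2^25"
  shows "real (card (lines_of Y)) \<ge> (real (card Y))^2 / 2^33"
proof -
  define n where "n = real (card Y)"
  define K :: nat where "K = 2^16"
  define c where "c M = card (Y \<inter> M)" for M
  define N where "N = nat \<lfloor>n / 2^25\<rfloor>"
  define L where "L s = {M \<in> lines_of Y. s \<le> c M}" for s
  have fL: "finite (lines_of Y)" using finite_lines_of[OF fY] .
  have cN: "c M \<le> N" if "M \<in> lines_of Y" for M
    using poor[OF that] unfolding c_def N_def n_def by (simp add: le_nat_floor)
  have c2: "c M \<ge> 2" if "M \<in> lines_of Y" for M
  proof -
    obtain p q where pq: "p \<in> Y" "q \<in> Y" "p \<noteq> q" "p \<in> M" "q \<in> M" using \<open>M \<in> lines_of Y\<close> by (rule lines_of_obtain)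
    then have "card {p, q} \<le> c M" unfolding c_def using fY by (intro card_mono) auto
    then show ?thesis using pq by simp
  qed
  \<comment> \<open>Every spanned line has two points, so the poverty hypothesis itself excludes
    small \<open>n\<close>.\<close>
  have n26: "n \<ge> 2^26"
  proof -
    obtain p q where pq: "p \<in> Y" "q \<in> Y" "p \<noteq> q"
      using n2 by (metis card_le_Suc0_iff_eq fY not_less_eq_eq numeral_2_eq_2)
    then have M: "affine hull {p, q} \<in> lines_of Y" unfolding lines_of_def by auto
    have "2 \<le> real (c (affine hull {p, q}))" using c2[OF M] by simp
    also have "\<dots> \<le> n / 2^25" using poor[OF M] unfolding c_def n_def by simp
    finally show ?thesis by simp
  qed
  have Nn: "real N \<le> n / 2^25" unfolding N_def using n26 by (intro of_nat_floor) simp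
  have Ls: "real (card (L s)) \<le> 32 * n / real s + 4096 * n^2 / (real s)^3" if "s \<ge> 2" for s
    using card_rich_lines_le[OF fY that] unfolding L_def c_def n_def .
  have "n^2 - n \<le> (\<Sum>M\<in>lines_of Y. (real (c M))^2)"
  proof -
    have "card (Y \<times> Y) \<le> card ((\<lambda>p. (p, p)) ` Y \<union> (\<Union>M\<in>lines_of Y. (Y \<inter> M) \<times> (Y \<inter> M)))"
    proof (rule card_mono)
      show "finite ((\<lambda>p. (p, p)) ` Y \<union> (\<Union>M\<in>lines_of Y. (Y \<inter> M) \<times> (Y \<inter> M)))"
        using fY fL by auto
      show "Y \<times> Y \<subseteq> (\<lambda>p. (p, p)) ` Y \<union> (\<Union>M\<in>lines_of Y. (Y \<inter> M) \<times> (Y \<inter> M))"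
      proof clarify
        fix p q assume pq: "p \<in> Y" "q \<in> Y" "(p, q) \<notin> (\<Union>M\<in>lines_of Y. (Y \<inter> M) \<times> (Y \<inter> M))"
        have "p \<in> affine hull {p, q}" "q \<in> affine hull {p, q}" by (rule hull_inc; simp)+
        then have "affine hull {p, q} \<notin> lines_of Y" using pq by blast
        then have "p = q" using pq unfolding lines_of_def by blast
        then show "(p, q) \<in> (\<lambda>p. (p, p)) ` Y" using pq by simp
      qed
    qed
    also have "\<dots> \<le> card Y + (\<Sum>M\<in>lines_of Y. card ((Y \<inter> M) \<times> (Y \<inter> M)))"
      by (rule order_trans[OF card_Un_le add_mono[OF card_image_le[OF fY] card_UN_le[OF fL]]])
    finally have "real (card Y * card Y) \<le> real (card Y + (\<Sum>M\<in>lines_of Y. c M * c M))"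
      unfolding c_def card_cartesian_product of_nat_le_iff .
    then show ?thesis unfolding n_def by (simp add: power2_eq_square)
  qed
  \<comment> \<open>Layer by layer: c^2 is at most K^2 plus the sum of 2 s over K < s \<le> c.
    Exchanging the sums brings in the numbers of s-rich lines.\<close>
  also have "\<dots> \<le> (\<Sum>M\<in>lines_of Y. (real K)^2 + (\<Sum>s\<in>{K+1..N}. if s \<le> c M then 2 * real s else 0))"
  proof (rule sum_mono)
    fix M assume M: "M \<in> lines_of Y"
    have *: "(real (K + d))^2 \<le> (real K)^2 + (\<Sum>s\<in>{K+1..K+d}. 2 * real s)" for d
    proof (induction d)
      case (Suc d)
      moreover have "{K+1..K + Suc d} = insert (K + Suc d) {K+1..K+d}" by auto
      ultimately show ?case by (simp add: power2_eq_square algebra_simps)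
    qed simp
    show "(real (c M))^2 \<le> (real K)^2 + (\<Sum>s\<in>{K+1..N}. if s \<le> c M then 2 * real s else 0)"
    proof (cases "K \<le> c M")
      case True
      have eq: "{K+1..c M} = {s \<in> {K+1..N}. s \<le> c M}" using cN[OF M] by auto
      have "(\<Sum>s\<in>{K+1..N}. if s \<le> c M then 2 * real s else 0) = (\<Sum>s\<in>{K+1..c M}. 2 * real s)"
        unfolding eq by (rule sum.inter_filter[symmetric]) simp
      then show ?thesis using *[of "c M - K"] True by simp
    next
      case False
      then have "(real (c M))^2 \<le> (real K)^2" by (intro power_mono) auto
      moreover have "0 \<le> (\<Sum>s\<in>{K+1..N}. if s \<le> c M then 2 * real s else 0)" by (intro sum_nonneg) auto
      ultimately show ?thesis by linarith
    qed
  qed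
  also have "\<dots> = (real K)^2 * real (card (lines_of Y)) +
      (\<Sum>M\<in>lines_of Y. \<Sum>s\<in>{K+1..N}. if s \<le> c M then 2 * real s else 0)"
    by (simp add: sum.distrib)
  also have "(\<Sum>M\<in>lines_of Y. \<Sum>s\<in>{K+1..N}. if s \<le> c M then 2 * real s else 0) =
      (\<Sum>s\<in>{K+1..N}. \<Sum>M\<in>lines_of Y. if s \<le> c M then 2 * real s else 0)"
    by (rule sum.swap)
  also have "\<dots> = (\<Sum>s\<in>{K+1..N}. 2 * real s * real (card (L s)))"
    unfolding L_def using fL by (simp add: sum.inter_filter[symmetric] mult.commute)
  also have "\<dots> \<le> (\<Sum>s\<in>{K+1..N}. 64 * n + 8192 * n^2 * (1 / (real s)^2))"
  proof (rule sum_mono)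
    fix s assume "s \<in> {K+1..N}"
    then have s: "s \<ge> 2" "real s > 0" by (auto simp: K_def)
    have "2 * real s * real (card (L s)) \<le> 2 * real s * (32 * n / real s + 4096 * n^2 / (real s)^3)"
      using Ls[OF s(1)] s(2) by (intro mult_left_mono) auto
    also have "\<dots> = 64 * n + 8192 * n^2 * (1 / (real s)^2)"
      using s by (simp add: field_simps power2_eq_square power3_eq_cube)
    finally show "2 * real s * real (card (L s)) \<le> 64 * n + 8192 * n^2 * (1 / (real s)^2)" .
  qed
  also have "\<dots> = real (card {K+1..N}) * (64 * n) + 8192 * n^2 * (\<Sum>s\<in>{K+1..N}. 1 / (real s)^2)"
    by (simp only: sum.distrib sum_distrib_left sum_constant)
  \<comment> \<open>The two constants are tuned here: richness at most n / 2^25 makes the first term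
    n^2 / 2^19, and K = 2^16 makes the second n^2 / 8.\<close>
  also have "\<dots> \<le> (n / 2^25) * (64 * n) + 8192 * n^2 * (1 / real K)"
  proof (intro add_mono mult_mono)
    show "real (card {K+1..N}) \<le> n / 2^25" using Nn by simp
    show "(\<Sum>s\<in>{K+1..N}. 1 / (real s)^2) \<le> 1 / real K" by (rule sum_inverse_squares_le) (simp add: K_def)
  qed (use n26 in \<open>auto intro!: sum_nonneg\<close>)
  finally have "n^2 - n \<le> 2^32 * real (card (lines_of Y)) + n^2 / 2^19 + n^2 / 8"
    unfolding K_def by (simp add: power2_eq_square)
  moreover have "n \<le> n^2 / 8" using n26 by (simp add: power2_eq_square)
  ultimately show ?thesis unfolding n_def[symmetric] using zero_le_power2[of n] by (simp add: field_simps)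
qed

section \<open>Planes and central projection\<close>

definition beck_eps :: real where "beck_eps = 1 / 2^25"
definition beck_con :: real where "beck_con = 1 / 2^33"

lemma beck_const_bounds: "0 < beck_eps" "beck_eps \<le> 1" "0 < beck_con" "beck_con \<le> 1"
  unfolding beck_eps_def beck_con_def by simp_all

lemma beck:
  assumes "finite Y" "card Y \<ge> 2"
    and "\<And>M. M \<in> lines_of Y \<Longrightarrow> real (card (Y \<inter> M)) \<le> beck_eps * real (card Y)"
  shows "beck_con * (real (card Y))^2 \<le> real (card (lines_of Y))"
  using beck_numeric[OF assms(1,2)] assms(3) unfolding beck_eps_def beck_con_def by simp

section \<open>Incidences of points, lines and planes\<close>

lemma plane_affine_hull_3:
  assumes "x \<noteq> y" "z \<notin> affine hull {x, y}"
  shows "plane (affine hull {x, y, z})"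
proof -
  have "\<not> collinear {x, y, z}" using assms collinear_3_affine_hull by blast
  then have "aff_dim {x, y, z} > 1" by (simp add: collinear_aff_dim)
  moreover have "aff_dim {x, y, z} \<le> int (card {x, y, z}) - 1" by (rule aff_dim_le_card) simp
  then have "aff_dim {x, y, z} \<le> 2" using card_insert_le_m1[of 3 "{y,z}" x] card_insert_le_m1[of 2 "{z}" y] by simp
  ultimately show ?thesis unfolding plane_def by simp
qed

lemma plane_eq_affine_hull_3:
  assumes "plane P" "x \<in> P" "y \<in> P" "z \<in> P" "x \<noteq> y" "z \<notin> affine hull {x, y}"
  shows "P = affine hull {x, y, z}"
proof -
  have Q: "plane (affine hull {x, y, z})" using assms by (intro plane_affine_hull_3)
  have "affine hull {x, y, z} \<subseteq> P" using assms unfolding plane_def by (intro hull_minimal) auto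
  then have "affine hull {x, y, z} = P"
    using Q assms(1) unfolding plane_def by (intro affine_dim_equal) auto
  then show ?thesis ..
qed

lemma plane_unique:
  assumes "plane P" "plane Q" "x \<in> P" "y \<in> P" "z \<in> P" "x \<in> Q" "y \<in> Q" "z \<in> Q"
    "x \<noteq> y" "z \<notin> affine hull {x, y}"
  shows "P = Q"
  using assms plane_eq_affine_hull_3 by metis

lemma line_subset_plane: "plane P \<Longrightarrow> x \<in> P \<Longrightarrow> y \<in> P \<Longrightarrow> affine hull {x, y} \<subseteq> P"
  unfolding plane_def by (intro hull_minimal) auto

lemma lines_of_subset_plane:
  assumes "plane P" "M \<in> lines_of Y" "x \<in> M" "y \<in> M" "x \<noteq> y" "x \<in> P" "y \<in> P"
  shows "M \<subseteq> P"
  using lines_of_eqI[OF assms(2-5)] line_subset_plane[OF assms(1,6,7)] by simp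

lemma in_line_left: "x \<in> affine hull {x, y}" and in_line_right: "y \<in> affine hull {x, y}"
  by (rule hull_inc; simp)+

lemma plane_insert:
  assumes "M \<in> lines_of Y" "q \<notin> M"
  shows "plane (affine hull (insert q M))"
proof -
  obtain x y where xy: "x \<noteq> y" "M = affine hull {x, y}" using assms(1) by (rule lines_of_obtain)
  have "affine hull (insert q M) = affine hull (insert q {x, y})"
    unfolding xy(2) by (rule hull_insert[symmetric])
  also have "insert q {x, y} = {x, y, q}" by auto
  finally show ?thesis using plane_affine_hull_3[OF xy(1)] assms(2) xy(2) by simp
qed

lemma plane_insert_eq:
  assumes "M \<in> lines_of Y" "q \<notin> M" "plane P" "M \<subseteq> P" "q \<in> P"
  shows "affine hull (insert q M) = P"
proof -
  obtain x y where xy: "x \<in> M" "y \<in> M" "x \<noteq> y" "M = affine hull {x, y}"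
    using assms(1) by (rule lines_of_obtain)
  have *: "insert q M \<subseteq> affine hull (insert q M)" by (rule hull_subset)
  show ?thesis
    by (rule plane_unique[OF plane_insert[OF assms(1,2)] assms(3), of x y q]) (use xy assms * in auto)
qed

lemma line_in_some_plane:
  assumes "M \<in> lines_of Y"
  shows "\<exists>P. plane P \<and> M \<subseteq> P"
proof -
  obtain x y where xy: "x \<noteq> y" "M = affine hull {x, y}" using assms by (rule lines_of_obtain)
  have "aff_dim M = 1" unfolding xy(2) using xy(1) by (simp add: aff_dim_2)
  then have "M \<noteq> UNIV" by auto
  then obtain q where "q \<notin> M" by auto
  then show ?thesis using plane_insert[OF assms, of q] hull_subset[of "insert q M" affine] by blast
qed

section \<open>Counting images through coincidences\<close>

lemma card_sq_le_collisions:
  assumes fA: "finite A"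
  shows "(card A)^2 \<le> card (f ` A) * card {(a, b) \<in> A \<times> A. f a = f b}"
proof -
  define F where "F z = {a\<in>A. f a = z}" for z
  have fF: "finite (F z)" for z using fA unfolding F_def by simp
  have "card A = card (\<Union>z\<in>f ` A. F z)" unfolding F_def by (rule arg_cong[of _ _ card]) auto
  also have "\<dots> = (\<Sum>z\<in>f ` A. card (F z))"
    using fA fF by (intro card_UN_disjoint) (auto simp: F_def)
  finally have A: "real (card A) = (\<Sum>z\<in>f ` A. 1 * real (card (F z)))" by simp
  have "{(a, b) \<in> A \<times> A. f a = f b} = (\<Union>z\<in>f ` A. F z \<times> F z)" unfolding F_def by auto
  then have "card {(a, b) \<in> A \<times> A. f a = f b} = card (\<Union>z\<in>f ` A. F z \<times> F z)" by simp
  also have "\<dots> = (\<Sum>z\<in>f ` A. card (F z \<times> F z))"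
    using fA fF by (intro card_UN_disjoint) (auto simp: F_def)
  finally have C: "real (card {(a, b) \<in> A \<times> A. f a = f b}) = (\<Sum>z\<in>f ` A. (real (card (F z)))^2)"
    by (simp add: card_cartesian_product power2_eq_square)
  have "(real (card A))^2 \<le> (\<Sum>z\<in>f ` A. 1^2) * (\<Sum>z\<in>f ` A. (real (card (F z)))^2)"
    unfolding A by (rule Cauchy_Schwarz_ineq_sum)
  then have "real ((card A)^2) \<le> real (card (f ` A) * card {(a, b) \<in> A \<times> A. f a = f b})"
    unfolding C[symmetric] by simp
  then show ?thesis using of_nat_le_iff by blast
qed

text \<open>The form in which all later counts use Cauchy-Schwarz. Coincidences are ordered pairs
  and include the diagonal, which supplies the 1 in the later factors such as 1 + K.\<close>

lemma card_image_ge: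
  assumes fA: "finite A" and K: "K > 0"
    and col: "real (card {(a, b) \<in> A \<times> A. f a = f b}) \<le> K * real (card A)"
  shows "real (card A) / K \<le> real (card (f ` A))"
proof (cases "card A = 0")
  case False
  define n where "n = real (card A)"
  have n: "n > 0" using False unfolding n_def by simp
  have "n^2 \<le> real (card (f ` A) * card {(a, b) \<in> A \<times> A. f a = f b})"
    unfolding n_def of_nat_power[symmetric] of_nat_le_iff by (rule card_sq_le_collisions[OF fA])
  also have "\<dots> \<le> real (card (f ` A)) * (K * n)"
    using col unfolding n_def by (simp add: mult_left_mono)
  finally have "n * n \<le> n * (K * real (card (f ` A)))" by (simp add: power2_eq_square algebra_simps)
  then have "n \<le> K * real (card (f ` A))" using n by simp
  then show ?thesis using K unfolding n_def by (simp add: field_simps)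
qed simp

text \<open>Small indices contribute at most \<kappa> B / 2 each, hence at most half of the required
  total; the rest must come from large indices, which contribute at most B each.\<close>

lemma popular:
  fixes f :: "'a \<Rightarrow> real"
  assumes fI: "finite I" and B: "B > 0" and ub: "\<And>i. i \<in> I \<Longrightarrow> f i \<le> B"
    and tot: "\<kappa> * real (card I) * B \<le> (\<Sum>i\<in>I. f i)" and \<kappa>: "\<kappa> \<ge> 0"
  shows "\<kappa> * real (card I) / 2 \<le> real (card {i\<in>I. \<kappa> * B / 2 \<le> f i})"
proof -
  let ?G = "{i\<in>I. \<kappa> * B / 2 \<le> f i}"
  have "(\<Sum>i\<in>I. f i) \<le> (\<Sum>i\<in>I. \<kappa> * B / 2 + (if \<kappa> * B / 2 \<le> f i then B else 0))"
  proof (rule sum_mono)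
    fix i assume "i \<in> I"
    then show "f i \<le> \<kappa> * B / 2 + (if \<kappa> * B / 2 \<le> f i then B else 0)"
      using ub[of i] B \<kappa> by (simp add: add_increasing)
  qed
  also have "\<dots> = real (card I) * (\<kappa> * B / 2) + real (card ?G) * B"
    using fI by (simp add: sum.distrib sum.inter_filter[symmetric])
  finally have "B * (\<kappa> * real (card I) / 2) \<le> B * real (card ?G)" using tot by (simp add: algebra_simps)
  then show ?thesis using B by simp
qed

section \<open>Planes through a point as lines of a central projection\<close>

definition planes_through :: "real ^ 3 \<Rightarrow> (real ^ 3) set \<Rightarrow> (real ^ 3) set set" where
  "planes_through x R = {P. plane P \<and> x \<in> P \<and>
     (\<exists>q\<in>R \<inter> P. \<exists>q'\<in>R \<inter> P. q \<noteq> x \<and> q' \<notin> affine hull {x, q})}"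

lemma planes_throughI:
  assumes "plane P" "x \<in> P" "q \<in> R" "q \<in> P" "q' \<in> R" "q' \<in> P" "q \<noteq> x" "q' \<notin> affine hull {x, q}"
  shows "P \<in> planes_through x R"
  unfolding planes_through_def using assms by blast

lemma planes_through_subset:
  assumes "x \<in> T" "R \<subseteq> T"
  shows "planes_through x R \<subseteq> spanned_planes T"
proof
  fix P assume "P \<in> planes_through x R"
  then obtain q q' where *: "plane P" "x \<in> P" "q \<in> R \<inter> P" "q' \<in> R \<inter> P" "q \<noteq> x" "q' \<notin> affine hull {x, q}"
    unfolding planes_through_def by blast
  then have "\<not> collinear {x, q, q'}" using collinear_3_affine_hull[of x q q'] by simp
  then show "P \<in> spanned_planes T" using * assms unfolding spanned_planes_def by blast
qed

lemma finite_spanned_planes: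
  assumes "finite T"
  shows "finite (spanned_planes T)"
proof -
  have "spanned_planes T \<subseteq> (\<lambda>z. affine hull {fst z, fst (snd z), snd (snd z)}) ` (T \<times> T \<times> T)"
  proof
    fix P assume "P \<in> spanned_planes T"
    then obtain x y z where P: "plane P" "x \<in> T" "y \<in> T" "z \<in> T" "x \<in> P" "y \<in> P" "z \<in> P"
      "\<not> collinear {x, y, z}" unfolding spanned_planes_def by auto
    then have "x \<noteq> y" by auto
    moreover have "z \<notin> affine hull {x, y}" using P(8) \<open>x \<noteq> y\<close> collinear_3_affine_hull by blast
    ultimately have "P = affine hull {x, y, z}" using P by (intro plane_eq_affine_hull_3)
    then show "P \<in> (\<lambda>z. affine hull {fst z, fst (snd z), snd (snd z)}) ` (T \<times> T \<times> T)"
      using P by (intro image_eqI[of _ _ "(x, y, z)"]) auto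
  qed
  then show ?thesis using assms by (meson finite_SigmaI finite_surj)
qed

text \<open>A point q is represented by the multiple of q - x whose inner product with
  \<open>u\<close> is 1. Rescaling coefficients turns affine combinations of the two images into
  combinations of q - x and q' - x, and back.\<close>

lemma central_projection_line:
  fixes x q q' u :: "real ^ 3"
  assumes u: "u \<bullet> (q - x) \<noteq> 0" "u \<bullet> (q' - x) \<noteq> 0"
  shows "affine hull {(1 / (u \<bullet> (q - x))) *\<^sub>R (q - x), (1 / (u \<bullet> (q' - x))) *\<^sub>R (q' - x)}
    = {z. u \<bullet> z = 1 \<and> x + z \<in> affine hull {x, q, q'}}" (is "affine hull {?g, ?g'} = ?F")
proof (intro set_eqI iffI)
  define a where "a = u \<bullet> (q - x)"
  define b where "b = u \<bullet> (q' - x)"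
  note ab = a_def b_def
  have ab0: "a \<noteq> 0" "b \<noteq> 0" using u unfolding ab by auto
  fix z
  {
    assume "z \<in> affine hull {?g, ?g'}"
    then obtain s t where st: "s + t = 1" "z = s *\<^sub>R ?g + t *\<^sub>R ?g'"
      unfolding affine_hull_2 by auto
    have "u \<bullet> ?g = 1" "u \<bullet> ?g' = 1" using u by (simp_all only: inner_scaleR_right) auto
    then have "u \<bullet> z = 1" unfolding st(2) inner_add_right inner_scaleR_right[of u s] inner_scaleR_right[of u t]
      using st(1) by simp
    moreover have "x + z = (1 - s / a - t / b) *\<^sub>R x + (s / a) *\<^sub>R q + (t / b) *\<^sub>R q'"
      unfolding st(2) ab[symmetric] by (simp add: algebra_simps)
    then have "x + z \<in> affine hull {x, q, q'}"
      unfolding affine_hull_3 by (smt (verit) mem_Collect_eq)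
    ultimately show "z \<in> ?F" by simp
  }
  {
    assume z: "z \<in> ?F"
    then obtain r s t where st: "r + s + t = 1" "x + z = r *\<^sub>R x + s *\<^sub>R q + t *\<^sub>R q'"
      unfolding affine_hull_3 by auto
    have r: "r = 1 - s - t" using st(1) by simp
    have "z = (x + z) - x" by simp
    also have "\<dots> = s *\<^sub>R (q - x) + t *\<^sub>R (q' - x)" unfolding st(2) r by (simp add: algebra_simps)
    finally have z': "z = s *\<^sub>R (q - x) + t *\<^sub>R (q' - x)" .
    then have "s * a + t * b = 1" using z unfolding ab by (simp only: inner_add_right inner_scaleR_right mem_Collect_eq)
    moreover have "z = (s * a) *\<^sub>R ?g + (t * b) *\<^sub>R ?g'"
      unfolding ab[symmetric] using z' ab0 by simp
    ultimately show "z \<in> affine hull {?g, ?g'}" unfolding affine_hull_2 by blast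
  }
qed

text \<open>Beck's theorem for the central projection of \<^term>\<open>R\<close> from \<^term>\<open>x\<close> to an affine plane
  \<open>{z. u \<bullet> (z - x) = 1}\<close>, whose lines correspond to the planes through \<^term>\<open>x\<close>.\<close>

lemma planes_through_ge:
  assumes fR: "finite R" and x: "x \<notin> R" and \<rho>2: "card ((\<lambda>q. affine hull {x, q}) ` R) \<ge> 2"
    and poor: "\<And>P. plane P \<Longrightarrow> x \<in> P \<Longrightarrow>
      real (card (R \<inter> P)) \<le> beck_eps * real (card ((\<lambda>q. affine hull {x, q}) ` R))"
  shows "beck_con * (real (card ((\<lambda>q. affine hull {x, q}) ` R)))^2 \<le> real (card (planes_through x R))"
proof -
  \<comment> \<open>One point is kept for each direction from \<open>x\<close>, so that the
    projection is injective and its image counts directions.\<close>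
  obtain R' where R': "R' \<subseteq> R" "inj_on (\<lambda>q. affine hull {x, q}) R'"
      "(\<lambda>q. affine hull {x, q}) ` R = (\<lambda>q. affine hull {x, q}) ` R'"
    using subset_image_inj[of "(\<lambda>q. affine hull {x, q}) ` R" "\<lambda>q. affine hull {x, q}" R] by auto
  have fR': "finite R'" using R'(1) fR finite_subset by blast
  have \<rho>: "card ((\<lambda>q. affine hull {x, q}) ` R) = card R'" unfolding R'(3) by (rule card_image[OF R'(2)])
  have "finite ((\<lambda>q. q - x) ` R')" "0 \<notin> (\<lambda>q. q - x) ` R'" using fR' x R'(1) by auto
  then obtain u where u: "\<And>q. q \<in> R' \<Longrightarrow> u \<bullet> (q - x) \<noteq> 0"
    using exists_inner_nonzero[of "(\<lambda>q. q - x) ` R'"] by auto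
  define g where "g q = (1 / (u \<bullet> (q - x))) *\<^sub>R (q - x)" for q
  have off: "q' \<notin> affine hull {x, q}" if "q \<in> R'" "q' \<in> R'" "q \<noteq> q'" for q q'
  proof
    assume "q' \<in> affine hull {x, q}"
    then have "affine hull {x, q'} = affine hull {x, q}"
      using x R'(1) that by (intro affine_hull_2_eq in_line_left) auto
    then show False using R'(2) that by (auto dest: inj_onD)
  qed
  have on_ray: "q \<in> affine hull {x, x + g q}" if "q \<in> R'" for q
  proof -
    have "q = (1 - u \<bullet> (q - x)) *\<^sub>R x + (u \<bullet> (q - x)) *\<^sub>R (x + g q)"
      unfolding g_def using u[OF that] by (simp add: algebra_simps)
    moreover have "(1 - u \<bullet> (q - x)) + u \<bullet> (q - x) = 1" by simp
    ultimately show ?thesis unfolding affine_hull_2 by blast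
  qed
  have forth: "x + g q \<in> affine hull {x, q}" for q
  proof -
    have "x + g q = (1 - 1 / (u \<bullet> (q - x))) *\<^sub>R x + (1 / (u \<bullet> (q - x))) *\<^sub>R q"
      unfolding g_def by (simp add: algebra_simps)
    moreover have "(1 - 1 / (u \<bullet> (q - x))) + 1 / (u \<bullet> (q - x)) = 1" by simp
    ultimately show ?thesis unfolding affine_hull_2 by blast
  qed
  have injg: "inj_on g R'"
  proof (rule inj_onI, rule ccontr)
    fix q q' assume q: "q \<in> R'" "q' \<in> R'" "g q = g q'" "q \<noteq> q'"
    have "affine hull {x, x + g q} \<subseteq> affine hull {x, q}"
      using forth[of q] in_line_left[of x q] by (intro hull_minimal) auto
    then have "q' \<in> affine hull {x, q}" using on_ray[OF q(2)] q(3) by auto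
    then show False using off[OF q(1,2,4)] by simp
  qed
  define Y where "Y = g ` R'"
  define F where "F P = {z. u \<bullet> z = 1 \<and> x + z \<in> P}" for P
  have cY: "card Y = card R'" unfolding Y_def by (rule card_image[OF injg])
  have lines: "\<exists>P. plane P \<and> x \<in> P \<and> P \<in> planes_through x R \<and> M = F P" if M: "M \<in> lines_of Y" for M
  proof -
    obtain y y' where "y \<in> Y" "y' \<in> Y" "y \<noteq> y'" "M = affine hull {y, y'}"
      using M by (rule lines_of_obtain)
    then obtain q q' where q: "q \<in> R'" "q' \<in> R'" "q \<noteq> q'" "M = affine hull {g q, g q'}"
      unfolding Y_def by auto
    have xq: "x \<noteq> q" using q(1) R'(1) x by auto
    have "plane (affine hull {x, q, q'})" by (rule plane_affine_hull_3[OF xq off[OF q(1-3)]])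
    moreover have i: "x \<in> affine hull {x, q, q'}" "q \<in> affine hull {x, q, q'}" "q' \<in> affine hull {x, q, q'}"
      by (rule hull_inc; simp)+
    moreover have "affine hull {x, q, q'} \<in> planes_through x R"
      using calculation off[OF q(1-3)] q R'(1) xq by (intro planes_throughI[of _ x q R q']) auto
    moreover have "M = F (affine hull {x, q, q'})"
      unfolding q(4) g_def F_def by (rule central_projection_line) (use u q in auto)
    ultimately show ?thesis by blast
  qed
  have "beck_con * (real (card Y))^2 \<le> real (card (lines_of Y))"
  proof (rule beck)
    show "finite Y" unfolding Y_def using fR' by simp
    show "card Y \<ge> 2" using \<rho>2 cY \<rho> by simp
    fix M assume "M \<in> lines_of Y"
    then obtain P where P: "plane P" "x \<in> P" "M = F P" using lines by blast
    \<comment> \<open>Beck's theorem asks about the directions inside a plane, the hypothesis bounds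
      its points; each direction comes from at least one point.\<close>
    have "Y \<inter> M \<subseteq> g ` (R \<inter> P)"
    proof
      fix y assume "y \<in> Y \<inter> M"
      then obtain q where q: "q \<in> R'" "y = g q" "x + g q \<in> P" unfolding Y_def P(3) F_def by auto
      have "q \<in> P" using on_ray[OF q(1)] line_subset_plane[OF P(1,2) q(3)] by auto
      then show "y \<in> g ` (R \<inter> P)" using q R'(1) by auto
    qed
    then have "card (Y \<inter> M) \<le> card (R \<inter> P)"
      using fR by (meson finite_Int surj_card_le)
    then show "real (card (Y \<inter> M)) \<le> beck_eps * real (card Y)"
      using poor[OF P(1,2)] unfolding \<rho> cY by linarith
  qed
  moreover have "card (lines_of Y) \<le> card (planes_through x R)"
  proof (rule surj_card_le)
    have "finite (spanned_planes (insert x R))" using fR by (intro finite_spanned_planes) simp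
    then show "finite (planes_through x R)" using planes_through_subset[of x "insert x R" R]
      by (meson finite_subset insertI1 subset_insertI)
    show "lines_of Y \<subseteq> F ` planes_through x R" using lines by blast
  qed
  ultimately show ?thesis unfolding \<rho> cY by linarith
qed

section \<open>Cones and pairs of skew lines\<close>

text \<open>A line joining \<open>A\<close> to \<open>B\<close> meets \<open>l\<close> once, so two
  pairs with the same join share their point of \<open>A\<close>. A coincidence off the diagonal is
  therefore determined by two distinct points of \<open>B\<close>, whose join recovers the point on
  \<open>l\<close>. There are at most \<open>card B\<close> squared of these against
  \<open>card A * card B\<close> pairs.\<close>

lemma card_join_lines_ge:
  assumes fA: "finite A" and fB: "finite B" and l: "l \<in> lines_of S" and A: "A \<subseteq> l" and B: "B \<inter> l = {}"
    and K: "K \<ge> 0" "real (card B) \<le> K * real (card A)"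
  shows "real (card A) * real (card B) / (1 + K) \<le> real (card ((\<lambda>z. affine hull {fst z, snd z}) ` (A \<times> B)))"
proof -
  let ?f = "\<lambda>z. affine hull {fst z, snd z} :: (real ^ 3) set"
  define C where "C = {(z, z') \<in> (A \<times> B) \<times> (A \<times> B). ?f z = ?f z'}"
  have key: "x = x'" if "x \<in> A" "x' \<in> A" "y \<in> B" "affine hull {x, y} = affine hull {x', y'}" for x x' y y'
  proof (rule ccontr)
    assume ne: "x \<noteq> x'"
    have "x' \<in> affine hull {x, y}" using that(4) in_line_left by metis
    then have "affine hull {x, x'} = affine hull {x, y}"
      using ne by (intro affine_hull_2_eq in_line_left)
    moreover have "l = affine hull {x, x'}" using lines_of_eqI[OF l] A that ne by blast
    ultimately have "y \<in> l" using in_line_right by metis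
    then show False using B that by auto
  qed
  define C2 where "C2 = {z \<in> C. snd (fst z) \<noteq> snd (snd z)}"
  have "C \<subseteq> (\<lambda>z. (z, z)) ` (A \<times> B) \<union> C2"
  proof
    fix c assume c: "c \<in> C"
    obtain x y x' y' where [simp]: "c = ((x, y), (x', y'))" by (metis surj_pair)
    have *: "x \<in> A" "x' \<in> A" "y \<in> B" "y' \<in> B" "affine hull {x, y} = affine hull {x', y'}"
      using c unfolding C_def by auto
    have "x = x'" using key[OF *(1-3,5)] .
    then show "c \<in> (\<lambda>z. (z, z)) ` (A \<times> B) \<union> C2" using * c unfolding C2_def by auto
  qed
  moreover have fC2: "finite C2" unfolding C2_def C_def
    by (rule finite_subset[of _ "(A \<times> B) \<times> (A \<times> B)"]) (use fA fB in auto)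
  ultimately have "card C \<le> card ((\<lambda>z. (z, z)) ` (A \<times> B) \<union> C2)"
    using fA fB by (intro card_mono) auto
  also have "\<dots> \<le> card ((\<lambda>z. (z, z)) ` (A \<times> B)) + card C2" by (rule card_Un_le)
  also have "\<dots> \<le> card (A \<times> B) + card C2" using card_image_le[of "A \<times> B"] fA fB by simp
  also have "card C2 \<le> card (B \<times> B)"
  proof (rule card_inj_on_le)
    show "inj_on (\<lambda>z. (snd (fst z), snd (snd z))) C2"
    proof (rule inj_onI)
      fix c c' assume c: "c \<in> C2" "c' \<in> C2" "(snd (fst c), snd (snd c)) = (snd (fst c'), snd (snd c'))"
      obtain x y x2 y2 where c1: "c = ((x, y), (x2, y2))" by (metis surj_pair)
      obtain u v u2 v2 where c2: "c' = ((u, v), (u2, v2))" by (metis surj_pair)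
      have *: "x \<in> A" "x2 \<in> A" "y \<in> B" "y2 \<in> B" "affine hull {x, y} = affine hull {x2, y2}" "y \<noteq> y2"
        using c unfolding C2_def C_def c1 by auto
      have **: "u \<in> A" "u2 \<in> A" "affine hull {u, y} = affine hull {u2, y2}" "v = y" "v2 = y2"
        using c unfolding C2_def C_def c1 c2 by auto
      have "affine hull {y, y2} = affine hull {x, y}"
        using *(5,6) in_line_right[of y2 x2] by (intro affine_hull_2_eq in_line_right) auto
      moreover have "affine hull {y, y2} = affine hull {u, y}"
        using *(6) **(3) in_line_right[of y2 u2] by (intro affine_hull_2_eq in_line_right) auto
      ultimately have "x = u" using key[OF *(1) **(1) *(3), of y] by simp
      moreover have "x2 = x" using key[OF *(1,2,3,5)] by simp
      moreover have "u2 = u" using key[OF **(1,2) *(3) **(3)] by simp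
      ultimately show "c = c'" unfolding c1 c2 using ** by simp
    qed
    show "(\<lambda>z. (snd (fst z), snd (snd z))) ` C2 \<subseteq> B \<times> B" unfolding C2_def C_def by auto
  qed (use fB in simp)
  finally have "real (card C) \<le> real (card A) * real (card B) + real (card B) * real (card B)"
    unfolding card_cartesian_product by (metis add_left_mono of_nat_add of_nat_le_iff of_nat_mult)
  also have "real (card B) * real (card B) \<le> (K * real (card A)) * real (card B)"
    using K by (intro mult_right_mono) auto
  finally have "real (card C) \<le> (1 + K) * real (card (A \<times> B))"
    by (simp add: card_cartesian_product algebra_simps)
  from card_image_ge[OF _ _ this[unfolded C_def]] show ?thesis
    using fA fB K by (simp add: card_cartesian_product)
qed

lemma spanned_planesI:
  assumes "plane P" "x \<in> T" "y \<in> T" "z \<in> T" "x \<in> P" "y \<in> P" "z \<in> P" "x \<noteq> y" "z \<notin> affine hull {x, y}"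
  shows "P \<in> spanned_planes T"
proof -
  have "\<not> collinear {x, y, z}" using assms(8,9) collinear_3_affine_hull by blast
  then show ?thesis using assms unfolding spanned_planes_def by blast
qed

text \<open>Two points \<^term>\<open>q\<close>, \<^term>\<open>q'\<close> off \<^term>\<open>P\<close> span the same plane with a line of \<^term>\<open>P\<close> only if
  that line lies in the plane of \<^term>\<open>q\<close>, \<^term>\<open>q'\<close> and some point of \<^term>\<open>T \<inter> P\<close>, so there are at most
  \<^term>\<open>card (T \<inter> P)\<close> such lines.\<close>

lemma cone_planes:
  assumes fT: "finite T" and P: "plane P" and K: "K \<ge> 0"
    "real (card (T - P)) * real (card (T \<inter> P)) \<le> K * real (card (lines_of (T \<inter> P)))"
  shows "real (card (lines_of (T \<inter> P))) * real (card (T - P)) / (1 + K) \<le> real (card (spanned_planes T))"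
proof -
  define L where "L = lines_of (T \<inter> P)"
  define W where "W = T - P"
  define f where "f z = affine hull (insert (snd z) (fst z))" for z :: "(real ^ 3) set \<times> (real ^ 3)"
  define C where "C = {(z, z') \<in> (L \<times> W) \<times> (L \<times> W). f z = f z'}"
  have fL: "finite L" unfolding L_def using fT by (intro finite_lines_of) simp
  have fW: "finite W" unfolding W_def using fT by simp
  have LP: "M \<subseteq> P" if M: "M \<in> L" for M
  proof -
    obtain p p' where pp: "p \<in> T \<inter> P" "p' \<in> T \<inter> P" "p \<noteq> p'" "M = affine hull {p, p'}"
      using M unfolding L_def by (rule lines_of_obtain)
    then show ?thesis using line_subset_plane[OF P] by auto
  qed
  have off: "q \<notin> M" if "M \<in> L" "q \<in> W" for M q using LP[OF that(1)] that(2) unfolding W_def by auto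
  have pl: "plane (f (M, q))" "M \<subseteq> f (M, q)" "q \<in> f (M, q)" if "M \<in> L" "q \<in> W" for M q
    using plane_insert[of M _ q] off[OF that] that hull_subset[of "insert q M" affine]
    unfolding L_def f_def by auto
  have in_sp: "f (M, q) \<in> spanned_planes T" if Mq: "M \<in> L" "q \<in> W" for M q
  proof -
    obtain p p' where pp: "p \<in> T \<inter> P" "p' \<in> T \<inter> P" "p \<noteq> p'" "M = affine hull {p, p'}" "p \<in> M" "p' \<in> M"
      using Mq(1) unfolding L_def by (rule lines_of_obtain)
    show ?thesis
      by (rule spanned_planesI[of _ p T p' q]) (use pp pl[OF Mq] off[OF Mq] Mq W_def in auto)
  qed
  \<comment> \<open>A plane that contains a point off \<open>P\<close> contains at most one line of
    \<open>P\<close>, so it determines its line.\<close>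
  have inj: "M = M'" if *: "M \<in> L" "M' \<in> L" "q \<in> Q" "q \<in> W" "plane Q" "M \<subseteq> Q" "M' \<subseteq> Q" for M M' q Q
  proof (rule ccontr)
    assume ne: "M \<noteq> M'"
    obtain p p' where pp: "p \<noteq> p'" "M = affine hull {p, p'}" "p \<in> M" "p' \<in> M"
      using *(1) unfolding L_def by (rule lines_of_obtain)
    obtain r r' where rr: "r \<noteq> r'" "M' = affine hull {r, r'}" "r \<in> M'" "r' \<in> M'"
      using *(2) unfolding L_def by (rule lines_of_obtain)
    obtain z where z: "z \<in> M'" "z \<notin> M"
      using ne rr lines_of_unique[OF *(1,2)[unfolded L_def], of r r'] by blast
    have "P = Q" by (rule plane_unique[OF P *(5), of p p' z]) (use pp z LP * in auto)
    then show False using * unfolding W_def by auto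
  qed
  define C2 where "C2 = {z \<in> C. snd (fst z) \<noteq> snd (snd z)}"
  have "C \<subseteq> (\<lambda>z. (z, z)) ` (L \<times> W) \<union> C2"
  proof
    fix c assume c: "c \<in> C"
    obtain M q M' q' where [simp]: "c = ((M, q), (M', q'))" by (metis surj_pair)
    have *: "M \<in> L" "M' \<in> L" "q \<in> W" "q' \<in> W" "f (M, q) = f (M', q')"
      using c unfolding C_def by auto
    have "M = M'" using inj[OF *(1,2) pl(3)[OF *(1,3)] *(3)] pl[OF *(1,3)] pl[OF *(2,4)] * by simp
    then show "c \<in> (\<lambda>z. (z, z)) ` (L \<times> W) \<union> C2" using * c unfolding C2_def by auto
  qed
  moreover have fC2: "finite C2" unfolding C2_def C_def
    by (rule finite_subset[of _ "(L \<times> W) \<times> (L \<times> W)"]) (use fL fW in auto)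
  ultimately have "card C \<le> card ((\<lambda>z. (z, z)) ` (L \<times> W) \<union> C2)"
    using fL fW by (intro card_mono) auto
  also have "\<dots> \<le> card ((\<lambda>z. (z, z)) ` (L \<times> W)) + card C2" by (rule card_Un_le)
  also have "\<dots> \<le> card (L \<times> W) + card C2" using card_image_le[of "L \<times> W"] fL fW by simp
  also have "card C2 \<le> card ((W \<times> W) \<times> (T \<inter> P))"
  proof -
    have "\<exists>t. t \<in> T \<inter> P \<and> t \<in> fst (fst c) \<and> t \<notin> affine hull {snd (fst c), snd (snd c)}" if "c \<in> C2" for c
    proof (rule ccontr)
      assume no: "\<nexists>t. t \<in> T \<inter> P \<and> t \<in> fst (fst c) \<and> t \<notin> affine hull {snd (fst c), snd (snd c)}"
      have c: "fst (fst c) \<in> L" "snd (fst c) \<in> W" using that unfolding C2_def C_def by auto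
      obtain p p' where pp: "p \<in> T \<inter> P" "p' \<in> T \<inter> P" "p \<noteq> p'" "fst (fst c) = affine hull {p, p'}"
        "p \<in> fst (fst c)" "p' \<in> fst (fst c)"
        using c(1) unfolding L_def by (rule lines_of_obtain)
      have "affine hull {p, p'} = affine hull {snd (fst c), snd (snd c)}"
        using no pp by (intro affine_hull_2_eq) auto
      then have "snd (fst c) \<in> fst (fst c)" using pp(4) in_line_left by metis
      then show False using off[OF c] by simp
    qed
    then obtain t where t: "\<And>c. c \<in> C2 \<Longrightarrow> t c \<in> T \<inter> P \<and> t c \<in> fst (fst c) \<and> t c \<notin> affine hull {snd (fst c), snd (snd c)}"
      by metis
    show ?thesis
    proof (rule card_inj_on_le)
      show "inj_on (\<lambda>c. ((snd (fst c), snd (snd c)), t c)) C2"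
      proof (rule inj_onI)
        fix c c' assume c: "c \<in> C2" "c' \<in> C2"
          "((snd (fst c), snd (snd c)), t c) = ((snd (fst c'), snd (snd c')), t c')"
        obtain M q M2 q2 where c1: "c = ((M, q), (M2, q2))" by (metis surj_pair)
        obtain N r N2 r2 where c2: "c' = ((N, r), (N2, r2))" by (metis surj_pair)
        have *: "M \<in> L" "M2 \<in> L" "q \<in> W" "q2 \<in> W" "f (M, q) = f (M2, q2)" "q \<noteq> q2"
          using c unfolding C2_def C_def c1 by auto
        have **: "N \<in> L" "N2 \<in> L" "f (N, q) = f (N2, q2)" "r = q" "r2 = q2"
          using c unfolding C2_def C_def c1 c2 by auto
        have tt: "t c \<in> M" "t c \<notin> affine hull {q, q2}" "t c' \<in> N" "t c' = t c"
          using t[OF c(1)] t[OF c(2)] c(3) unfolding c1 c2 by auto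
        note p1 = pl[OF *(1,3)] and p2 = pl[OF *(2,4)] and p3 = pl[OF **(1) *(3)] and p4 = pl[OF **(2) *(4)]
        have eq: "f (M, q) = f (N, q)"
          by (rule plane_unique[OF p1(1) p3(1), of q q2 "t c"])
            (use p1 p2 p3 p4 tt * ** in auto)
        have "M = M2" using inj[OF *(1,2) p1(3) *(3) p1(1)] p1 p2 * by simp
        moreover have "M = N" using inj[OF *(1) **(1) p1(3) *(3) p1(1)] p1 p3 eq by simp
        moreover have "M = N2" using inj[OF *(1) **(2) p1(3) *(3) p1(1)] p1 p4 eq ** by simp
        ultimately show "c = c'" unfolding c1 c2 using ** by simp
      qed
      show "(\<lambda>c. ((snd (fst c), snd (snd c)), t c)) ` C2 \<subseteq> (W \<times> W) \<times> (T \<inter> P)"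
        using t unfolding C2_def C_def by auto
    qed (use fW fT in simp)
  qed
  finally have "card C \<le> card L * card W + card W * card W * card (T \<inter> P)"
    by (simp add: card_cartesian_product)
  then have "real (card C) \<le> real (card L * card W + card W * card W * card (T \<inter> P))"
    unfolding of_nat_le_iff .
  then have "real (card C) \<le> real (card L) * real (card W) + real (card W) * (real (card W) * real (card (T \<inter> P)))"
    by (simp add: mult.assoc)
  also have "real (card W) * (real (card W) * real (card (T \<inter> P))) \<le> real (card W) * (K * real (card L))"
    using K(2) unfolding L_def W_def by (intro mult_left_mono) auto
  finally have "real (card C) \<le> (1 + K) * real (card (L \<times> W))"
    by (simp add: card_cartesian_product algebra_simps)
  from card_image_ge[OF _ _ this[unfolded C_def]]
  have "real (card L) * real (card W) / (1 + K) \<le> real (card (f ` (L \<times> W)))"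
    using fL fW K by (simp add: card_cartesian_product)
  also have "\<dots> \<le> real (card (spanned_planes T))"
    using finite_spanned_planes[OF fT] in_sp by (intro of_nat_mono card_mono) auto
  finally show ?thesis unfolding L_def W_def .
qed

text \<open>Take planes spanned by x in \<open>A\<close>, y in \<open>B\<close> and q in
  \<open>W\<close>. A plane that contains neither line meets them only in x and y, so among
  coincidences only q can vary. Skewness is stated as the absence of a common plane, the form that
  the incidence lemmas use.\<close>

lemma skew_planes:
  assumes fT: "finite T" and l: "l \<in> lines_of S" and M: "M \<in> lines_of S'"
    and skew: "\<And>P. plane P \<Longrightarrow> l \<subseteq> P \<Longrightarrow> M \<subseteq> P \<Longrightarrow> False"
    and A: "A \<subseteq> T \<inter> l" and B: "B \<subseteq> T \<inter> M" and W: "W \<subseteq> T - l - M"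
    and a2: "card A \<ge> 2" and b2: "card B \<ge> 2"
    and K: "K1 \<ge> 0" "K2 \<ge> 0" "real (card W) \<le> K1 * real (card B)" "real (card W) \<le> K2 * real (card A)"
  shows "real (card A) * real (card B) * real (card W) / (4 * (1 + 4 * (K1 + K2)))
    \<le> real (card (spanned_planes T))"
proof -
  have fin: "finite A" "finite B" "finite W" using A B W fT finite_subset by blast+
  have disj: "z \<notin> M" if z: "z \<in> l" for z
  proof
    assume zM: "z \<in> M"
    obtain p p' where pp: "p \<noteq> p'" "M = affine hull {p, p'}" "p \<in> M" "p' \<in> M" using M by (rule lines_of_obtain)
    obtain m where m: "m \<in> M" "m \<noteq> z" using pp by metis
    show False
    proof (cases "m \<in> l")
      case True
      then have "l = M" using lines_of_unique[OF l M] z zM m by blast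
      then show False using line_in_some_plane[OF l] skew by blast
    next
      case False
      have i: "insert m l \<subseteq> affine hull (insert m l)" by (rule hull_subset)
      have "M \<subseteq> affine hull (insert m l)"
        by (rule lines_of_subset_plane[OF plane_insert[OF l False] M m(1) zM m(2)]) (use i z in auto)
      then show False using skew[OF plane_insert[OF l False]] i by auto
    qed
  qed
  have yl: "y \<notin> l" if "y \<in> B" for y using disj B that by blast
  have xM: "x \<notin> M" if "x \<in> A" for x using disj A that by blast
  \<comment> \<open>For given \<open>q\<close>, at most one x spans with \<open>M\<close> a plane
    through \<open>q\<close>: the point where the plane of \<open>q\<close> and \<open>M\<close>
    meets \<open>l\<close>. Without it, and without the analogous y, the spanned plane contains
    neither line.\<close>
  define Al where "Al q = {x\<in>A. q \<notin> affine hull (insert x M)}" for q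
  define Bl where "Bl q = {y\<in>B. q \<notin> affine hull (insert y l)}" for q
  have Al: "card A - 1 \<le> card (Al q)" if q: "q \<in> W" for q
  proof -
    have qM: "q \<notin> M" using q W by auto
    have "x = x'" if *: "x \<in> A - Al q" "x' \<in> A - Al q" for x x'
    proof (rule ccontr)
      assume ne: "x \<noteq> x'"
      have "affine hull (insert q M) = affine hull (insert z M)" if "z \<in> A - Al q" for z
        by (rule plane_insert_eq[OF M qM plane_insert[OF M]])
          (use that xM hull_subset[of "insert z M" affine] in \<open>auto simp: Al_def\<close>)
      from this[OF *(1)] this[OF *(2)]
      have xx: "x \<in> affine hull (insert q M)" "x' \<in> affine hull (insert q M)"
        using hull_subset[of "insert x M" affine] hull_subset[of "insert x' M" affine] by auto
      have "l \<subseteq> affine hull (insert q M)"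
        by (rule lines_of_subset_plane[OF plane_insert[OF M qM] l, of x x']) (use xx * ne A in auto)
      then show False using skew[OF plane_insert[OF M qM]] hull_subset[of "insert q M" affine] by auto
    qed
    then have "card (A - Al q) \<le> Suc 0"
      using fin by (subst card_le_Suc0_iff_eq) auto
    moreover have "card (A - Al q) = card A - card (Al q)"
      using fin by (intro card_Diff_subset) (auto simp: Al_def)
    ultimately show ?thesis by simp
  qed
  have Bl: "card B - 1 \<le> card (Bl q)" if q: "q \<in> W" for q
  proof -
    have ql: "q \<notin> l" using q W by auto
    have "y = y'" if *: "y \<in> B - Bl q" "y' \<in> B - Bl q" for y y'
    proof (rule ccontr)
      assume ne: "y \<noteq> y'"
      have "affine hull (insert q l) = affine hull (insert z l)" if "z \<in> B - Bl q" for z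
        by (rule plane_insert_eq[OF l ql plane_insert[OF l]])
          (use that yl hull_subset[of "insert z l" affine] in \<open>auto simp: Bl_def\<close>)
      from this[OF *(1)] this[OF *(2)]
      have yy: "y \<in> affine hull (insert q l)" "y' \<in> affine hull (insert q l)"
        using hull_subset[of "insert y l" affine] hull_subset[of "insert y' l" affine] by auto
      have "M \<subseteq> affine hull (insert q l)"
        by (rule lines_of_subset_plane[OF plane_insert[OF l ql] M, of y y']) (use yy * ne B in auto)
      then show False using skew[OF plane_insert[OF l ql]] hull_subset[of "insert q l" affine] by auto
    qed
    then have "card (B - Bl q) \<le> Suc 0"
      using fin by (subst card_le_Suc0_iff_eq) auto
    moreover have "card (B - Bl q) = card B - card (Bl q)"
      using fin by (intro card_Diff_subset) (auto simp: Bl_def)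
    ultimately show ?thesis by simp
  qed
  define D where "D = Sigma W (\<lambda>q. Al q \<times> Bl q)"
  define f where "f d = affine hull {fst (snd d), snd (snd d), fst d}" for d :: "(real ^ 3) \<times> (real ^ 3) \<times> (real ^ 3)"
  have fD: "finite D" unfolding D_def using fin by (auto simp: Al_def Bl_def)
  have D: "q \<in> W" "x \<in> A" "y \<in> B" "x \<in> l" "y \<in> M" "x \<noteq> y" "q \<notin> affine hull {x, y}" "plane (f (q, x, y))"
    "q \<in> f (q, x, y)" "x \<in> f (q, x, y)" "y \<in> f (q, x, y)"
    if "(q, x, y) \<in> D" for q x y
  proof -
    show *: "q \<in> W" "x \<in> A" "y \<in> B" "x \<in> l" "y \<in> M" using that A B unfolding D_def Al_def Bl_def by auto
    show **: "x \<noteq> y" using disj * by auto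
    have "affine hull {x, y} \<subseteq> affine hull (insert y l)" using * by (intro hull_mono) auto
    then show ***: "q \<notin> affine hull {x, y}" using that unfolding D_def Bl_def by auto
    show "plane (f (q, x, y))" unfolding f_def using plane_affine_hull_3[OF ** ***] by simp
    show "q \<in> f (q, x, y)" "x \<in> f (q, x, y)" "y \<in> f (q, x, y)" unfolding f_def by (rule hull_inc; simp)+
  qed
  have uniq: "x = x' \<and> y = y'" if d: "(q, x, y) \<in> D" "(q', x', y') \<in> D" "f (q, x, y) = f (q', x', y')" for q x y q' x' y'
  proof (intro conjI; rule ccontr)
    note d1 = D[OF d(1)] and d2 = D[OF d(2)]
    {
      assume ne: "x \<noteq> x'"
      have "l \<subseteq> f (q, x, y)"
        by (rule lines_of_subset_plane[OF d1(8) l, of x x']) (use d1 d2 d ne in auto)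
      then have "affine hull (insert y l) = f (q, x, y)"
        using d1 yl by (intro plane_insert_eq[OF l]) auto
      then show False using d1(9) d(1) unfolding D_def Bl_def by auto
    }
    {
      assume ne: "y \<noteq> y'"
      have "M \<subseteq> f (q, x, y)"
        by (rule lines_of_subset_plane[OF d1(8) M, of y y']) (use d1 d2 d ne in auto)
      then have "affine hull (insert x M) = f (q, x, y)"
        using d1 xM by (intro plane_insert_eq[OF M]) auto
      then show False using d1(9) d(1) unfolding D_def Al_def by auto
    }
  qed
  have in_sp: "f d \<in> spanned_planes T" if "d \<in> D" for d
  proof -
    obtain q x y where d: "d = (q, x, y)" by (metis surj_pair)
    note d1 = D[OF that[unfolded d]]
    show ?thesis unfolding d
      by (rule spanned_planesI[of _ x T y q]) (use d1 A B W in auto)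
  qed
  define C where "C = {(z, z') \<in> D \<times> D. f z = f z'}"
  define C2 where "C2 = {z \<in> C. fst (fst z) \<noteq> fst (snd z)}"
  have "C \<subseteq> (\<lambda>z. (z, z)) ` D \<union> C2"
  proof
    fix c assume c: "c \<in> C"
    obtain q x y q' x' y' where cc: "c = ((q, x, y), (q', x', y'))" by (metis surj_pair)
    have *: "(q, x, y) \<in> D" "(q', x', y') \<in> D" "f (q, x, y) = f (q', x', y')"
      using c unfolding C_def cc by auto
    show "c \<in> (\<lambda>z. (z, z)) ` D \<union> C2" using uniq[OF *] * c unfolding C2_def cc by auto
  qed
  moreover have fC2: "finite C2" unfolding C2_def C_def
    by (rule finite_subset[of _ "D \<times> D"]) (use fD in auto)
  ultimately have "card C \<le> card ((\<lambda>z. (z, z)) ` D \<union> C2)"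
    using fD by (intro card_mono) auto
  also have "\<dots> \<le> card ((\<lambda>z. (z, z)) ` D) + card C2" by (rule card_Un_le)
  also have "\<dots> \<le> card D + card C2" using card_image_le[OF fD] by simp
  \<comment> \<open>A coincidence with q \<noteq> q' is determined by q, q' and one of x, y off
    their join. Such a point exists because q is not on the line through x and y.\<close>
  also have "card C2 \<le> card ((W \<times> W) \<times> (A \<union> B))"
  proof -
    have "\<exists>t. t \<in> A \<union> B \<and> t \<in> f (fst c) \<and> t \<notin> affine hull {fst (fst c), fst (snd c)}" if "c \<in> C2" for c
    proof -
      obtain q x y q' d' where cc: "c = ((q, x, y), (q', d'))" by (metis surj_pair)
      have d: "(q, x, y) \<in> D" "q \<noteq> q'" using that unfolding C2_def C_def cc by auto
      note d1 = D[OF d(1)]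
      have "\<not> (x \<in> affine hull {q, q'} \<and> y \<in> affine hull {q, q'})"
      proof
        assume "x \<in> affine hull {q, q'} \<and> y \<in> affine hull {q, q'}"
        then have "affine hull {x, y} = affine hull {q, q'}" using d1(6) by (intro affine_hull_2_eq) auto
        then show False using d1(7) in_line_left by metis
      qed
      then show ?thesis using d1 unfolding cc by auto
    qed
    then obtain t where t: "\<And>c. c \<in> C2 \<Longrightarrow> t c \<in> A \<union> B \<and> t c \<in> f (fst c) \<and> t c \<notin> affine hull {fst (fst c), fst (snd c)}"
      by metis
    show ?thesis
    proof (rule card_inj_on_le)
      show "inj_on (\<lambda>c. ((fst (fst c), fst (snd c)), t c)) C2"
      proof (rule inj_onI)
        fix c c' assume c: "c \<in> C2" "c' \<in> C2"
          "((fst (fst c), fst (snd c)), t c) = ((fst (fst c'), fst (snd c')), t c')"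
        obtain q x y q2 x2 y2 where c1: "c = ((q, x, y), (q2, x2, y2))" by (metis surj_pair)
        obtain r u v r2 u2 v2 where c2: "c' = ((r, u, v), (r2, u2, v2))" by (metis surj_pair)
        have *: "(q, x, y) \<in> D" "(q2, x2, y2) \<in> D" "f (q, x, y) = f (q2, x2, y2)" "q \<noteq> q2"
          using c unfolding C2_def C_def c1 by auto
        have **: "(q, u, v) \<in> D" "(q2, u2, v2) \<in> D" "f (q, u, v) = f (q2, u2, v2)" "r = q" "r2 = q2"
          using c unfolding C2_def C_def c1 c2 by auto
        have tt: "t c \<in> f (q, x, y)" "t c \<notin> affine hull {q, q2}" "t c' \<in> f (q, u, v)" "t c' = t c"
          using t[OF c(1)] t[OF c(2)] c(3) unfolding c1 c2 by auto
        have eq: "f (q, x, y) = f (q, u, v)"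
          by (rule plane_unique[OF D(8)[OF *(1)] D(8)[OF **(1)], of q q2 "t c"])
            (use D(9)[OF *(1)] D(9)[OF *(2)] D(9)[OF **(1)] D(9)[OF **(2)] tt * ** in auto)
        have "x = x2 \<and> y = y2" using uniq[OF *(1,2,3)] .
        moreover have "x = u \<and> y = v" using uniq[OF *(1) **(1) eq] .
        moreover have "x = u2 \<and> y = v2" using uniq[OF *(1) **(2)] eq ** by simp
        ultimately show "c = c'" unfolding c1 c2 using ** by simp
      qed
      show "(\<lambda>c. ((fst (fst c), fst (snd c)), t c)) ` C2 \<subseteq> (W \<times> W) \<times> (A \<union> B)"
      proof (rule image_subsetI)
        fix c assume c: "c \<in> C2"
        have "fst c \<in> D" "snd c \<in> D" using c unfolding C2_def C_def by auto
        then have "fst (fst c) \<in> W" "fst (snd c) \<in> W" unfolding D_def by auto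
        then show "((fst (fst c), fst (snd c)), t c) \<in> (W \<times> W) \<times> (A \<union> B)" using t[OF c] by auto
      qed
    qed (use fin in simp)
  qed
  also have "\<dots> \<le> card W * card W * (card A + card B)"
    by (simp add: card_cartesian_product card_Un_le)
  finally have "real (card C) \<le> real (card D + card W * card W * (card A + card B))"
    using of_nat_le_iff by (simp del: of_nat_add of_nat_mult)
  define a b w where "a = real (card A)" and "b = real (card B)" and "w = real (card W)"
  have abw: "a \<ge> 2" "b \<ge> 2" "w \<ge> 0" "w \<le> K1 * b" "w \<le> K2 * a"
    using a2 b2 K unfolding a_def b_def w_def by auto
  have "real (card C) \<le> real (card D) + w * w * (a + b)"
    using \<open>real (card C) \<le> _\<close> unfolding a_def b_def w_def by simp
  also have "w * w * (a + b) = w * (w * a) + w * (w * b)" by (simp add: algebra_simps)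
  also have "\<dots> \<le> w * ((K1 * b) * a) + w * ((K2 * a) * b)"
    using abw by (intro add_mono mult_left_mono mult_right_mono) auto
  also have "\<dots> = (K1 + K2) * (a * b * w)" by (simp add: algebra_simps)
  finally have C: "real (card C) \<le> real (card D) + (K1 + K2) * (a * b * w)" by simp
  have "(card A - 1) * (card B - 1) * card W \<le> card D"
  proof -
    have "(\<Sum>q\<in>W. (card A - 1) * (card B - 1)) \<le> (\<Sum>q\<in>W. card (Al q) * card (Bl q))"
      using Al Bl by (intro sum_mono mult_le_mono) auto
    also have "\<dots> = card D" unfolding D_def using fin
      by (subst card_SigmaI) (auto simp: Al_def Bl_def card_cartesian_product)
    finally show ?thesis by (simp add: mult.commute)
  qed
  then have "real ((card A - 1) * (card B - 1) * card W) \<le> real (card D)" using of_nat_le_iff by blast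
  then have "(a - 1) * (b - 1) * w \<le> real (card D)"
    using a2 b2 unfolding a_def b_def w_def by (simp add: of_nat_diff)
  \<comment> \<open>Losing one point on each line costs at most a factor 4, since both lines carry
    at least two points.\<close>
  moreover have "(a / 2) * (b / 2) * w \<le> (a - 1) * (b - 1) * w"
    using abw by (intro mult_right_mono mult_mono) auto
  ultimately have Dge: "a * b * w \<le> 4 * real (card D)" by simp
  then have "(K1 + K2) * (a * b * w) \<le> (K1 + K2) * (4 * real (card D))" using K by (intro mult_left_mono) auto
  then have "real (card C) \<le> (1 + 4 * (K1 + K2)) * real (card D)" using C by (simp add: algebra_simps)
  from card_image_ge[OF fD _ this[unfolded C_def]]
  have "real (card D) / (1 + 4 * (K1 + K2)) \<le> real (card (f ` D))" using K by simp
  also have "\<dots> \<le> real (card (spanned_planes T))"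
    using finite_spanned_planes[OF fT] in_sp by (intro of_nat_mono card_mono) auto
  finally have "real (card D) / (1 + 4 * (K1 + K2)) \<le> real (card (spanned_planes T))" .
  moreover have "a * b * w / (4 * (1 + 4 * (K1 + K2))) \<le> real (card D) / (1 + 4 * (K1 + K2))"
  proof -
    define k where "k = 1 + 4 * (K1 + K2)"
    have "k > 0" using K unfolding k_def by simp
    then show ?thesis using Dge unfolding k_def[symmetric] by (simp add: field_simps)
  qed
  ultimately show ?thesis unfolding a_def b_def w_def by linarith
qed

section \<open>Poor configurations\<close>

lemma planes_throughE:
  assumes "P \<in> planes_through x R"
  obtains q q' where "plane P" "x \<in> P" "q \<in> R" "q \<in> P" "q' \<in> R" "q' \<in> P" "q \<noteq> x" "q' \<notin> affine hull {x, q}"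
  using assms unfolding planes_through_def by blast

lemma lines_ofI: "p \<in> Y \<Longrightarrow> q \<in> Y \<Longrightarrow> p \<noteq> q \<Longrightarrow> affine hull {p, q} \<in> lines_of Y"
  unfolding lines_of_def by blast

lemma ex_lines_of:
  assumes "card Y \<ge> 2"
  obtains M where "M \<in> lines_of Y"
proof -
  have "finite Y" using assms by (rule_tac ccontr) simp
  then obtain p q where "p \<in> Y" "q \<in> Y" "p \<noteq> q"
    using assms by (metis card_le_Suc0_iff_eq not_less_eq_eq numeral_2_eq_2)
  then show ?thesis using that lines_ofI by blast
qed

lemma card_lines_of_Int_ge:
  assumes "finite Y" "M \<in> lines_of Y"
  shows "card (Y \<inter> M) \<ge> 2"
proof -
  obtain p q where pq: "p \<in> Y" "q \<in> Y" "p \<noteq> q" "M = affine hull {p, q}" "p \<in> M" "q \<in> M"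
    using assms(2) by (rule lines_of_obtain)
  then have "card {p, q} \<le> card (Y \<inter> M)" using assms(1) by (intro card_mono) auto
  then show ?thesis using pq by simp
qed

lemma card_le_sum_card:
  assumes "finite I" "\<And>i. i \<in> I \<Longrightarrow> finite (Y i)" "X \<subseteq> (\<Union>i\<in>I. Y i)"
  shows "real (card X) \<le> (\<Sum>i\<in>I. real (card (Y i)))"
proof -
  have "card X \<le> card (\<Union>i\<in>I. Y i)" using assms by (intro card_mono) auto
  also have "\<dots> \<le> (\<Sum>i\<in>I. card (Y i))" by (rule card_UN_le[OF assms(1)])
  finally show ?thesis unfolding of_nat_sum[symmetric] of_nat_le_iff .
qed

text \<open>A popular point sees at least \<open>beck_con\<close> n / 2 directions, and the bound on
  planes is \<open>beck_eps\<close> times this number, as Beck's theorem demands of its projection.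
  The constant \<alpha> multiplies \<open>beck_con\<close> n / 2 popular points by
  \<open>beck_con\<close>^3 n^2 / 4 planes through each.\<close>

lemma no_rich_plane:
  assumes fT: "finite T" and n2: "card T \<ge> 2"
    and poor: "\<And>P. plane P \<Longrightarrow> real (card (T \<inter> P)) \<le> beck_eps * beck_con / 2 * real (card T)"
  defines "\<alpha> \<equiv> beck_con^4 / 8"
  shows "\<alpha> / (1 + 1 / \<alpha>) * real (card T)^3 \<le> real (card (spanned_planes T))"
proof -
  define n where "n = real (card T)"
  have \<alpha>: "\<alpha> > 0" unfolding \<alpha>_def using beck_const_bounds by simp
  have n: "n \<ge> 2" using n2 unfolding n_def by simp
  have line_poor: "real (card (T \<inter> M)) \<le> beck_eps * beck_con / 2 * n" if M: "M \<in> lines_of T" for M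
  proof -
    obtain P where P: "plane P" "M \<subseteq> P" using line_in_some_plane[OF M] by blast
    then have "card (T \<inter> M) \<le> card (T \<inter> P)" using fT by (intro card_mono) auto
    then show ?thesis using poor[OF P(1)] unfolding n_def by linarith
  qed
  obtain M where M: "M \<in> lines_of T" using n2 by (rule ex_lines_of)
  have "2 \<le> real (card (T \<inter> M))" using card_lines_of_Int_ge[OF fT M] by simp
  then have big: "2 \<le> beck_eps * (beck_con * n / 2)" using line_poor[OF M] by simp
  also have "\<dots> \<le> 1 * (beck_con * n / 2)" using beck_const_bounds n by (intro mult_right_mono) auto
  finally have cbn: "2 \<le> beck_con * n / 2" by simp
  define \<rho> where "\<rho> p = card ((\<lambda>q. affine hull {p, q}) ` (T - {p}))" for p
  define I where "I = {p\<in>T. beck_con * n / 2 \<le> real (\<rho> p)}"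
  have "beck_con * n^2 \<le> real (card (lines_of T))"
    unfolding n_def
  proof (rule beck[OF fT n2])
    fix M assume "M \<in> lines_of T"
    from line_poor[OF this] have "real (card (T \<inter> M)) \<le> beck_eps * (beck_con / 2) * n" by simp
    also have "\<dots> \<le> beck_eps * 1 * n" using beck_const_bounds n by (intro mult_right_mono mult_left_mono) auto
    finally show "real (card (T \<inter> M)) \<le> beck_eps * real (card T)" unfolding n_def by simp
  qed
  also have "real (card (lines_of T)) \<le> (\<Sum>p\<in>T. real (\<rho> p))"
    unfolding \<rho>_def
  proof (rule card_le_sum_card[OF fT])
    show "lines_of T \<subseteq> (\<Union>p\<in>T. (\<lambda>q. affine hull {p, q}) ` (T - {p}))"
    proof
      fix M assume "M \<in> lines_of T"
      then obtain p q where "p \<in> T" "q \<in> T" "p \<noteq> q" "M = affine hull {p, q}" by (rule lines_of_obtain)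
      then show "M \<in> (\<Union>p\<in>T. (\<lambda>q. affine hull {p, q}) ` (T - {p}))"
        by (intro UN_I[of p] image_eqI[of _ _ q]) auto
    qed
  qed (use fT in simp)
  finally have "beck_con * real (card T) / 2 \<le> real (card {p\<in>T. beck_con * n / 2 \<le> real (\<rho> p)})"
  proof (intro popular[OF fT])
    fix p assume "p \<in> T"
    have "\<rho> p \<le> card (T - {p})" unfolding \<rho>_def using fT by (intro card_image_le) simp
    also have "\<dots> \<le> card T" using fT by (intro card_mono) auto
    finally show "real (\<rho> p) \<le> n" unfolding n_def by simp
  qed (use n beck_const_bounds in \<open>auto simp: n_def power2_eq_square algebra_simps\<close>)
  then have I: "beck_con * n / 2 \<le> real (card I)" unfolding I_def n_def .
  define U where "U p = planes_through p (T - {p})" for p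
  have U_sub: "U p \<subseteq> spanned_planes T" if "p \<in> T" for p
    unfolding U_def using that by (intro planes_through_subset) auto
  have fU: "finite (U p)" if "p \<in> T" for p
    using U_sub[OF that] finite_spanned_planes[OF fT] finite_subset by blast
  have U: "beck_con^3 * n^2 / 4 \<le> real (card (U p))" if p: "p \<in> I" for p
  proof -
    have r: "beck_con * n / 2 \<le> real (\<rho> p)" using p unfolding I_def by simp
    have "beck_con * (real (\<rho> p))^2 \<le> real (card (U p))"
      unfolding U_def \<rho>_def
    proof (rule planes_through_ge, goal_cases)
      case 3 then show ?case using r cbn unfolding \<rho>_def by linarith
    next
      case (4 P)
      have "card ((T - {p}) \<inter> P) \<le> card (T \<inter> P)" using fT by (intro card_mono) auto
      also have "real (card (T \<inter> P)) \<le> beck_eps * (beck_con * n / 2)" using poor[OF 4(1)] unfolding n_def by simp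
      also have "\<dots> \<le> beck_eps * real (\<rho> p)" using r beck_const_bounds by (intro mult_left_mono) auto
      finally show ?case unfolding \<rho>_def by simp
    qed (use fT in auto)
    moreover have "beck_con * (beck_con * n / 2)^2 \<le> beck_con * (real (\<rho> p))^2"
      using r beck_const_bounds n by (intro mult_left_mono power_mono) auto
    moreover have "beck_con * (beck_con * n / 2)^2 = beck_con^3 * n^2 / 4" by (simp add: power2_eq_square power3_eq_cube)
    ultimately show ?thesis by linarith
  qed
  have IT: "I \<subseteq> T" "finite I" unfolding I_def using fT by auto
  define D where "D = Sigma I U"
  have fD: "finite D" unfolding D_def using IT fU by auto
  have Dge: "\<alpha> * n^3 \<le> real (card D)"
  proof -
    have "\<alpha> * n^3 = (beck_con * n / 2) * (beck_con^3 * n^2 / 4)"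
      unfolding \<alpha>_def by (simp add: power2_eq_square power3_eq_cube power4_eq_xxxx)
    also have "\<dots> \<le> real (card I) * (beck_con^3 * n^2 / 4)" using I beck_const_bounds by (intro mult_right_mono) auto
    also have "\<dots> = (\<Sum>p\<in>I. beck_con^3 * n^2 / 4)" by simp
    also have "\<dots> \<le> (\<Sum>p\<in>I. real (card (U p)))" using U by (intro sum_mono)
    also have "\<dots> = real (card D)" unfolding D_def using IT fU by (subst card_SigmaI) auto
    finally show ?thesis .
  qed
  define C where "C = {(z, z') \<in> D \<times> D. snd z = snd z'}"
  define C2 where "C2 = {z \<in> C. fst (fst z) \<noteq> fst (snd z)}"
  have "C \<subseteq> (\<lambda>z. (z, z)) ` D \<union> C2" unfolding C2_def C_def by force
  moreover have fC2: "finite C2" unfolding C2_def C_def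
    by (rule finite_subset[of _ "D \<times> D"]) (use fD in auto)
  ultimately have "card C \<le> card ((\<lambda>z. (z, z)) ` D \<union> C2)"
    using fD by (intro card_mono) auto
  also have "\<dots> \<le> card ((\<lambda>z. (z, z)) ` D) + card C2" by (rule card_Un_le)
  also have "\<dots> \<le> card D + card C2" using card_image_le[OF fD] by simp
  \<comment> \<open>A plane counted at two points is determined by them and a third point of
    \<open>T\<close> off their join. This allows n^3 coincidences, which is affordable because
    \<open>D\<close> itself has order n^3.\<close>
  also have "card C2 \<le> card ((T \<times> T) \<times> T)"
  proof -
    have "\<exists>t. t \<in> T \<and> t \<in> snd (fst c) \<and> t \<notin> affine hull {fst (fst c), fst (snd c)}" if "c \<in> C2" for c
    proof -
      obtain p Q p' Q' where c0: "c = ((p, Q), (p', Q'))" by (metis surj_pair)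
      have "Q' = Q" "p \<noteq> p'" "Q \<in> U p" using that unfolding C2_def C_def D_def c0 by auto
      then have cc: "c = ((p, Q), (p', Q))" "p \<noteq> p'" "Q \<in> U p" using c0 by auto
      obtain q q' where q: "p \<in> Q" "q \<in> T" "q \<in> Q" "q' \<in> T" "q' \<in> Q" "q \<noteq> p" "q' \<notin> affine hull {p, q}"
        using cc(3) unfolding U_def by (rule planes_throughE) auto
      have "\<not> (q \<in> affine hull {p, p'} \<and> q' \<in> affine hull {p, p'})"
      proof
        assume *: "q \<in> affine hull {p, p'} \<and> q' \<in> affine hull {p, p'}"
        then have "affine hull {p, q} = affine hull {p, p'}"
          using q(6) by (intro affine_hull_2_eq in_line_left) auto
        then show False using * q(7) by simp
      qed
      then show ?thesis using q unfolding cc(1) by auto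
    qed
    then obtain t where t: "\<And>c. c \<in> C2 \<Longrightarrow> t c \<in> T \<and> t c \<in> snd (fst c) \<and> t c \<notin> affine hull {fst (fst c), fst (snd c)}"
      by metis
    show ?thesis
    proof (rule card_inj_on_le)
      show "inj_on (\<lambda>c. ((fst (fst c), fst (snd c)), t c)) C2"
      proof (rule inj_onI)
        fix c c' assume c: "c \<in> C2" "c' \<in> C2"
          "((fst (fst c), fst (snd c)), t c) = ((fst (fst c'), fst (snd c')), t c')"
        obtain p Q p' Q' where c10: "c = ((p, Q), (p', Q'))" by (metis surj_pair)
        obtain u S u' S' where c20: "c' = ((u, S), (u', S'))" by (metis surj_pair)
        have "Q' = Q" "p \<noteq> p'" "Q \<in> U p" "Q' \<in> U p'"
          using c(1) unfolding C2_def C_def D_def c10 by auto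
        then have c1: "c = ((p, Q), (p', Q))" "p \<noteq> p'" "Q \<in> U p" "Q \<in> U p'" using c10 by auto
        have "S' = S" "S \<in> U u" "S' \<in> U u'"
          using c(2) unfolding C2_def C_def D_def c20 by auto
        then have c2: "c' = ((u, S), (u', S))" "S \<in> U u" "S \<in> U u'" using c20 by auto
        have e: "u = p" "u' = p'" "t c' = t c" using c(3) unfolding c1 c2 by auto
        have Q: "plane Q" "p \<in> Q" "p' \<in> Q" "plane S" "p \<in> S" "p' \<in> S"
          using c1 c2 e unfolding U_def planes_through_def by auto
        have "Q = S"
          by (rule plane_unique[OF Q(1,4), of p p' "t c"])
            (use Q t[OF c(1)] t[OF c(2)] c1 c2 e in auto)
        then show "c = c'" using c1 c2 e by simp
      qed
      show "(\<lambda>c. ((fst (fst c), fst (snd c)), t c)) ` C2 \<subseteq> (T \<times> T) \<times> T"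
      proof (rule image_subsetI)
        fix c assume c: "c \<in> C2"
        have "fst c \<in> D" "snd c \<in> D" using c unfolding C2_def C_def by auto
        then have "fst (fst c) \<in> T" "fst (snd c) \<in> T" using IT unfolding D_def by auto
        then show "((fst (fst c), fst (snd c)), t c) \<in> (T \<times> T) \<times> T" using t[OF c] by auto
      qed
    qed (use fT in simp)
  qed
  finally have "card C \<le> card D + card T * card T * card T"
    by (simp add: card_cartesian_product)
  then have "real (card C) \<le> real (card D + card T * card T * card T)" unfolding of_nat_le_iff .
  then have "real (card C) \<le> real (card D) + n^3" unfolding n_def by (simp add: power3_eq_cube)
  also have "n^3 \<le> (1 / \<alpha>) * real (card D)" using Dge \<alpha> by (simp add: field_simps)
  finally have "real (card C) \<le> (1 + 1 / \<alpha>) * real (card D)" by (simp add: algebra_simps)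
  from card_image_ge[OF fD _ this[unfolded C_def]]
  have "real (card D) / (1 + 1 / \<alpha>) \<le> real (card (snd ` D))" using \<alpha> by (simp add: add_pos_pos)
  also have "\<dots> \<le> real (card (spanned_planes T))"
  proof (intro of_nat_mono card_mono image_subsetI finite_spanned_planes[OF fT])
    fix z assume "z \<in> D"
    then have "fst z \<in> T" "snd z \<in> U (fst z)" using IT unfolding D_def by auto
    then show "snd z \<in> spanned_planes T" using U_sub by blast
  qed
  finally have "real (card D) / (1 + 1 / \<alpha>) \<le> real (card (spanned_planes T))" .
  moreover have "(\<alpha> * n^3) / (1 + 1 / \<alpha>) \<le> real (card D) / (1 + 1 / \<alpha>)"
    using Dge \<alpha> by (intro divide_right_mono) auto
  ultimately show ?thesis unfolding n_def by simp
qed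

text \<open>Points of \<open>l\<close> are discarded if they see few directions or lie on a rich
  plane not containing \<open>l\<close>. The value of \<delta> makes \<delta> r equal to
  \<open>beck_eps\<close> times the \<kappa> r / 2 directions of a popular point. Planes not
  containing \<open>l\<close> meet it only once, so those found at different points are distinct and
  the counts add up; 32 is 4 from the points times 8 from the planes at each.\<close>

lemma poor_line_planes:
  fixes T :: "(real ^ 3) set" and K \<eta> :: real
  assumes fT: "finite T" and l: "l \<in> lines_of T"
  defines "a \<equiv> real (card (T \<inter> l))" and "r \<equiv> real (card (T - l))"
  assumes K: "K \<ge> 0" "r \<le> K * a" and r0: "T - l \<noteq> {}"
  defines "\<kappa> \<equiv> 1 / (1 + K)"
  defines "\<delta> \<equiv> beck_eps * \<kappa> / 2"
  assumes \<eta>: "\<eta> > 0" "\<eta> \<le> \<delta>^2 / 2" "\<eta> \<le> beck_con * \<kappa> / 4" and a: "a \<ge> 8 / (\<kappa> * \<delta>)"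
    and H1: "\<And>P. plane P \<Longrightarrow> l \<subseteq> P \<Longrightarrow> real (card ((T - l) \<inter> P)) \<le> \<delta> * r"
    and H2: "\<And>M. M \<in> lines_of (T - l) \<Longrightarrow> (\<And>P. plane P \<Longrightarrow> l \<subseteq> P \<Longrightarrow> M \<subseteq> P \<Longrightarrow> False) \<Longrightarrow>
      real (card ((T - l) \<inter> M)) \<le> \<eta> * r"
  shows "\<kappa>^3 * beck_con * a * r^2 / 32 \<le> real (card (spanned_planes T))"
proof -
  define A where "A = T \<inter> l"
  define R where "R = T - l"
  have fin: "finite A" "finite R" unfolding A_def R_def using fT by auto
  have \<kappa>: "0 < \<kappa>" "\<kappa> \<le> 1" unfolding \<kappa>_def using K by auto
  have \<delta>: "0 < \<delta>" unfolding \<delta>_def using \<kappa> beck_const_bounds by simp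
  have "beck_eps * \<kappa> \<le> 1 * 1" using \<kappa> beck_const_bounds by (intro mult_mono) auto
  then have \<delta>1: "\<delta> < 1" unfolding \<delta>_def by simp
  have ra: "r = real (card R)" "a = real (card A)" unfolding r_def a_def R_def A_def by auto
  have rpos: "r > 0" unfolding ra using r0 fin R_def by (simp add: card_gt_0_iff)
  note H1' = H1[folded R_def] and H2' = H2[folded R_def]
  \<comment> \<open>By \<open>H1\<close> no plane through \<open>l\<close> contains all points off
    \<open>l\<close>, so two of them span a line skew to \<open>l\<close>. Applying
    \<open>H2\<close> to this line rules out small \<open>r\<close>.\<close>
  have \<eta>r: "2 \<le> \<eta> * r"
  proof -
    obtain q where q: "q \<in> R" using r0 R_def by auto
    then have ql: "q \<notin> l" unfolding R_def by auto
    let ?P = "affine hull (insert q l)"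
    have P: "plane ?P" "l \<subseteq> ?P" "q \<in> ?P" using plane_insert[OF l ql] hull_subset[of "insert q l" affine] by auto
    have "\<delta> * r < 1 * r" using \<delta>1 rpos by (intro mult_strict_right_mono)
    then have "card (R \<inter> ?P) < card R" using H1'[OF P(1,2)] unfolding ra by linarith
    then have "R \<inter> ?P \<noteq> R" by auto
    then obtain q' where q': "q' \<in> R" "q' \<notin> ?P" by auto
    then have M: "affine hull {q, q'} \<in> lines_of R" using q P by (intro lines_ofI) auto
    have "2 \<le> real (card (R \<inter> affine hull {q, q'}))" using card_lines_of_Int_ge[OF fin(2) M] by simp
    also have "\<dots> \<le> \<eta> * r"
    proof (rule H2'[OF M])
      fix Q assume Q: "plane Q" "l \<subseteq> Q" "affine hull {q, q'} \<subseteq> Q"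
      then have "q \<in> Q" "q' \<in> Q" using in_line_left in_line_right by blast+
      then have "?P = Q" using Q by (intro plane_insert_eq[OF l ql])
      then show False using q' \<open>q' \<in> Q\<close> by simp
    qed
    finally show ?thesis .
  qed
  define \<rho> where "\<rho> x = card ((\<lambda>q. affine hull {x, q}) ` R)" for x
  define I where "I = {x\<in>A. \<kappa> * r / 2 \<le> real (\<rho> x)}"
  have I: "\<kappa> * real (card A) / 2 \<le> real (card I)"
    unfolding I_def
  proof (rule popular[OF fin(1) rpos])
    show "real (\<rho> x) \<le> r" for x unfolding \<rho>_def ra using fin by (simp add: card_image_le)
    have "\<kappa> * real (card A) * r = real (card A) * real (card R) / (1 + K)" unfolding \<kappa>_def ra by simp
    also have "\<dots> \<le> real (card ((\<lambda>z. affine hull {fst z, snd z}) ` (A \<times> R)))"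
      using K ra by (intro card_join_lines_ge[OF fin l]) (auto simp: A_def R_def)
    also have "\<dots> \<le> (\<Sum>x\<in>A. real (\<rho> x))"
      unfolding \<rho>_def
    proof (rule card_le_sum_card[OF fin(1)])
      show "(\<lambda>z. affine hull {fst z, snd z}) ` (A \<times> R) \<subseteq> (\<Union>x\<in>A. (\<lambda>q. affine hull {x, q}) ` R)"
      proof (rule image_subsetI)
        fix z assume "z \<in> A \<times> R"
        then show "affine hull {fst z, snd z} \<in> (\<Union>x\<in>A. (\<lambda>q. affine hull {x, q}) ` R)"
          by (intro UN_I[of "fst z"] image_eqI[of _ _ "snd z"]) auto
      qed
    qed (use fin in simp)
    finally show "\<kappa> * real (card A) * r \<le> (\<Sum>x\<in>A. real (\<rho> x))" .
  qed (use \<kappa> in simp)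
  \<comment> \<open>The points where Beck's hypothesis may fail because of a plane not containing
    \<open>l\<close>; planes containing \<open>l\<close> are harmless by \<open>H1\<close>.\<close>
  define J where "J = {x\<in>A. \<exists>Q. plane Q \<and> x \<in> Q \<and> \<not> l \<subseteq> Q \<and> \<delta> * r < real (card (R \<inter> Q))}"
  have fJ: "finite J" unfolding J_def using fin by simp
  have J: "real (card J) \<le> 2 / \<delta>"
  proof -
    have "\<forall>x\<in>J. \<exists>Q. plane Q \<and> x \<in> Q \<and> \<not> l \<subseteq> Q \<and> \<delta> * r < real (card (R \<inter> Q))"
      unfolding J_def by blast
    then obtain Q where Q: "\<And>x. x \<in> J \<Longrightarrow> plane (Q x) \<and> x \<in> Q x \<and> \<not> l \<subseteq> Q x \<and> \<delta> * r < real (card (R \<inter> Q x))"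
      by metis
    \<comment> \<open>A plane containing \<open>l\<close> and the common line of \<open>Q x\<close>
      and \<open>Q x'\<close> would coincide with \<open>Q x\<close>, which does not contain
      \<open>l\<close>. So the common line is skew to \<open>l\<close>, and \<open>H2\<close>
      applies.\<close>
    have inter: "real (card (R \<inter> Q x \<inter> Q x')) \<le> \<eta> * r" if x: "x \<in> J" "x' \<in> J" "x \<noteq> x'" for x x'
    proof (cases "card (R \<inter> Q x \<inter> Q x') \<le> 1")
      case True
      then show ?thesis using \<eta>r by linarith
    next
      case False
      then have "card (R \<inter> Q x \<inter> Q x') \<ge> 2" by simp
      then obtain M where M: "M \<in> lines_of (R \<inter> Q x \<inter> Q x')" by (rule ex_lines_of)
      obtain q q' where q: "q \<in> R \<inter> Q x \<inter> Q x'" "q' \<in> R \<inter> Q x \<inter> Q x'" "q \<noteq> q'" "M = affine hull {q, q'}"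
        using M by (rule lines_of_obtain)
      have xl: "x \<in> l" "x' \<in> l" using x unfolding J_def A_def by auto
      have noboth: "\<not> (x \<in> Q x')"
      proof
        assume "x \<in> Q x'"
        then have "l \<subseteq> Q x'" using Q[OF x(2)] by (intro lines_of_subset_plane[OF _ l xl x(3)]) auto
        then show False using Q[OF x(2)] by simp
      qed
      have QM: "M \<subseteq> Q x" "M \<subseteq> Q x'"
        using line_subset_plane[of "Q x" q q'] line_subset_plane[of "Q x'" q q'] Q x q by auto
      have "R \<inter> Q x \<inter> Q x' \<subseteq> R \<inter> M"
      proof
        fix z assume z: "z \<in> R \<inter> Q x \<inter> Q x'"
        have "z \<in> M"
        proof (rule ccontr)
          assume "z \<notin> M"
          then have "Q x = Q x'"
            using q z Q x by (intro plane_unique[of "Q x" "Q x'" q q' z]) auto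
          then show False using noboth Q[OF x(1)] by simp
        qed
        then show "z \<in> R \<inter> M" using z by simp
      qed
      then have "card (R \<inter> Q x \<inter> Q x') \<le> card (R \<inter> M)" using fin by (intro card_mono) auto
      also have "real (card (R \<inter> M)) \<le> \<eta> * r"
      proof (rule H2')
        show "M \<in> lines_of R" unfolding q(4) using q by (intro lines_ofI) auto
        fix P assume P: "plane P" "l \<subseteq> P" "M \<subseteq> P"
        have "q \<in> M" "q' \<in> M" unfolding q(4) by (rule in_line_left, rule in_line_right)
        then have "P = Q x"
          using P QM Q[OF x(1)] xl noboth q by (intro plane_unique[of P "Q x" q q' x]) auto
        then show False using P Q[OF x(1)] by simp
      qed
      finally show ?thesis by simp
    qed
    define D where "D = Sigma J (\<lambda>x. R \<inter> Q x)"
    define j where "j = real (card J)"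
    define S where "S = real (card D)"
    have fD: "finite D" unfolding D_def using fJ fin by auto
    have S: "j * \<delta> * r \<le> S"
    proof -
      have "j * \<delta> * r = (\<Sum>x\<in>J. \<delta> * r)" unfolding j_def by simp
      also have "\<dots> \<le> (\<Sum>x\<in>J. real (card (R \<inter> Q x)))" using Q by (intro sum_mono) (simp add: less_imp_le)
      also have "\<dots> = S" unfolding S_def D_def using fJ fin by (subst card_SigmaI) auto
      finally show ?thesis .
    qed
    define C where "C = {(z, z') \<in> D \<times> D. snd z = snd z'}"
    define C2 where "C2 = (SIGMA z:{z \<in> J \<times> J. fst z \<noteq> snd z}. R \<inter> Q (fst z) \<inter> Q (snd z))"
    have fC2: "finite C2" unfolding C2_def using fJ fin by (intro finite_SigmaI finite_subset[of _ "J \<times> J"]) auto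
    have "C \<subseteq> (\<lambda>z. (z, z)) ` D \<union> (\<lambda>((x, x'), q). ((x, q), (x', q))) ` C2"
    proof
      fix c assume c: "c \<in> C"
      obtain x q x' q' where cc: "c = ((x, q), (x', q'))" by (metis surj_pair)
      have *: "x \<in> J" "x' \<in> J" "q \<in> R \<inter> Q x \<inter> Q x'" "q' = q" using c unfolding C_def D_def cc by auto
      show "c \<in> (\<lambda>z. (z, z)) ` D \<union> (\<lambda>((x, x'), q). ((x, q), (x', q))) ` C2"
      proof (cases "x = x'")
        case True
        then show ?thesis using * unfolding cc D_def by auto
      next
        case False
        then have "((x, x'), q) \<in> C2" using * unfolding C2_def by auto
        then show ?thesis using * unfolding cc by (intro UnI2 image_eqI[of _ _ "((x, x'), q)"]) auto
      qed
    qed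
    then have "card C \<le> card ((\<lambda>z. (z, z)) ` D \<union> (\<lambda>((x, x'), q). ((x, q), (x', q))) ` C2)"
      using fD fC2 by (intro card_mono) auto
    also have "\<dots> \<le> card ((\<lambda>z. (z, z)) ` D) + card ((\<lambda>((x, x'), q). ((x, q), (x', q))) ` C2)" by (rule card_Un_le)
    also have "\<dots> \<le> card D + card C2" using card_image_le[OF fD] card_image_le[OF fC2] by (meson add_mono)
    finally have 1: "real (card C) \<le> S + real (card C2)" unfolding S_def by simp
    have "real (card C2) = (\<Sum>z\<in>{z \<in> J \<times> J. fst z \<noteq> snd z}. real (card (R \<inter> Q (fst z) \<inter> Q (snd z))))"
      unfolding C2_def using fJ fin by (subst card_SigmaI) auto
    also have "\<dots> \<le> (\<Sum>z\<in>{z \<in> J \<times> J. fst z \<noteq> snd z}. \<eta> * r)"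
      using inter by (intro sum_mono) auto
    also have "\<dots> = real (card {z \<in> J \<times> J. fst z \<noteq> snd z}) * (\<eta> * r)" by simp
    also have "\<dots> \<le> real (card (J \<times> J)) * (\<eta> * r)"
      using fJ \<eta>r by (intro mult_right_mono of_nat_mono card_mono) auto
    finally have 2: "real (card C2) \<le> j^2 * (\<eta> * r)" unfolding j_def by (simp add: card_cartesian_product power2_eq_square)
    \<comment> \<open>Second moment of the incidences of \<open>R\<close> with the planes: S^2 \<le>
      r (S + j^2 \<eta> r). As \<eta> \<le> \<delta>^2 / 2 and S \<ge> j \<delta> r, the quadratic
      term is at most S^2 / 2. Hence S \<le> 2 r and j \<delta> \<le> 2.\<close>
    have "(card D)^2 \<le> card (snd ` D) * card C" unfolding C_def by (rule card_sq_le_collisions[OF fD])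
    also have "card (snd ` D) \<le> card R" using fin unfolding D_def by (intro card_mono) auto
    finally have "real ((card D)^2) \<le> real (card R * card C)" using of_nat_le_iff by (simp del: of_nat_mult of_nat_power)
    then have "S^2 \<le> r * real (card C)" unfolding S_def ra by simp
    also have "\<dots> \<le> r * (S + j^2 * (\<eta> * r))" using 1 2 rpos by (intro mult_left_mono) auto
    also have "\<dots> = r * S + (j * r)^2 * \<eta>" by (simp add: power2_eq_square algebra_simps)
    also have "(j * r)^2 * \<eta> \<le> (j * r)^2 * (\<delta>^2 / 2)" using \<eta> by (intro mult_left_mono) auto
    also have "\<dots> = (j * \<delta> * r)^2 / 2" by (simp add: power2_eq_square)
    also have "\<dots> \<le> S^2 / 2" using S \<delta> rpos unfolding j_def by (intro divide_right_mono power_mono) auto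
    finally have "S * S \<le> r * S + S * S / 2" by (simp add: power2_eq_square)
    then have "S * S \<le> S * (2 * r)" by (simp add: algebra_simps)
    moreover have "S \<ge> 0" unfolding S_def by simp
    ultimately have "S \<le> 2 * r" using rpos by (cases "S = 0") auto
    then have "r * (j * \<delta>) \<le> r * 2" using S by (simp add: algebra_simps)
    then have "j * \<delta> \<le> 2" using rpos by simp
    then show ?thesis using \<delta> unfolding j_def by (simp add: field_simps)
  qed
  define G where "G = I - J"
  have fG: "finite G" unfolding G_def I_def using fin by simp
  have G: "\<kappa> * a / 4 \<le> real (card G)"
  proof -
    have "card I \<le> card (G \<union> J)" unfolding G_def using fJ fin by (intro card_mono) (auto simp: I_def)
    also have "\<dots> \<le> card G + card J" by (rule card_Un_le)
    finally have "real (card I) \<le> real (card G) + real (card J)" by simp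
    \<comment> \<open>The lower bound on \<open>a\<close> serves this step: the bad points use up at
      most half of the \<kappa> a / 2 popular ones that are guaranteed.\<close>
    moreover have "2 / \<delta> \<le> \<kappa> * a / 4"
    proof -
      have "\<kappa> * (8 / (\<kappa> * \<delta>)) \<le> \<kappa> * a" using a \<kappa> by (intro mult_left_mono) auto
      then show ?thesis using \<kappa> by simp
    qed
    ultimately show ?thesis using I J unfolding ra by simp
  qed
  define V where "V x = {P \<in> planes_through x R. \<not> l \<subseteq> P}" for x
  have V_sub: "V x \<subseteq> spanned_planes T" if "x \<in> G" for x
    using planes_through_subset[of x T R] that unfolding V_def G_def I_def A_def R_def by auto
  have fV: "finite (V x)" if "x \<in> G" for x
    using V_sub[OF that] finite_spanned_planes[OF fT] finite_subset by blast
  have V: "beck_con * \<kappa>^2 * r^2 / 8 \<le> real (card (V x))" if x: "x \<in> G" for x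
  proof -
    have xI: "x \<in> A" "x \<in> l" "x \<in> T" "\<kappa> * r / 2 \<le> real (\<rho> x)" "x \<notin> J"
      using x unfolding G_def I_def A_def by auto
    define p where "p = real (\<rho> x)"
    \<comment> \<open>With \<eta> \<le> \<open>beck_con\<close> \<kappa> / 4 the number of
      directions reaches 4 / \<open>beck_con\<close>, enough for the quadratic count of planes to
      dominate the at most \<open>p\<close> planes through \<open>l\<close>.\<close>
    have "4 / beck_con * \<eta> \<le> \<kappa>" using \<eta>(3) beck_const_bounds by (simp add: field_simps)
    then have "(4 / beck_con * \<eta>) * r \<le> \<kappa> * r" using rpos by (intro mult_right_mono) auto
    moreover have "4 / beck_con * 2 \<le> 4 / beck_con * (\<eta> * r)" using \<eta>r beck_const_bounds by (intro mult_left_mono) auto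
    ultimately have p: "4 / beck_con \<le> p" using xI(4) unfolding p_def by simp
    have "4 \<le> 4 / beck_con" using beck_const_bounds by (simp add: field_simps)
    then have p4: "4 \<le> p" using p by simp
    have 1: "beck_con * p^2 \<le> real (card (planes_through x R))"
      unfolding p_def \<rho>_def
    proof (rule planes_through_ge[OF fin(2)], goal_cases)
      case 1 show ?case using xI unfolding R_def by simp
    next
      case 2 show ?case using p4 unfolding p_def \<rho>_def by simp
    next
      case (3 P)
      have "real (card (R \<inter> P)) \<le> \<delta> * r"
      proof (cases "l \<subseteq> P")
        case True then show ?thesis using H1' 3 by blast
      next
        case False then show ?thesis using xI 3 unfolding J_def by fastforce
      qed
      also have "\<dots> = beck_eps * (\<kappa> * r / 2)" unfolding \<delta>_def by simp
      also have "\<dots> \<le> beck_eps * real (\<rho> x)" using xI beck_const_bounds by (intro mult_left_mono) auto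
      finally show ?case unfolding \<rho>_def .
    qed
    \<comment> \<open>A plane containing \<open>l\<close> is recovered from \<open>l\<close> and any
      one of its directions from \<open>x\<close> towards \<open>R\<close>.\<close>
    have "{P \<in> planes_through x R. l \<subseteq> P} \<subseteq> (\<lambda>N. affine hull (l \<union> N)) ` ((\<lambda>q. affine hull {x, q}) ` R)"
    proof
      fix P assume "P \<in> {P \<in> planes_through x R. l \<subseteq> P}"
      then have P: "P \<in> planes_through x R" "l \<subseteq> P" by auto
      obtain q where q: "plane P" "x \<in> P" "q \<in> R" "q \<in> P" using P(1) by (rule planes_throughE) 
      have ql: "q \<notin> l" using q unfolding R_def by auto
      have "affine hull (l \<union> affine hull {x, q}) \<subseteq> P"
        using P q line_subset_plane[OF q(1,2,4)] unfolding plane_def by (intro hull_minimal) auto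
      moreover have "affine hull (insert q l) \<subseteq> affine hull (l \<union> affine hull {x, q})"
        using in_line_right[of q x] by (intro hull_mono) auto
      moreover have "affine hull (insert q l) = P" by (rule plane_insert_eq[OF l ql q(1) P(2) q(4)])
      ultimately have "P = affine hull (l \<union> affine hull {x, q})" by simp
      then show "P \<in> (\<lambda>N. affine hull (l \<union> N)) ` ((\<lambda>q. affine hull {x, q}) ` R)" using q by blast
    qed
    then have "card {P \<in> planes_through x R. l \<subseteq> P} \<le> \<rho> x"
      unfolding \<rho>_def using fin by (intro surj_card_le) auto
    moreover have "card (planes_through x R) \<le> card (V x) + card {P \<in> planes_through x R. l \<subseteq> P}"
    proof -
      have "planes_through x R = V x \<union> {P \<in> planes_through x R. l \<subseteq> P}" unfolding V_def by auto
      then show ?thesis using card_Un_le[of "V x" "{P \<in> planes_through x R. l \<subseteq> P}"] by simp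
    qed
    ultimately have 2: "beck_con * p^2 \<le> real (card (V x)) + p" using 1 unfolding p_def by simp
    have "2 \<le> beck_con * p" using p beck_const_bounds by (simp add: field_simps)
    then have "2 * p \<le> beck_con * p * p" using p4 by (intro mult_right_mono) auto
    then have "beck_con * p^2 / 2 \<le> real (card (V x))" using 2 by (simp add: power2_eq_square)
    moreover have "beck_con * (\<kappa> * r / 2)^2 \<le> beck_con * p^2"
      using xI(4) beck_const_bounds \<kappa> rpos unfolding p_def by (intro mult_left_mono power_mono) auto
    ultimately show ?thesis by (simp add: power_mult_distrib power_divide)
  qed
  have disj: "V x \<inter> V x' = {}" if "x \<in> G" "x' \<in> G" "x \<noteq> x'" for x x'
  proof -
    have "l \<subseteq> P" if "P \<in> planes_through x R" "P \<in> planes_through x' R" for P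
      using that \<open>x \<in> G\<close> \<open>x' \<in> G\<close> \<open>x \<noteq> x'\<close> lines_of_subset_plane[OF _ l, of P x x']
      unfolding planes_through_def G_def I_def A_def by auto
    then show ?thesis unfolding V_def by auto
  qed
  have "(\<kappa> * a / 4) * (beck_con * \<kappa>^2 * r^2 / 8) \<le> real (card G) * (beck_con * \<kappa>^2 * r^2 / 8)"
    using G beck_const_bounds by (intro mult_right_mono) auto
  also have "\<dots> = (\<Sum>x\<in>G. beck_con * \<kappa>^2 * r^2 / 8)" by simp
  also have "\<dots> \<le> (\<Sum>x\<in>G. real (card (V x)))" using V by (intro sum_mono)
  also have "\<dots> = real (card (\<Union>x\<in>G. V x))"
    using fG fV disj by (subst card_UN_disjoint) auto
  also have "\<dots> \<le> real (card (spanned_planes T))"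
    using finite_spanned_planes[OF fT] V_sub by (intro of_nat_mono card_mono) auto
  finally show ?thesis by (simp add: power2_eq_square power3_eq_cube algebra_simps)
qed

section \<open>Rich lines and rich planes\<close>

text \<open>An affine hull of three points that contains both lines also contains the plane of
  \<open>l\<close> and a point of \<open>M\<close> off \<open>l\<close>. Its dimension is at most 2,
  so it is itself a plane, contrary to the hypothesis. The dimension count is there because
  \<open>coplanar\<close> admits degenerate hulls.\<close>

lemma skew_linesI:
  assumes l: "l \<in> lines_of S" and M: "M \<in> lines_of S'"
    and skew: "\<And>P. plane P \<Longrightarrow> l \<subseteq> P \<Longrightarrow> M \<subseteq> P \<Longrightarrow> False"
  shows "skew_lines l M"
proof -
  have line: "line N" if N: "N \<in> lines_of Y" for N Y
  proof -
    obtain p q where "p \<noteq> q" "N = affine hull {p, q}" using N by (rule lines_of_obtain)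
    then show ?thesis unfolding line_def by (simp add: aff_dim_2)
  qed
  have "\<not> coplanar (l \<union> M)"
  proof
    assume "coplanar (l \<union> M)"
    then obtain u v w where H: "l \<union> M \<subseteq> affine hull {u, v, w}" unfolding coplanar_def by blast
    let ?H = "affine hull {u, v, w}"
    have "\<not> M \<subseteq> l"
      using line_in_some_plane[OF l] skew by blast
    then obtain z where z: "z \<in> M" "z \<notin> l" by auto
    let ?P = "affine hull (insert z l)"
    have P: "plane ?P" by (rule plane_insert[OF l z(2)])
    have sub: "?P \<subseteq> ?H" using H z by (intro hull_minimal) auto
    have "aff_dim {u, v, w} \<le> int (card {u, v, w}) - 1" by (rule aff_dim_le_card) simp
    moreover have "card {u, v, w} \<le> 3"
      using card_insert_le_m1[of 3 "{v,w}" u] card_insert_le_m1[of 2 "{w}" v] by simp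
    ultimately have "aff_dim ?H \<le> 2" by simp
    moreover have "aff_dim ?P \<le> aff_dim ?H" by (rule aff_dim_subset[OF sub])
    ultimately have "plane ?H" using P unfolding plane_def by simp
    then show False using skew H by blast
  qed
  then show ?thesis using line[OF l] line[OF M] unfolding skew_lines_def by blast
qed

text \<open>The hypotheses speak of the points left out instead of those contained, because the
  cones are built over the points left out.\<close>

lemma many_points_bound:
  "\<exists>(N::nat) c. c > 0 \<and> (\<forall>(T :: (real ^ 3) set) k::real. finite T \<longrightarrow> N \<le> card T \<longrightarrow> 1 \<le> k \<longrightarrow>
     (\<forall>P. plane P \<longrightarrow> k \<le> real (card (T - P))) \<longrightarrow>
     (\<forall>L M. skew_lines L M \<longrightarrow> k \<le> real (card (T - L - M))) \<longrightarrow>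
     c * real (card T) * k^2 \<le> real (card (spanned_planes T)))"
proof -
  define \<epsilon>1 where "\<epsilon>1 = beck_eps * beck_con / 2"
  \<comment> \<open>A line with at most \<epsilon>2 n points is poor in Beck's sense within any
    plane that has more than \<epsilon>1 n points.\<close>
  define \<epsilon>2 where "\<epsilon>2 = beck_eps * \<epsilon>1"
  define K where "K = 1 / \<epsilon>2"
  define \<kappa> where "\<kappa> = 1 / (1 + K)"
  define \<delta> where "\<delta> = beck_eps * \<kappa> / 2"
  define \<eta> where "\<eta> = min (\<delta>^2 / 2) (beck_con * \<kappa> / 4)"
  define \<alpha> where "\<alpha> = beck_con^4 / 8"
  define K1 where "K1 = 1 / (\<epsilon>1 * beck_con)"
  define K2 where "K2 = (1 + K) / (\<delta> * \<epsilon>2)"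
  define K3 where "K3 = 4 * (1 + 4 * (1 / \<eta> + K))"
  define c0 where "c0 = \<alpha> / (1 + 1 / \<alpha>)"
  define c1 where "c1 = beck_con * \<epsilon>1^2 / (1 + K1)"
  define c2 where "c2 = \<epsilon>2 * \<delta> / (1 + K) / (1 + K2)"
  define c3 where "c3 = \<epsilon>2 * \<eta> / K3"
  define c4 where "c4 = \<kappa>^3 * beck_con * \<epsilon>2 / 32"
  define c where "c = min (min (min c0 c1) (min c2 c3)) c4"
  \<comment> \<open>The first summand ensures \<epsilon>1 n \<ge> 2; the second gives every rich
    line the 8 / (\<kappa> \<delta>) points that \<open>poor_line_planes\<close> requires.\<close>
  define N where "N = nat \<lceil>2 / \<epsilon>1 + 8 / (\<kappa> * \<delta>) / \<epsilon>2\<rceil> + 2"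
  have pos1: "\<epsilon>1 > 0" "\<epsilon>2 > 0" "K > 0" "\<alpha> > 0" "K1 > 0"
    using beck_const_bounds unfolding \<epsilon>1_def \<epsilon>2_def K_def \<alpha>_def K1_def by auto
  have pos2: "\<kappa> > 0" unfolding \<kappa>_def using pos1 by simp
  then have pos3: "\<delta> > 0" unfolding \<delta>_def using beck_const_bounds by simp
  then have pos4: "\<eta> > 0" "K2 > 0" unfolding \<eta>_def K2_def using beck_const_bounds pos1 pos2 by auto
  have "1 / \<eta> > 0" using pos4 by simp
  then have "K3 > 0" unfolding K3_def using pos1(3) by (intro mult_pos_pos add_pos_pos) auto
  note pos = pos1 pos2 pos3 pos4 this
  have cpos: "c0 > 0" "c1 > 0" "c2 > 0" "c3 > 0" "c4 > 0"
    using beck_const_bounds pos unfolding c0_def c1_def c2_def c3_def c4_def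
    by (auto intro!: divide_pos_pos mult_pos_pos add_pos_pos)
  then have c: "c > 0" "c \<le> c0" "c \<le> c1" "c \<le> c2" "c \<le> c3" "c \<le> c4" unfolding c_def by auto
  have "c * real (card T) * k^2 \<le> real (card (spanned_planes T))"
    if fT: "finite T" and NT: "N \<le> card T" and k1: "1 \<le> k"
      and HP: "\<And>P. plane P \<Longrightarrow> k \<le> real (card (T - P))"
      and HS: "\<And>L M. skew_lines L M \<Longrightarrow> k \<le> real (card (T - L - M))"
    for T :: "(real ^ 3) set" and k :: real
  proof -
    define n where "n = real (card T)"
    define S where "S = real (card (spanned_planes T))"
    have n2: "card T \<ge> 2" using NT unfolding N_def by simp
    have sum0: "0 \<le> 2 / \<epsilon>1" "0 \<le> 8 / (\<kappa> * \<delta>) / \<epsilon>2" using pos by auto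
    have "2 / \<epsilon>1 + 8 / (\<kappa> * \<delta>) / \<epsilon>2 \<le> real N" unfolding N_def by linarith
    then have big: "2 / \<epsilon>1 + 8 / (\<kappa> * \<delta>) / \<epsilon>2 \<le> n" using NT unfolding n_def by linarith
    have big1: "2 \<le> \<epsilon>1 * n"
    proof -
      have "2 / \<epsilon>1 \<le> n" using big sum0 by linarith
      then show ?thesis using pos by (simp add: field_simps)
    qed
    have big2: "8 / (\<kappa> * \<delta>) \<le> \<epsilon>2 * n"
    proof -
      have "8 / (\<kappa> * \<delta>) / \<epsilon>2 \<le> n" using big sum0 by linarith
      then have "8 / (\<kappa> * \<delta>) \<le> n * \<epsilon>2" by (rule pos_divide_le_eq[OF pos(2), THEN iffD1])
      then show ?thesis by (simp only: mult.commute)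
    qed
    have n0: "n > 0" using n2 unfolding n_def by simp
    have suff: ?thesis if "d * (n * k^2) \<le> S" "c \<le> d" for d
    proof -
      have "c * (n * k^2) \<le> d * (n * k^2)" using that(2) n0 by (intro mult_right_mono) auto
      then show ?thesis using that(1) unfolding n_def S_def by simp
    qed
    obtain l0 where l0: "l0 \<in> lines_of T" using n2 by (rule ex_lines_of)
    obtain P0 where P0: "plane P0" using line_in_some_plane[OF l0] by blast
    have kn: "k \<le> n"
      using HP[OF P0] card_mono[OF fT, of "T - P0"] unfolding n_def by fastforce
    show ?thesis
    proof (cases "\<exists>l\<in>lines_of T. \<epsilon>2 * n < real (card (T \<inter> l))")
      case False
      then have lines: "\<And>l. l \<in> lines_of T \<Longrightarrow> real (card (T \<inter> l)) \<le> \<epsilon>2 * n" by force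
      show ?thesis
      proof (cases "\<exists>P. plane P \<and> \<epsilon>1 * n < real (card (T \<inter> P))")
        case False
        then have "c0 * n^3 \<le> S"
          using no_rich_plane[OF fT n2] unfolding c0_def \<alpha>_def \<epsilon>1_def n_def S_def by force
        moreover have "k^2 \<le> n^2" using kn k1 by (intro power_mono) auto
        then have "c0 * (n * k^2) \<le> c0 * (n * n^2)" using cpos n0 by (intro mult_left_mono) auto
        moreover have "n * n^2 = n^3" by (simp add: power2_eq_square power3_eq_cube)
        ultimately have "c0 * (n * k^2) \<le> S" by simp
        then show ?thesis using c(2) by (rule suff)
      next
        case True
        then obtain P where P: "plane P" "\<epsilon>1 * n < real (card (T \<inter> P))" by blast
        define s where "s = real (card (T \<inter> P))"
        define m where "m = real (card (T - P))"
        define L where "L = real (card (lines_of (T \<inter> P)))"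
        have s: "\<epsilon>1 * n < s" "s \<ge> 2" "s \<le> n" using P big1 card_mono[OF fT, of "T \<inter> P"] unfolding s_def n_def by auto
        have m: "k \<le> m" "m \<le> n" using HP[OF P(1)] card_mono[OF fT, of "T - P"] unfolding m_def n_def by auto
        have L: "beck_con * s^2 \<le> L"
          unfolding s_def L_def
        proof (rule beck)
          show "card (T \<inter> P) \<ge> 2" using s unfolding s_def by simp
          fix M assume M: "M \<in> lines_of (T \<inter> P)"
          then have "M \<in> lines_of T" unfolding lines_of_def by blast
          from lines[OF this] have "real (card (T \<inter> M)) \<le> beck_eps * (\<epsilon>1 * n)"
            unfolding \<epsilon>2_def by (simp only: mult.assoc)
          moreover have "beck_eps * (\<epsilon>1 * n) \<le> beck_eps * s" using s beck_const_bounds by (intro mult_left_mono) auto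
          moreover have "card (T \<inter> P \<inter> M) \<le> card (T \<inter> M)" using fT by (intro card_mono) auto
          ultimately show "real (card (T \<inter> P \<inter> M)) \<le> beck_eps * real (card (T \<inter> P))"
            unfolding s_def by linarith
        qed (use fT in simp)
        have "m * s \<le> K1 * L"
        proof -
          have "m * s \<le> n * s" using m s by (intro mult_right_mono) auto
          also have "n * s \<le> (s / \<epsilon>1) * s" using s pos by (intro mult_right_mono) (auto simp: field_simps)
          also have "\<dots> = K1 * (beck_con * s^2)" unfolding K1_def using beck_const_bounds by (simp add: power2_eq_square)
          also have "\<dots> \<le> K1 * L" using L pos by (intro mult_left_mono) auto
          finally show ?thesis .
        qed
        then have main: "L * m / (1 + K1) \<le> S"
          unfolding L_def m_def S_def s_def using pos by (intro cone_planes[OF fT P(1)]) auto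
        \<comment> \<open>The cone yields order n^2 m planes. One factor k is bounded by n, the
          other by \<open>m\<close>.\<close>
        have "c1 * (n * k^2) = (beck_con * (\<epsilon>1^2 * n)) * (k * k) / (1 + K1)"
          unfolding c1_def by (simp add: power2_eq_square)
        also have "\<dots> \<le> (beck_con * (\<epsilon>1^2 * n)) * (n * m) / (1 + K1)"
          using kn k1 m n0 beck_const_bounds pos by (intro divide_right_mono mult_left_mono mult_mono) auto
        also have "\<dots> = (beck_con * (\<epsilon>1 * n)^2) * m / (1 + K1)" by (simp add: power2_eq_square)
        also have "\<dots> \<le> (beck_con * s^2) * m / (1 + K1)"
          using s m k1 n0 beck_const_bounds pos by (intro divide_right_mono mult_right_mono mult_left_mono power_mono) auto
        also have "\<dots> \<le> L * m / (1 + K1)"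
          using L m k1 pos by (intro divide_right_mono mult_right_mono) auto
        also note main
        finally show ?thesis using c(3) by (rule suff)
      qed
    next
      case True
      then obtain l where l: "l \<in> lines_of T" "\<epsilon>2 * n < real (card (T \<inter> l))" by blast
      define a where "a = real (card (T \<inter> l))"
      define r where "r = real (card (T - l))"
      have a: "\<epsilon>2 * n < a" "a > 0" "card (T \<inter> l) \<ge> 2"
        using l(2) pos n0 card_lines_of_Int_ge[OF fT l(1)] unfolding a_def by auto
      have naK: "n \<le> K * a" using a pos unfolding K_def by (simp add: field_simps)
      have rn: "r \<le> n" unfolding r_def n_def using card_mono[OF fT, of "T - l"] by auto
      then have raK: "r \<le> K * a" using naK by linarith
      obtain Q where Q: "plane Q" "l \<subseteq> Q" using line_in_some_plane[OF l(1)] by blast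
      have kr: "k \<le> r"
      proof -
        have "card (T - Q) \<le> card (T - l)" using fT Q by (intro card_mono) auto
        then show ?thesis using HP[OF Q(1)] unfolding r_def by linarith
      qed
      then have r0: "r > 0" using k1 by simp
      show ?thesis
      proof (cases "\<exists>P. plane P \<and> l \<subseteq> P \<and> \<delta> * r < real (card ((T - l) \<inter> P))")
        case True
        then obtain P where P: "plane P" "l \<subseteq> P" "\<delta> * r < real (card ((T - l) \<inter> P))" by blast
        define b where "b = real (card ((T - l) \<inter> P))"
        define m where "m = real (card (T - P))"
        define s where "s = real (card (T \<inter> P))"
        define L where "L = real (card (lines_of (T \<inter> P)))"
        have "0 < \<delta> * r" using pos r0 by simp
        moreover have "\<delta> * r < b" using P(3) unfolding b_def .
        moreover have "b \<le> r" unfolding b_def r_def using fT by (intro of_nat_mono card_mono) auto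
        ultimately have b: "\<delta> * r < b" "b > 0" "b \<le> r" by auto
        have m: "k \<le> m" "m \<le> r"
          using HP[OF P(1)] card_mono[of "T - l" "T - P"] fT P(2) unfolding m_def r_def by auto
        have sn: "s \<le> n" unfolding s_def n_def using card_mono[OF fT, of "T \<inter> P"] by auto
        \<comment> \<open>Beck's theorem may fail in \<open>P\<close>, where most points can lie on
          \<open>l\<close>. The lines are instead the joins of points of \<open>l\<close> with the
          other points of \<open>P\<close>.\<close>
        have L: "a * b / (1 + K) \<le> L"
        proof -
          have "a * b / (1 + K) \<le> real (card ((\<lambda>z. affine hull {fst z, snd z}) ` ((T \<inter> l) \<times> ((T - l) \<inter> P))))"
            unfolding a_def b_def using pos raK b fT
            by (intro card_join_lines_ge[OF _ _ l(1)]) (auto simp: a_def b_def r_def)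
          also have "\<dots> \<le> L"
            unfolding L_def
          proof (intro of_nat_mono card_mono image_subsetI)
            fix z assume "z \<in> (T \<inter> l) \<times> ((T - l) \<inter> P)"
            then show "affine hull {fst z, snd z} \<in> lines_of (T \<inter> P)" using P(2) by (intro lines_ofI) auto
          qed (use fT in \<open>simp add: finite_lines_of\<close>)
          finally show ?thesis .
        qed
        have "m * s \<le> K2 * L"
        proof -
          have "\<delta> * m \<le> \<delta> * r" using m pos by (intro mult_left_mono) auto
          then have "\<delta> * m \<le> b" using b by linarith
          then have "m \<le> b / \<delta>" using pos by (simp add: field_simps)
          moreover have "s \<le> a / \<epsilon>2" using sn naK unfolding K_def by simp
          ultimately have "m * s \<le> (b / \<delta>) * (a / \<epsilon>2)" using m k1 pos b unfolding s_def by (intro mult_mono) auto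
          also have "\<dots> = K2 * (a * b / (1 + K))" unfolding K2_def using pos by simp
          also have "\<dots> \<le> K2 * L" using L pos by (intro mult_left_mono) auto
          finally show ?thesis .
        qed
        then have main: "L * m / (1 + K2) \<le> S"
          unfolding L_def m_def S_def s_def using pos by (intro cone_planes[OF fT P(1)]) auto
        have "c2 * (n * k^2) = ((\<epsilon>2 * n) * (\<delta> * k) / (1 + K)) * k / (1 + K2)"
          unfolding c2_def by (simp add: power2_eq_square)
        also have "\<dots> \<le> (a * b / (1 + K)) * m / (1 + K2)"
        proof (intro divide_right_mono mult_mono)
          have "\<delta> * k \<le> \<delta> * r" using kr pos by (intro mult_left_mono) auto
          then show "\<delta> * k \<le> b" using b by linarith
        qed (use a m k1 b pos n0 in auto)
        also have "\<dots> \<le> L * m / (1 + K2)"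
          using L m k1 pos by (intro divide_right_mono mult_right_mono) auto
        also note main
        finally show ?thesis using c(4) by (rule suff)
      next
        case False
        then have H1: "\<And>P. plane P \<Longrightarrow> l \<subseteq> P \<Longrightarrow> real (card ((T - l) \<inter> P)) \<le> \<delta> * r"
          using not_less by blast
        show ?thesis
        proof (cases "\<exists>M\<in>lines_of (T - l). (\<forall>P. plane P \<longrightarrow> l \<subseteq> P \<longrightarrow> \<not> M \<subseteq> P) \<and> \<eta> * r < real (card ((T - l) \<inter> M))")
          case True
          then obtain M where M: "M \<in> lines_of (T - l)" "\<And>P. plane P \<Longrightarrow> l \<subseteq> P \<Longrightarrow> M \<subseteq> P \<Longrightarrow> False"
            "\<eta> * r < real (card ((T - l) \<inter> M))" by blast
          define b where "b = real (card ((T - l) \<inter> M))"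
          define w where "w = real (card (T - l - M))"
          have kw: "k \<le> w" unfolding w_def by (rule HS[OF skew_linesI[OF l(1) M(1,2)]])
          have wr: "w \<le> r" unfolding w_def r_def using fT by (intro of_nat_mono card_mono) auto
          have b: "\<eta> * r < b" using M(3) unfolding b_def .
          have main: "a * b * w / K3 \<le> S"
            unfolding K3_def a_def b_def w_def S_def
          proof (rule skew_planes[OF fT l(1) M(1,2)])
            show "card ((T - l) \<inter> M) \<ge> 2" using fT M(1) by (intro card_lines_of_Int_ge) auto
            have "\<eta> * w \<le> \<eta> * r" using wr pos by (intro mult_left_mono) auto
            then have "\<eta> * w \<le> b" using b by linarith
            then have "w \<le> 1 / \<eta> * b" using pos by (simp add: field_simps)
            then show "real (card (T - l - M)) \<le> 1 / \<eta> * real (card ((T - l) \<inter> M))"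
              unfolding b_def w_def .
            show "real (card (T - l - M)) \<le> K * real (card (T \<inter> l))"
              using wr raK unfolding a_def w_def by linarith
          qed (use a pos in auto)
          have "c3 * (n * k^2) = ((\<epsilon>2 * n) * (\<eta> * k)) * k / K3" unfolding c3_def by (simp add: power2_eq_square)
          also have "\<dots> \<le> (a * b) * w / K3"
          proof (intro divide_right_mono mult_mono)
            have "\<eta> * k \<le> \<eta> * r" using kr pos by (intro mult_left_mono) auto
            then show "\<eta> * k \<le> b" using b by linarith
          qed (use a kw k1 pos n0 in \<open>auto simp: b_def\<close>)
          also note main
          finally show ?thesis using c(5) by (rule suff)
        next
          case False
          have main: "\<kappa>^3 * beck_con * a * r^2 / 32 \<le> S"
            unfolding \<kappa>_def a_def r_def S_def
          proof (rule poor_line_planes[OF fT l(1), where K = K and \<eta> = \<eta>], unfold a_def[symmetric] r_def[symmetric] \<kappa>_def[symmetric] \<delta>_def[symmetric])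
            show "T - l \<noteq> {}" using r0 unfolding r_def by (metis card.empty less_irrefl of_nat_0)
            show "8 / (\<kappa> * \<delta>) \<le> a" using big2 a by linarith
            fix M
            assume M: "M \<in> lines_of (T - l)" and sk: "\<And>P. plane P \<Longrightarrow> l \<subseteq> P \<Longrightarrow> M \<subseteq> P \<Longrightarrow> False"
            show "real (card ((T - l) \<inter> M)) \<le> \<eta> * r"
            proof (rule ccontr)
              assume "\<not> real (card ((T - l) \<inter> M)) \<le> \<eta> * r"
              then have "\<eta> * r < real (card ((T - l) \<inter> M))" by simp
              moreover have "\<forall>P. plane P \<longrightarrow> l \<subseteq> P \<longrightarrow> \<not> M \<subseteq> P" using sk by blast
              ultimately show False using False M by blast
            qed
          qed (use pos raK H1 in \<open>auto simp: \<eta>_def\<close>)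
          have "c4 * (n * k^2) = \<kappa>^3 * beck_con * (\<epsilon>2 * n) * k^2 / 32" unfolding c4_def by simp
          also have "\<dots> \<le> \<kappa>^3 * beck_con * a * r^2 / 32"
            using a kr k1 pos beck_const_bounds n0 by (intro divide_right_mono mult_mono power_mono) auto
          also note main
          finally show ?thesis using c(6) by (rule suff)
        qed
      qed
    qed
  qed
  then show ?thesis using c(1) by blast
qed

section \<open>Small sets and the conclusion\<close>

lemma spanned_planes_nonempty:
  assumes fT: "finite T" and nonplanar: "\<And>P. plane P \<Longrightarrow> \<not> T \<subseteq> P"
  shows "card (spanned_planes T) \<ge> 1"
proof -
  \<comment> \<open>Some plane exists and \<open>T\<close> leaves it, so \<open>T\<close> has a
    point. Enclosing first this point and then the line found next in a plane forces
    \<open>T\<close> to contain a further point each time.\<close>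
  obtain P0 :: "(real ^ 3) set" where P0: "plane P0"
    using line_in_some_plane[OF lines_ofI[of 0 UNIV "axis 1 1"]] by (auto simp: axis_eq_0_iff)
  obtain x where x: "x \<in> T" using nonplanar[OF P0] by auto
  obtain e :: "real ^ 3" where e: "e \<noteq> x" using UNIV_not_singleton[of x] by auto
  obtain P1 where P1: "plane P1" "affine hull {x, e} \<subseteq> P1"
    using line_in_some_plane[OF lines_ofI[of x UNIV e]] e by auto
  obtain y where y: "y \<in> T" "x \<noteq> y" using nonplanar[OF P1(1)] P1(2) in_line_left[of x e] by auto
  obtain P2 where P2: "plane P2" "affine hull {x, y} \<subseteq> P2"
    using line_in_some_plane[OF lines_ofI[of x UNIV y]] y by auto
  obtain z where z: "z \<in> T" "z \<notin> affine hull {x, y}" using nonplanar[OF P2(1)] P2(2) by auto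
  have "affine hull {x, y, z} \<in> spanned_planes T"
    by (rule spanned_planesI[of _ x T y z])
      (use x y z plane_affine_hull_3[OF y(2) z(2)] in \<open>auto intro: hull_inc\<close>)
  then have "card (spanned_planes T) > 0" using finite_spanned_planes[OF fT] by (auto simp: card_gt_0_iff)
  then show ?thesis by simp
qed

theorem theorem3:
  "\<exists>c::real. c > 0 \<and>
     (\<forall>(T :: (real ^ 3) set) (n :: nat) (k :: int).
        finite T \<longrightarrow> card T = n \<longrightarrow> k \<ge> 0 \<longrightarrow>
        (\<forall>P. plane P \<longrightarrow> int (card (T \<inter> P)) \<le> int n - k) \<longrightarrow>
        (\<forall>L M. skew_lines L M \<longrightarrow> int (card (T \<inter> (L \<union> M))) \<le> int n - k) \<longrightarrow>
        real (card (spanned_planes T)) \<ge> c * real n * (of_int k)\<^sup>2)"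
proof -
  obtain N c where c: "c > 0" and large: "\<And>(T :: (real ^ 3) set) k::real. finite T \<Longrightarrow> N \<le> card T \<Longrightarrow> 1 \<le> k \<Longrightarrow>
     (\<forall>P. plane P \<longrightarrow> k \<le> real (card (T - P))) \<Longrightarrow>
     (\<forall>L M. skew_lines L M \<longrightarrow> k \<le> real (card (T - L - M))) \<Longrightarrow>
     c * real (card T) * k^2 \<le> real (card (spanned_planes T))"
    using many_points_bound by blast
  \<comment> \<open>Below N points a single spanned plane suffices: n and k are then at most N + 1,
    so d n k^2 \<le> 1.\<close>
  define d where "d = min c (1 / (real N + 1)^3)"
  have d: "d > 0" "d \<le> c" "d \<le> 1 / (real N + 1)^3" using c unfolding d_def by auto
  have "d * real n * (of_int k)\<^sup>2 \<le> real (card (spanned_planes T))"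
    if fT: "finite T" and n: "card T = n" and k: "k \<ge> 0"
      and HP: "\<And>P. plane P \<Longrightarrow> int (card (T \<inter> P)) \<le> int n - k"
      and HS: "\<And>L M. skew_lines L M \<Longrightarrow> int (card (T \<inter> (L \<union> M))) \<le> int n - k"
    for T :: "(real ^ 3) set" and n :: nat and k :: int
  proof (cases "k = 0")
    case False
    then have k1: "1 \<le> k" using k by simp
    have diff: "real_of_int k \<le> real (card (T - X))" if "int (card (T \<inter> X)) \<le> int n - k" for X
    proof -
      have "card T = card (T \<inter> X) + card (T - X)" by (rule card_Int_Diff[OF fT])
      then have "k \<le> int (card (T - X))" using that n by linarith
      then have "real_of_int k \<le> real_of_int (int (card (T - X)))" using of_int_le_iff by blast
      then show ?thesis by simp
    qed
    show ?thesis
    proof (cases "N \<le> n")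
      case True
      have "c * real (card T) * (real_of_int k)\<^sup>2 \<le> real (card (spanned_planes T))"
      proof (rule large[OF fT])
        show "\<forall>L M. skew_lines L M \<longrightarrow> real_of_int k \<le> real (card (T - L - M))"
        proof (intro allI impI)
          fix L M :: "(real ^ 3) set"
          assume "skew_lines L M"
          moreover have "T - L - M = T - (L \<union> M)" by auto
          ultimately show "real_of_int k \<le> real (card (T - L - M))" using diff[OF HS] by simp
        qed
      qed (use True n k1 HP diff in auto)
      moreover have "d * (real n * (of_int k)\<^sup>2) \<le> c * (real n * (of_int k)\<^sup>2)"
        using d by (intro mult_right_mono) auto
      ultimately show ?thesis using n by simp
    next
      case False
      have np: "\<not> T \<subseteq> P" if "plane P" for P
      proof
        assume "T \<subseteq> P"
        then have "T \<inter> P = T" by auto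
        then show False using HP[OF that] n k1 by simp
      qed
      have "1 \<le> real (card (spanned_planes T))" using spanned_planes_nonempty[OF fT np] by simp
      moreover have "d * real n * (of_int k)\<^sup>2 \<le> 1"
      proof -
        obtain P0 :: "(real ^ 3) set" where P0: "plane P0"
          using line_in_some_plane[OF lines_ofI[of 0 UNIV "axis 1 1"]] by (auto simp: axis_eq_0_iff)
        have "k \<le> int n" using HP[OF P0] by linarith
        then have "real_of_int k \<le> real n" using of_int_le_iff[of k "int n"] by simp
        then have kN: "real_of_int k \<le> real N + 1" "real n \<le> real N + 1" using False by auto
        have "d * real n * (of_int k)\<^sup>2 = d * (real n * (of_int k)\<^sup>2)" by simp
        also have "\<dots> \<le> 1 / (real N + 1)^3 * ((real N + 1) * (real N + 1)\<^sup>2)"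
          using d kN k by (intro mult_mono power_mono) auto
        also have "\<dots> = 1" by (simp add: power2_eq_square power3_eq_cube)
        finally show ?thesis .
      qed
      ultimately show ?thesis by linarith
    qed
  qed simp
  then show ?thesis using d(1) by blast
qed

end
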